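(* Let $\lambda\in\mathbb{R}$ be the modulus of convexity of $V$, i.e. $\nabla^2V\ge\lambda\mathbf 1$ on $\Omega$. For each $\mathfrak{T}\in\mathrm{Diff}^+$, the functional $\mathfrak{t}\mapsto\mathbf{E}(\mathfrak{t}\circ\mathfrak{T})$ is $\lambda$-convex on $\nabla\mathfrak{X}$ in the usual (flat) sense with respect to $L^2(\mathfrak{T}_\#\bar u)$; that is, for all $\mathfrak{t}_0,\mathfrak{t}_1\in\nabla\mathfrak{X}$ and all $s\in[0,1]$, with $\mathfrak{t}_s=(1-s)\mathfrak{t}_0+s\mathfrak{t}_1$, $$\mathbf{E}(\mathfrak{t}_s\circ\mathfrak{T})\le(1-s)\,\mathbf{E}(\mathfrak{t}_0\circ\mathfrak{T})+s\,\mathbf{E}(\mathfrak{t}_1\circ\mathfrak{T})-\frac{\lambda}{2}s(1-s)\,\|\mathfrak{t}_1-\mathfrak{t}_0\|^2_{L^2(\mathfrak{T}_\#\bar u)}.$$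
   Context: $\Omega=(0,1)^d$. The pressure $\mathrm{P}:\mathbb{R}_{\ge0}\to\mathbb{R}$ is continuous, smooth on $\mathbb{R}_{>0}$ and strictly increasing. The function $h:\mathbb{R}_{\ge0}\to\mathbb{R}$ is defined (up to an affine normalization) by $\mathrm{P}'(r)=r\,h''(r)$ for all $r>0$, and $h_*(s)=s\,h(1/s)$ for $s>0$, with the convention $h_*'(s)=-\mathrm{P}(1/s)$. The potential $V:\Omega\to\mathbb{R}$ is smooth (up to the boundary). $\bar u:\Omega\to(0,\infty)$ is a fixed reference density of total mass $M$; measures with densities are identified with their densities. $\mathrm{Diff}^+$ is the class of orientation-preserving $C^1$-diffeomorphisms of $\overline\Omega$ onto itself that fix the corners. For a density $\bar u$ and a map $\mathfrak{T}$, $\mathfrak{T}_\#\bar u$ is the push-forward; for a diffeomorphism, $\mathfrak{T}_\#\bar u=\frac{\bar u}{\det \mathrm{D}\mathfrak{T}}\circ\mathfrak{T}^{-1}$. The relative entropy is $\mathbb{E}(u)=\int_\Omega h(u(x))\,\mathrm{d}x+\int_\Omega u(x)V(x)\,\mathrm{d}x$, and $\mathbf{E}(\mathfrak{T})=\mathbb{E}(\mathfrak{T}_\#\bar u)$, with value $+\infty$ allowed (in particular if $\mathfrak{T}_\#\bar u$ has no density); for diffeomorphisms $\mathbf{E}(\mathfrak{T})=\int_\Omega\big[h_*\big(\tfrac{\det \mathrm{D}\mathfrak{T}}{\bar u}\big)+V\circ\mathfrak{T}\big]\bar u\,\mathrm{d}x$. $\mathfrak{X}=\{\phi:\overline\Omega\to\mathbb{R}\,;\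 \phi \text{ convex},\ \nabla\phi(\Omega)\subseteq\Omega\}$, and $\nabla\mathfrak{X}=\{\nabla\phi\,;\ \phi\in\mathfrak{X}\}$.
   Formalization: McCann's condition is added: r ↦ (P(r)−P(0))/r^(1−1/d) is nondecreasing on r>0 (automatic for d=1); without it the claim fails, e.g. d=2, P(r)=r^(1/3), V=0, λ=0, ū=1, T=id, t_a(x)=ax, where E(t_a)=−(3/2)a^(4/3) is strictly concave. *)

theory Defs
  imports "HOL-Analysis.Analysis"
begin

definition cube :: "(real ^ 'n) set" where
  "cube = {x. \<forall>i. 0 < x $ i \<and> x $ i < 1}"

text \<open>
  Derivatives are taken within \<open>S\<close>. For an open set this is the ordinary notion; for the closed
  cube it is differentiability up to the boundary, where derivatives within the set are
  unique. \<open>g b\<close> is the partial derivative of \<open>f\<close> in the basis direction \<open>b\<close>.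
\<close>

primrec Ck_on :: "nat \<Rightarrow> 'a::euclidean_space set \<Rightarrow> ('a \<Rightarrow> real) \<Rightarrow> bool" where
  "Ck_on 0 S f \<longleftrightarrow> continuous_on S f"
| "Ck_on (Suc k) S f \<longleftrightarrow>
     (\<exists>g. (\<forall>x\<in>S. (f has_derivative (\<lambda>v. \<Sum>b\<in>Basis. (v \<bullet> b) * g b x)) (at x within S)) \<and>
          (\<forall>b\<in>Basis. Ck_on k S (g b)))"

definition smooth_on :: "'a::euclidean_space set \<Rightarrow> ('a \<Rightarrow> real) \<Rightarrow> bool" where
  "smooth_on S f \<longleftrightarrow> (\<forall>k. Ck_on k S f)"

definition C1_map_on :: "(real ^ 'n) set \<Rightarrow> (real ^ 'n \<Rightarrow> real ^ 'n) \<Rightarrow> bool" where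
  "C1_map_on S F \<longleftrightarrow> (\<forall>i. Ck_on 1 S (\<lambda>x. F x $ i))"

definition hessian :: "(real ^ 'n \<Rightarrow> real) \<Rightarrow> real ^ 'n \<Rightarrow> real ^ 'n ^ 'n" where
  "hessian f x = (\<chi> i j. frechet_derivative
      (\<lambda>y. frechet_derivative f (at y) (axis j 1)) (at x) (axis i 1))"

definition pressure :: "(real \<Rightarrow> real) \<Rightarrow> bool" where
  "pressure P \<longleftrightarrow> continuous_on {0..} P \<and> smooth_on {0<..} P \<and> strict_mono_on {0..} P"

definition hstar :: "(real \<Rightarrow> real) \<Rightarrow> real \<Rightarrow> real" where
  "hstar h s = s * h (1 / s)"

text \<open>
  The last conjunct normalizes \<open>h\<close>: it says \<open>P r = r * h' r - h r\<close>. Then \<open>h\<close> has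
  the limit \<open>- P 0\<close> at \<open>0\<close>, and continuity makes this its value there.
\<close>

definition internal_energy :: "(real \<Rightarrow> real) \<Rightarrow> (real \<Rightarrow> real) \<Rightarrow> bool" where
  "internal_energy P h \<longleftrightarrow>
     continuous_on {0..} h \<and> smooth_on {0<..} h \<and>
     (\<forall>r>0. deriv P r = r * deriv (deriv h) r) \<and>
     (\<forall>s>0. (hstar h has_real_derivative - P (1 / s)) (at s))"

text \<open>
  McCann's condition in dimension \<open>d\<close>. It is equivalent to
  \<open>s \<mapsto> s ^ d * (h (1 / s ^ d) - h 0)\<close> being convex and nonincreasing on the positive reals.
  Subtracting \<open>P 0\<close> makes it independent of the affine normalization of \<open>h\<close>. For \<open>d = 1\<close> it
  holds for every increasing \<open>P\<close>. For \<open>d \<ge> 2\<close> the entropy is in general not convex along the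
  dilations \<open>x \<mapsto> a *\<^sub>R x\<close> without it, e.g. for \<open>d = 2\<close> and \<open>P r = r powr (1/3)\<close>.
\<close>

definition McCann_condition :: "nat \<Rightarrow> (real \<Rightarrow> real) \<Rightarrow> bool" where
  "McCann_condition d P \<longleftrightarrow> mono_on {0<..} (\<lambda>r. (P r - P 0) / r powr (1 - 1 / real d))"

definition corners :: "(real ^ 'n) set" where
  "corners = {x. \<forall>i. x $ i = 0 \<or> x $ i = 1}"

definition Diff_plus :: "(real ^ 'n \<Rightarrow> real ^ 'n) set" where
  "Diff_plus = {T.
     bij_betw T (closure cube) (closure cube) \<and>
     C1_map_on (closure cube) T \<and>
     C1_map_on (closure cube) (inv_into (closure cube) T) \<and>
     (\<forall>x\<in>closure cube. 0 < det (matrix (frechet_derivative T (at x within closure cube)))) \<and>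
     (\<forall>x\<in>corners. T x = x)}"

text \<open>
  A convex function need not be differentiable everywhere. The range condition is imposed
  wherever the gradient exists.
\<close>

definition convex_potentials :: "(real ^ 'n \<Rightarrow> real) set" where
  "convex_potentials = {\<phi>. convex_on (closure cube) \<phi> \<and>
     (\<forall>x\<in>cube. \<forall>p. GDERIV \<phi> x :> p \<longrightarrow> p \<in> cube)}"

text \<open>
  A convex function is differentiable almost everywhere in the cube, so its gradient is
  an almost everywhere defined map. The set contains all its Borel representatives.
\<close>

definition convex_gradients :: "(real ^ 'n \<Rightarrow> real ^ 'n) set" where
  "convex_gradients = {t \<in> borel_measurable borel.
     \<exists>\<phi>\<in>convex_potentials. AE x in lebesgue_on cube. GDERIV \<phi> x :> t x}"

definition push_forward ::
    "(real ^ 'n \<Rightarrow> real) \<Rightarrow> (real ^ 'n \<Rightarrow> real ^ 'n) \<Rightarrow> (real ^ 'n) measure" where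
  "push_forward u T = distr (density (lebesgue_on cube) (\<lambda>x. ennreal (u x))) borel T"

text \<open>
  Integral with values in the extended reals, positive part minus negative part
  (\<open>ennreal\<close> truncates negative numbers to \<open>0\<close>).
\<close>

definition ext_integral :: "'a measure \<Rightarrow> ('a \<Rightarrow> real) \<Rightarrow> ereal" where
  "ext_integral M f =
     enn2ereal (\<integral>\<^sup>+x. ennreal (f x) \<partial>M) - enn2ereal (\<integral>\<^sup>+x. ennreal (- f x) \<partial>M)"

definition relative_entropy ::
    "(real \<Rightarrow> real) \<Rightarrow> (real ^ 'n \<Rightarrow> real) \<Rightarrow> (real ^ 'n \<Rightarrow> real) \<Rightarrow> ereal" where
  "relative_entropy h V u =
     ext_integral (lebesgue_on cube) (\<lambda>x. h (u x)) +
     ext_integral (lebesgue_on cube) (\<lambda>x. u x * V x)"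

definition map_entropy ::
    "(real \<Rightarrow> real) \<Rightarrow> (real ^ 'n \<Rightarrow> real) \<Rightarrow> (real ^ 'n \<Rightarrow> real) \<Rightarrow>
     (real ^ 'n \<Rightarrow> real ^ 'n) \<Rightarrow> ereal" where
  "map_entropy h V ubar T =
     (if \<exists>u\<in>borel_measurable lborel. density lborel u = push_forward ubar T
      then relative_entropy h V (\<lambda>x. enn2real (RN_deriv lborel (push_forward ubar T) x))
      else \<infinity>)"

end

theory Submission
  imports Defs
begin

text \<open>
  McCann's displacement convexity. The push-forward of \<open>ubar\<close> by \<open>T\<close> has a density \<open>\<rho>\<close>, so it suffices to
  compare the entropies of the images of \<open>\<rho>\<close> under \<open>t\<^sub>0\<close>, \<open>t\<^sub>1\<close> and \<open>t\<^sub>s\<close>. The resolvent of the gradient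
  \<open>t\<close> of a convex function is Lipschitz, so by Rademacher's theorem and Sard's lemma \<open>t\<close> is
  differentiable within a set of full measure at almost every point, with a positive semidefinite
  derivative, which is symmetric because \<open>t\<close> is cyclically monotone. Where the images of \<open>\<rho>\<close>
  under \<open>t\<^sub>0\<close> and \<open>t\<^sub>1\<close> have densities, both derivatives are nondegenerate almost everywhere, and the
  maps \<open>t\<^sub>0\<close>, \<open>t\<^sub>1\<close>, \<open>t\<^sub>s\<close> are then injective by monotonicity. The change of variables turns the internal
  energy into the integral of a function of the Jacobian which, by McCann's condition, is convex and
  nonincreasing in the \<open>n\<close>-th root of the Jacobian. Minkowski's determinant inequality says that this
  root is concave in the derivative.
\<close>

subsection \<open>Sard's lemma and change of variables for arbitrary finite index types\<close>

text \<open>A map in \<open>convex_gradients\<close> is determined only almost everywhere, so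
  differentiability at a point in the full sense is out of reach; every derivative is taken within a
  set of full measure. This is enough because such a set is dense, so that difference quotients
  along it still see every direction, and because the area formula holds for derivatives within a
  measurable set on which the map is injective. Since only \<open>t\<close> is differentiated and no
  second-order expansion of its potential is at hand, symmetry of the derivative has to be extracted
  from cyclic monotonicity; Minkowski's inequality depends on it. The internal energy is handled as
  the integral of \<open>h (u x) - h 0\<close>: this integrand vanishes where the density does, so
  the part of the cube outside the image of a map contributes nothing, while \<open>h 0\<close> adds
  a constant common to all maps. Infinite values are harmless because \<open>h r - h 0\<close> is
  bounded below by a negative multiple of \<open>1 + r\<close>: the entropies that occur are real or
  plus infinity, never minus infinity.\<close>

text \<open>
  Sard's lemma and the change of variables formula are available only for index types of sort
  \<open>wellorder\<close>. They are transferred to an arbitrary finite index type through a well-ordered copy of it.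
\<close>

typedef 'a wo_index = "UNIV :: 'a set" by simp

instance wo_index :: (finite) finite
proof
  show "finite (UNIV :: 'a wo_index set)"
    by (rule finite_surj[of "UNIV :: 'a set" _ Abs_wo_index])
      (auto intro: rev_image_eqI[of "Rep_wo_index x" for x] simp: Rep_wo_index_inverse)
qed

lemma bij_Rep_wo_index: "bij Rep_wo_index"
  by (metis Abs_wo_index_inverse Rep_wo_index_inverse UNIV_I bijI')

lemma CARD_wo_index: "CARD('a wo_index) = CARD('a)"
  using bij_betw_same_card[OF bij_Rep_wo_index] .

instantiation wo_index :: (finite) wellorder
begin

definition "x \<le> y \<longleftrightarrow> to_nat_on UNIV (Rep_wo_index x) \<le> to_nat_on UNIV (Rep_wo_index y)"
definition "x < y \<longleftrightarrow> to_nat_on UNIV (Rep_wo_index x) < to_nat_on UNIV (Rep_wo_index y)"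

instance
proof
  fix x y z :: "'a wo_index"
  have inj: "x = y" if "to_nat_on UNIV (Rep_wo_index x) = to_nat_on UNIV (Rep_wo_index y)" for x y :: "'a wo_index"
    using that to_nat_on_inj[of "UNIV :: 'a set"] by (simp add: countable_finite Rep_wo_index_inject)
  show "x < y \<longleftrightarrow> x \<le> y \<and> \<not> y \<le> x" by (auto simp: less_eq_wo_index_def less_wo_index_def)
  show "x \<le> x" by (simp add: less_eq_wo_index_def)
  show "x \<le> y \<Longrightarrow> y \<le> z \<Longrightarrow> x \<le> z" by (simp add: less_eq_wo_index_def)
  show "x \<le> y \<Longrightarrow> y \<le> x \<Longrightarrow> x = y" using inj by (simp add: less_eq_wo_index_def)
  show "x \<le> y \<or> y \<le> x" by (auto simp: less_eq_wo_index_def)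
  fix P and a :: "'a wo_index"
  assume *: "\<And>x. (\<And>y. y < x \<Longrightarrow> P y) \<Longrightarrow> P (x :: 'a wo_index)"
  show "P a"
    by (induction "to_nat_on UNIV (Rep_wo_index a)" arbitrary: a rule: less_induct)
      (use * in \<open>auto simp: less_wo_index_def\<close>)
qed

end

section \<open>Determinants under relabelling of the index set\<close>

lemma permutes_conj_bij:
  assumes f: "bij f" and p: "p permutes UNIV"
  shows "(inv f \<circ> p \<circ> f) permutes UNIV"
  by (rule bij_imp_permutes) (simp_all add: bij_comp[OF bij_comp[OF f permutes_bij[OF p]] bij_imp_bij_inv[OF f]] comp_assoc)

text \<open>Conjugation turns the transposition of \<open>a\<close> and \<open>b\<close> into that
  of \<open>inv f a\<close> and \<open>inv f b\<close>, so the sign can be followed through a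
  product of transpositions. The two permutations live on different types, hence the induction
  instead of multiplicativity of the sign.\<close>

lemma sign_conj_bij:
  fixes f :: "'m::finite \<Rightarrow> 'n::finite"
  assumes f: "bij f" and p: "p permutes UNIV"
  shows "sign (inv f \<circ> p \<circ> f) = sign p"
proof -
  have "finite (UNIV :: 'n set)" by simp
  from p this show ?thesis
  proof (induction p rule: permutes_induct)
    case id
    then show ?case using f by (simp add: bij_def id_def[symmetric] comp_def inv_f_f)
  next
    case (swap a b p)
    have eq: "inv f \<circ> (Transposition.transpose a b \<circ> p) \<circ> f = Transposition.transpose (inv f a) (inv f b) \<circ> (inv f \<circ> p \<circ> f)"
      using f by (auto simp: fun_eq_iff Transposition.transpose_def bij_def inv_f_f surj_f_inv_f)
         (metis surj_f_inv_f)+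
    have ab: "inv f a = inv f b \<longleftrightarrow> a = b" using f by (metis bij_inv_eq_iff)
    have q: "(inv f \<circ> p \<circ> f) permutes (UNIV :: 'm set)"
      by (rule permutes_conj_bij[OF f]) (use swap in simp)
    have perm: "permutation r" if "r permutes (UNIV :: 'k set)" "finite (UNIV :: 'k set)" for r :: "'k \<Rightarrow> 'k"
      using that by (auto simp: permutation_permutes)
    have p: "permutation p" "permutation (inv f \<circ> p \<circ> f)"
      using perm[OF q] perm[of p] swap.hyps by auto
    show ?case unfolding eq sign_compose[OF permutation_swap_id p(1)] sign_compose[OF permutation_swap_id p(2)]
      using swap by (simp add: sign_swap_id ab comp_def)
  qed
qed

text \<open>In the Leibniz formula, conjugation by \<open>f\<close> is a sign-preserving bijection
  between the permutations of the two index types.\<close>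

lemma det_reindex:
  fixes f :: "'m::finite \<Rightarrow> 'n::finite" and A :: "real^'n^'n"
  assumes f: "bij f"
  shows "det (\<chi> i j. A $ f i $ f j) = det A"
proof -
  have inj: "f (inv f y) = y" "inv f (f x) = x" for x y
    using f by (auto simp: bij_def surj_f_inv_f inv_f_f)
  have "det A = (\<Sum>p | p permutes UNIV. of_int (sign p) * (\<Prod>i\<in>UNIV. A $ i $ p i))"
    by (simp add: det_def)
  also have "\<dots> = (\<Sum>p | p permutes (UNIV::'m set). of_int (sign p) * (\<Prod>i\<in>UNIV. A $ f i $ f (p i)))"
  proof (rule sum.reindex_bij_witness[where i="\<lambda>p. f \<circ> p \<circ> inv f" and j="\<lambda>p. inv f \<circ> p \<circ> f"])
    fix p :: "'n \<Rightarrow> 'n" assume "p \<in> {p. p permutes UNIV}"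
    then have p: "p permutes UNIV" by simp
    show "f \<circ> (inv f \<circ> p \<circ> f) \<circ> inv f = p" by (simp add: fun_eq_iff inj)
    show "inv f \<circ> p \<circ> f \<in> {p. p permutes UNIV}"
      using permutes_conj_bij[OF f p] by simp
    have "(\<Prod>i\<in>UNIV. A $ f i $ f ((inv f \<circ> p \<circ> f) i)) = (\<Prod>i\<in>UNIV. A $ i $ p i)"
      using prod.reindex_bij_betw[OF f, of "\<lambda>i. A $ i $ p i"] by (simp add: inj)
    then show "of_int (sign (inv f \<circ> p \<circ> f)) * (\<Prod>i\<in>UNIV. A $ f i $ f ((inv f \<circ> p \<circ> f) i)) =
         of_int (sign p) * (\<Prod>i\<in>UNIV. A $ i $ p i)"
      by (simp only: sign_conj_bij[OF f p])
  next
    fix p :: "'m \<Rightarrow> 'm" assume "p \<in> {p. p permutes UNIV}"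
    then have p: "p permutes UNIV" by simp
    show "inv f \<circ> (f \<circ> p \<circ> inv f) \<circ> f = p" by (simp add: fun_eq_iff inj)
    show "f \<circ> p \<circ> inv f \<in> {p. p permutes UNIV}"
      using permutes_conj_bij[OF bij_imp_bij_inv[OF f] p] by (simp add: inv_inv_eq[OF f])
  qed
  also have "\<dots> = det (\<chi> i j. A $ f i $ f j)"
    by (simp add: det_def)
  finally show ?thesis by simp
qed

section \<open>Transfer of Lebesgue measure, null sets and derivatives\<close>

definition to_wo :: "real^'n \<Rightarrow> real^('n::finite wo_index)" where
  "to_wo x = (\<chi> i. x $ Rep_wo_index i)"

definition of_wo :: "real^('n::finite wo_index) \<Rightarrow> real^'n" where
  "of_wo x = (\<chi> i. x $ Abs_wo_index i)"

lemma of_to_wo [simp]: "of_wo (to_wo x) = x"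
  by (simp add: of_wo_def to_wo_def Abs_wo_index_inverse vec_eq_iff)

lemma to_of_wo [simp]: "to_wo (of_wo x) = x"
  by (simp add: of_wo_def to_wo_def Rep_wo_index_inverse vec_eq_iff)

lemma bounded_linear_to_wo: "bounded_linear to_wo"
  unfolding to_wo_def by (auto intro!: linear_conv_bounded_linear[THEN iffD1] linearI simp: vec_eq_iff)

lemma bounded_linear_of_wo: "bounded_linear of_wo"
  unfolding of_wo_def by (auto intro!: linear_conv_bounded_linear[THEN iffD1] linearI simp: vec_eq_iff)

lemma to_wo_image: "to_wo ` S = of_wo -` S"
  by (force simp: image_iff)

lemma det_to_wo:
  fixes f :: "real^'n \<Rightarrow> real^'n"
  shows "det (matrix (to_wo \<circ> f \<circ> of_wo)) = det (matrix f)"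
proof -
  have "of_wo (axis j 1) $ i = (axis (Rep_wo_index j) 1 :: real^'n) $ i" for i and j :: "'n wo_index"
    by (auto simp: of_wo_def axis_def vec_eq_iff Abs_wo_index_inverse Rep_wo_index_inverse)
  then have ax: "of_wo (axis j 1) = (axis (Rep_wo_index j) 1 :: real^'n)" for j :: "'n wo_index" by (simp add: vec_eq_iff)
  have "matrix (to_wo \<circ> f \<circ> of_wo) = (\<chi> i j. matrix f $ Rep_wo_index i $ Rep_wo_index j)"
    unfolding matrix_def vec_eq_iff comp_apply ax by (simp add: to_wo_def)
  then show ?thesis using det_reindex[OF bij_Rep_wo_index, of "matrix f"] by simp
qed

text \<open>Relabelling coordinates takes boxes to boxes with the same side lengths in another
  order, and Lebesgue measure is determined by its values on boxes.\<close>

lemma lborel_distr_of_wo: "distr lborel borel of_wo = (lborel :: (real^'n) measure)"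
proof (rule lborel_eqI[symmetric])
  fix l u :: "real^'n" assume lu: "\<And>b. b \<in> Basis \<Longrightarrow> l \<bullet> b \<le> u \<bullet> b"
  have [measurable]: "of_wo \<in> borel_measurable borel"
    by (intro borel_measurable_continuous_onI linear_continuous_on bounded_linear_of_wo)
  have box: "of_wo -` box l u = box (to_wo l) (to_wo u)"
  proof (intro set_eqI iffI)
    fix x assume "x \<in> of_wo -` box l u"
    then have "l $ i < x $ Abs_wo_index i \<and> x $ Abs_wo_index i < u $ i" for i
      by (simp add: mem_box_cart of_wo_def)
    from this[of "Rep_wo_index _"] show "x \<in> box (to_wo l) (to_wo u)"
      by (simp add: mem_box_cart to_wo_def Rep_wo_index_inverse)
  next
    fix x assume "x \<in> box (to_wo l) (to_wo u)"
    then have "l $ Rep_wo_index i < x $ i \<and> x $ i < u $ Rep_wo_index i" for i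
      by (simp add: mem_box_cart to_wo_def)
    from this[of "Abs_wo_index _"] show "x \<in> of_wo -` box l u"
      by (simp add: mem_box_cart of_wo_def Abs_wo_index_inverse)
  qed
  have lu': "l $ i \<le> u $ i" for i using lu[of "axis i 1"] by (simp add: inner_axis)
  have "emeasure (distr lborel borel of_wo) (box l u) = emeasure lborel (box (to_wo l) (to_wo u))"
    by (subst emeasure_distr) (auto simp: box)
  also have "\<dots> = (\<Prod>b\<in>Basis. (to_wo u - to_wo l) \<bullet> b)"
    by (rule emeasure_lborel_box) (auto simp: Basis_vec_def inner_axis to_wo_def lu')
  also have "(\<Prod>b\<in>Basis. (to_wo u - to_wo l) \<bullet> b) = (\<Prod>i\<in>UNIV. u $ i - l $ i)"
    using prod.reindex_bij_betw[OF bij_Rep_wo_index, of "\<lambda>i. u $ i - l $ i"]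
    by (simp add: Basis_vec_def prod.UNION_disjoint axis_eq_axis inner_axis to_wo_def)
  also have "\<dots> = (\<Prod>b\<in>Basis. (u - l) \<bullet> b)"
    by (simp add: Basis_vec_def prod.UNION_disjoint axis_eq_axis inner_axis)
  finally show "emeasure (distr lborel borel of_wo) (box l u) = ennreal (\<Prod>b\<in>Basis. (u - l) \<bullet> b)" .
qed simp

lemma lebesgue_distr_of_wo: "distr lebesgue lebesgue of_wo = (lebesgue :: (real^'n) measure)"
  and measurable_of_wo: "of_wo \<in> (lebesgue :: (real^'n wo_index) measure) \<rightarrow>\<^sub>M (lebesgue :: (real^'n) measure)"
proof -
  have borel: "of_wo \<in> (borel :: (real^'n wo_index) measure) \<rightarrow>\<^sub>M (borel :: (real^'n) measure)"
    by (intro borel_measurable_continuous_onI linear_continuous_on bounded_linear_of_wo)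
  have eq: "distr lebesgue lborel of_wo = (lborel :: (real^'n) measure)"
  proof -
    have "distr lebesgue lborel of_wo = (distr lborel lborel of_wo :: (real^'n) measure)"
      using borel by (intro distr_completion) simp
    also have "\<dots> = distr lborel borel of_wo" by (rule distr_cong) auto
    finally show ?thesis by (simp add: lborel_distr_of_wo)
  qed
  have meas: "of_wo \<in> (lebesgue :: (real^'n wo_index) measure) \<rightarrow>\<^sub>M (lborel :: (real^'n) measure)"
    using borel by (simp add: measurable_completion)
  show "distr lebesgue lebesgue of_wo = (lebesgue :: (real^'n) measure)"
    using completion.completion_distr_eq[OF meas] eq by simp
  show "of_wo \<in> (lebesgue :: (real^'n wo_index) measure) \<rightarrow>\<^sub>M (lebesgue :: (real^'n) measure)"
    using completion.measurable_completion2[OF meas] eq by simp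
qed

lemma emeasure_to_wo_image:
  assumes "S \<in> sets lebesgue"
  shows "to_wo ` S \<in> sets lebesgue" "emeasure lebesgue (to_wo ` S) = emeasure lebesgue (S :: (real^'n) set)"
proof -
  show "to_wo ` S \<in> sets lebesgue"
    unfolding to_wo_image using measurable_sets[OF measurable_of_wo assms] by simp
  show "emeasure lebesgue (to_wo ` S) = emeasure lebesgue S"
    unfolding to_wo_image
    by (subst (2) lebesgue_distr_of_wo[symmetric]) (simp add: emeasure_distr measurable_of_wo assms)
qed

lemma negligible_to_wo_image: "negligible (to_wo ` S) \<Longrightarrow> negligible S"
proof -
  assume "negligible (to_wo ` S)"
  then have "negligible (of_wo ` to_wo ` S)"
    by (rule negligible_differentiable_image_negligible[rotated])
      (auto simp: CARD_wo_index linear_imp_differentiable_on bounded_linear_of_wo bounded_linear.linear)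
  then show ?thesis by (simp add: image_image)
qed

lemma has_derivative_to_wo:
  fixes g :: "real^'n \<Rightarrow> real^'n"
  assumes "(g has_derivative g') (at (of_wo y) within S)"
  shows "(to_wo \<circ> g \<circ> of_wo has_derivative to_wo \<circ> g' \<circ> of_wo) (at y within to_wo ` S)"
proof -
  have im: "of_wo ` to_wo ` S = S" by (simp add: image_image)
  have "(g \<circ> of_wo has_derivative g' \<circ> of_wo) (at y within to_wo ` S)"
    by (rule diff_chain_within[OF bounded_linear_imp_has_derivative[OF bounded_linear_of_wo]])
      (simp only: im assms)
  then have "(to_wo \<circ> (g \<circ> of_wo) has_derivative to_wo \<circ> (g' \<circ> of_wo)) (at y within to_wo ` S)"
    by (rule diff_chain_within) (rule bounded_linear_imp_has_derivative[OF bounded_linear_to_wo])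
  then show ?thesis by (simp add: comp_assoc)
qed

text \<open>Sard's lemma in equal dimensions: a vanishing determinant is a rank deficit. The set is
  arbitrary and the derivative is only within it, which suits the exceptional sets that occur
  later.\<close>

lemma negligible_image_det_zero:
  fixes g :: "real^'n \<Rightarrow> real^'n"
  assumes der: "\<And>x. x \<in> S \<Longrightarrow> (g has_derivative g' x) (at x within S)"
    and det: "\<And>x. x \<in> S \<Longrightarrow> det (matrix (g' x)) = 0"
  shows "negligible (g ` S)"
proof -
  have "negligible ((to_wo \<circ> g \<circ> of_wo) ` to_wo ` S)"
  proof (rule baby_Sard[OF order_refl, where f' = "\<lambda>y. to_wo \<circ> g' (of_wo y) \<circ> of_wo"])
    fix y assume "y \<in> to_wo ` S"
    then have y: "of_wo y \<in> S" by auto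
    show "(to_wo \<circ> g \<circ> of_wo has_derivative to_wo \<circ> g' (of_wo y) \<circ> of_wo) (at y within to_wo ` S)"
      by (rule has_derivative_to_wo[OF der[OF y]])
    have "det (matrix (to_wo \<circ> g' (of_wo y) \<circ> of_wo)) = 0"
      by (simp only: det_to_wo det[OF y])
    then show "rank (matrix (to_wo \<circ> g' (of_wo y) \<circ> of_wo)) < CARD('n wo_index)"
      by (simp only: det_eq_0_rank)
  qed
  then show ?thesis by (rule_tac negligible_to_wo_image) (simp add: image_image)
qed

text \<open>The area formula in \<open>ennreal\<close>. When the Jacobian is not integrable, the
  measurable image cannot have finite measure, so both sides are infinite; otherwise the identity is
  one between finite numbers.\<close>

lemma differentiable_image_emeasure_wo:
  fixes g :: "real^'n::{finite,wellorder} \<Rightarrow> real^'n::_"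
  assumes S: "S \<in> sets lebesgue"
    and der: "\<And>x. x \<in> S \<Longrightarrow> (g has_derivative g' x) (at x within S)"
    and inj: "inj_on g S"
  shows "g ` S \<in> sets lebesgue" (is ?thesis1)
    and "(\<lambda>x. det (matrix (g' x))) \<in> borel_measurable (lebesgue_on S)" (is ?thesis2)
    and "emeasure lebesgue (g ` S) = (\<integral>\<^sup>+x\<in>S. ennreal \<bar>det (matrix (g' x))\<bar> \<partial>lebesgue)" (is ?thesis3)
proof -
  show 1: ?thesis1
    using der by (intro differentiable_image_in_sets_lebesgue[OF S]) (auto simp: differentiable_on_def differentiable_def)
  show 2: ?thesis2
    by (rule borel_measurable_det_Jacobian[OF S der])
  have I: "(\<integral>\<^sup>+x\<in>S. ennreal \<bar>det (matrix (g' x))\<bar> \<partial>lebesgue) = (\<integral>\<^sup>+x. ennreal \<bar>det (matrix (g' x))\<bar> \<partial>lebesgue_on S)"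
    using S by (simp add: nn_integral_restrict_space)
  show ?thesis3
  proof (cases "(\<lambda>x. \<bar>det (matrix (g' x))\<bar>) integrable_on S")
    case True
    have lm: "g ` S \<in> lmeasurable" using True measurable_differentiable_image_eq[OF S der inj] by blast
    then have "(\<lambda>x. \<bar>det (matrix (g' x))\<bar>) absolutely_integrable_on S"
      using measurable_differentiable_image_alt[OF S der inj] by blast
    then have ai: "integrable (lebesgue_on S) (\<lambda>x. \<bar>det (matrix (g' x))\<bar>)"
      using S by (subst integrable_restrict_space) (simp_all add: set_integrable_def)
    have "emeasure lebesgue (g ` S) = ennreal (measure lebesgue (g ` S))"
      by (rule emeasure_eq_measure2[OF lm])
    also have "measure lebesgue (g ` S) = integral S (\<lambda>x. \<bar>det (matrix (g' x))\<bar>)"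
      by (rule measure_differentiable_image_eq[OF S der inj True])
    also have "\<dots> = (\<integral>x. \<bar>det (matrix (g' x))\<bar> \<partial>lebesgue_on S)"
      using lebesgue_integral_eq_integral[OF ai S] by simp
    also have "ennreal \<dots> = (\<integral>\<^sup>+x. ennreal \<bar>det (matrix (g' x))\<bar> \<partial>lebesgue_on S)"
      using ai by (intro nn_integral_eq_integral[symmetric]) auto
    finally show ?thesis using I by simp
  next
    case False
    then have "g ` S \<notin> lmeasurable" using measurable_differentiable_image_eq[OF S der inj] by simp
    then have inf: "emeasure lebesgue (g ` S) = \<infinity>"
      using 1 by (auto simp: fmeasurable_def simp del: emeasure_completion)
        (metis infinity_ennreal_def less_top)
    have "\<not> integrable (lebesgue_on S) (\<lambda>x. \<bar>det (matrix (g' x))\<bar>)"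
      using False S integrable_on_lebesgue_on by blast
    then have "(\<integral>\<^sup>+x. ennreal \<bar>det (matrix (g' x))\<bar> \<partial>lebesgue_on S) = \<infinity>"
      using 2 by (subst (asm) integrable_iff_bounded) (auto simp: less_top[symmetric])
    then show ?thesis using I inf by simp
  qed
qed

lemma differentiable_image_emeasure:
  fixes g :: "real^'n \<Rightarrow> real^'n"
  assumes S: "S \<in> sets lebesgue"
    and der: "\<And>x. x \<in> S \<Longrightarrow> (g has_derivative g' x) (at x within S)"
    and inj: "inj_on g S"
  shows "g ` S \<in> sets lebesgue" (is ?thesis1)
    and "(\<lambda>x. det (matrix (g' x))) \<in> borel_measurable (lebesgue_on S)" (is ?thesis2)
    and "emeasure lebesgue (g ` S) = (\<integral>\<^sup>+x\<in>S. ennreal \<bar>det (matrix (g' x))\<bar> \<partial>lebesgue)" (is ?thesis3)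
proof -
  let ?g = "to_wo \<circ> g \<circ> of_wo" and ?d = "\<lambda>x. det (matrix (g' x))"
  have d: "(?g has_derivative to_wo \<circ> g' (of_wo y) \<circ> of_wo) (at y within to_wo ` S)" if "y \<in> to_wo ` S" for y
    using that by (intro has_derivative_to_wo der) auto
  have i: "inj_on ?g (to_wo ` S)"
    using inj by (auto simp: inj_on_def) (metis of_to_wo)
  have im: "?g ` to_wo ` S = to_wo ` g ` S" by (simp add: image_comp comp_def)
  note wo = differentiable_image_emeasure_wo[OF emeasure_to_wo_image(1)[OF S] d i]
  show 1: ?thesis1
    using der by (intro differentiable_image_in_sets_lebesgue[OF S]) (auto simp: differentiable_on_def differentiable_def)
  have det: "det (matrix (to_wo \<circ> g' (of_wo y) \<circ> of_wo)) = ?d (of_wo y)" for y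
    by (simp only: det_to_wo)
  have m: "(\<lambda>y. if y \<in> to_wo ` S then ?d (of_wo y) else 0) \<in> borel_measurable lebesgue"
    using wo(2) emeasure_to_wo_image(1)[OF S] unfolding det
    by (simp add: borel_measurable_if)
  \<comment> \<open>Measurability of the Jacobian is known on the copy and pulled back along
    \<open>to_wo\<close>; preimages under \<open>to_wo\<close> are linear images under
    \<open>of_wo\<close>, hence Lebesgue measurable.\<close>
  have tow: "to_wo \<in> (lebesgue :: (real^'n) measure) \<rightarrow>\<^sub>M lebesgue"
  proof (rule measurableI)
    fix A :: "(real^'n wo_index) set" assume A: "A \<in> sets lebesgue"
    have "to_wo -` A = of_wo ` A" by (force simp: image_iff)
    moreover have "of_wo ` A \<in> sets lebesgue"
      by (intro differentiable_image_in_sets_lebesgue[OF A])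
       (auto simp: CARD_wo_index linear_imp_differentiable_on bounded_linear_of_wo bounded_linear.linear)
    ultimately show "to_wo -` A \<inter> space lebesgue \<in> sets lebesgue" by simp
  qed simp
  have m2: "(\<lambda>x. if x \<in> S then ?d x else 0) \<in> borel_measurable lebesgue"
    using measurable_compose[OF tow m] by (simp add: to_wo_image cong: if_cong)
  then show ?thesis2
    using S by (simp add: borel_measurable_if)
  have "emeasure lebesgue (g ` S) = emeasure lebesgue (to_wo ` g ` S)"
    by (simp add: emeasure_to_wo_image(2)[OF 1])
  also have "\<dots> = (\<integral>\<^sup>+y\<in>to_wo ` S. ennreal \<bar>?d (of_wo y)\<bar> \<partial>lebesgue)"
    using wo(3) unfolding im det .
  also have "\<dots> = (\<integral>\<^sup>+y. ennreal \<bar>if of_wo y \<in> S then ?d (of_wo y) else 0\<bar> \<partial>lebesgue)"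
    by (intro nn_integral_cong) (auto simp: to_wo_image indicator_def)
  also have "\<dots> = (\<integral>\<^sup>+x. ennreal \<bar>if x \<in> S then ?d x else 0\<bar> \<partial>distr lebesgue lebesgue of_wo)"
    using m2 by (subst nn_integral_distr) (auto intro: measurable_of_wo)
  also have "\<dots> = (\<integral>\<^sup>+x\<in>S. ennreal \<bar>?d x\<bar> \<partial>lebesgue)"
    unfolding lebesgue_distr_of_wo by (intro nn_integral_cong) (auto simp: indicator_def)
  finally show ?thesis3 .
qed

subsection \<open>Rademacher's theorem\<close>

lemma negligible_borel_iff:
  assumes "A \<in> sets borel"
  shows "negligible A \<longleftrightarrow> emeasure lborel A = 0"
  using assms by (simp add: negligible_iff_emeasure0)

text \<open>Vitali's covering argument: disjoint stretched intervals cover \<open>E\<close> up to a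
  null set. Since \<open>F\<close> is increasing, their images are again disjoint intervals, and
  these stay in an open set that exceeds the image of \<open>E\<close> by measure less than
  \<open>e\<close>.\<close>

lemma Vitali_expansion:
  fixes F :: "real \<Rightarrow> real" and q :: real
  assumes F: "strict_mono F" "continuous_on UNIV F" "surj F"
    and E: "E \<in> sets borel" and FE: "F ` E \<in> sets borel" and "0 < q"
    and exp: "\<And>x d. x \<in> E \<Longrightarrow> 0 < d \<Longrightarrow> \<exists>a b. a < b \<and> x \<in> {a..b} \<and> b - a < d \<and> q * (b - a) < F b - F a"
  shows "ennreal q * emeasure lborel E \<le> emeasure lborel (F ` E)"
proof (rule ennreal_le_epsilon)
  fix e :: real assume "0 < e"
  obtain W where W: "open W" "F ` E \<subseteq> W" "emeasure lborel (W - F ` E) < e"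
    using outer_regular_lborel[OF FE \<open>0 < e\<close>] by blast
  define U where "U = F -` W"
  have U: "open U" "E \<subseteq> U"
    using W open_vimage[OF W(1) F(2)] by (auto simp: U_def)
  \<comment> \<open>Intervals in centre-radius form, as the covering theorem for balls expects;
    containment in \<open>U\<close> keeps their images inside \<open>W\<close>.\<close>
  define K where "K = {(c, r). 0 < r \<and> cball c r \<subseteq> U \<and> q * (2 * r) < F (c + r) - F (c - r)}"
  have cov: "\<exists>i. i \<in> K \<and> x \<in> cball (fst i) (snd i) \<and> snd i < d" if x: "x \<in> E" and d: "0 < d" for x d
  proof -
    obtain s where s: "0 < s" "cball x s \<subseteq> U"
      using U x open_contains_cball by (metis subsetD)
    obtain a b where ab: "a < b" "x \<in> {a..b}" "b - a < min d s" "q * (b - a) < F b - F a"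
      using exp[OF x, of "min d s"] d s by auto
    let ?c = "(a + b) / 2" and ?r = "(b - a) / 2"
    have cb: "cball ?c ?r = {a..b}"
      by (simp add: cball_eq_atLeastAtMost field_simps)
    have "{a..b} \<subseteq> cball x s" using ab by (auto simp: dist_real_def)
    moreover have e: "?c + ?r = b" "?c - ?r = a" "2 * ?r = b - a" by (simp_all add: field_simps)
    have "q * (2 * ?r) < F (?c + ?r) - F (?c - ?r)" unfolding e by (rule ab(4))
    moreover have "0 < ?r" using ab(1) by simp
    ultimately have "(?c, ?r) \<in> K" using s unfolding K_def cb[symmetric] by blast
    moreover have "?r < d" using ab by auto
    ultimately show ?thesis using cb ab by (intro exI[of _ "(?c, ?r)"]) simp
  qed
  have K_pos: "0 < snd i" if "i \<in> K" for i
    using that by (auto simp: K_def)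
  obtain C where C: "countable C" "C \<subseteq> K"
      "pairwise (\<lambda>i j. disjnt (cball (fst i) (snd i)) (cball (fst j) (snd j))) C"
      "negligible (E - (\<Union>i \<in> C. cball (fst i) (snd i)))"
    using Vitali_covering_theorem_cballs[of K snd E fst, OF K_pos cov] by blast
  let ?I = "\<lambda>i. cball (fst i) (snd i)" and ?J = "\<lambda>i. {F (fst i - snd i) .. F (fst i + snd i)}"
  have I_eq: "?I i = {fst i - snd i .. fst i + snd i}" for i :: "real \<times> real"
    by (simp add: cball_eq_atLeastAtMost)
  have J_vimage: "y \<in> ?J i \<longleftrightarrow> (\<exists>x \<in> ?I i. y = F x)" for y and i :: "real \<times> real"
  proof -
    obtain x where "y = F x" using F(3) by (metis surjD)
    then show ?thesis
      unfolding I_eq by (auto simp: strict_mono_less_eq[OF F(1)] strict_mono_eq[OF F(1)])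
  qed
  have disjI: "disjoint_family_on ?I C"
    using C(3) by (auto simp: disjoint_family_on_def pairwise_def disjnt_def)
  have disjJ: "disjoint_family_on ?J C"
    unfolding disjoint_family_on_def
  proof (intro ballI impI)
    fix i j assume ij: "i \<in> C" "j \<in> C" "i \<noteq> j"
    then have I: "?I i \<inter> ?I j = {}" using disjI by (simp add: disjoint_family_on_def)
    show "?J i \<inter> ?J j = {}"
    proof (rule ccontr)
      assume "?J i \<inter> ?J j \<noteq> {}"
      then obtain y where y: "y \<in> ?J i" "y \<in> ?J j" by blast
      obtain x where x: "x \<in> ?I i" "y = F x" using iffD1[OF J_vimage y(1)] by blast
      obtain x' where x': "x' \<in> ?I j" "y = F x'" using iffD1[OF J_vimage y(2)] by blast
      have "x = x'" using x(2) x'(2) strict_mono_eq[OF F(1)] by simp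
      then show False using I x(1) x'(1) by blast
    qed
  qed
  have "E - (\<Union>i \<in> C. ?I i) \<in> sets borel"
    using C(1) E by (intro sets.Diff sets.countable_UN') auto
  then have null: "emeasure lborel (E - (\<Union>i \<in> C. ?I i)) = 0"
    using C(4) by (simp add: negligible_borel_iff)
  have "emeasure lborel E \<le> emeasure lborel ((\<Union>i \<in> C. ?I i) \<union> (E - (\<Union>i \<in> C. ?I i)))"
    using C(1) E by (intro emeasure_mono) (auto intro!: sets.countable_UN')
  also have "\<dots> \<le> emeasure lborel (\<Union>i \<in> C. ?I i) + emeasure lborel (E - (\<Union>i \<in> C. ?I i))"
    using C(1) E by (intro emeasure_subadditive) (auto intro!: sets.countable_UN')
  also have "\<dots> = (\<integral>\<^sup>+i. emeasure lborel (?I i) \<partial>count_space C)"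
    unfolding null using C(1) disjI by (simp add: emeasure_UN_countable)
  finally have "ennreal q * emeasure lborel E \<le> ennreal q * (\<integral>\<^sup>+i. emeasure lborel (?I i) \<partial>count_space C)"
    by (rule mult_left_mono) simp
  also have "\<dots> = (\<integral>\<^sup>+i. ennreal q * emeasure lborel (?I i) \<partial>count_space C)"
    by (simp add: nn_integral_cmult)
  also have "\<dots> \<le> (\<integral>\<^sup>+i. emeasure lborel (?J i) \<partial>count_space C)"
  proof (rule nn_integral_mono)
    fix i assume "i \<in> space (count_space C)"
    then have "0 < snd i" "q * (2 * snd i) < F (fst i + snd i) - F (fst i - snd i)" using C(2) by (auto simp: K_def)
    then show "ennreal q * emeasure lborel (?I i) \<le> emeasure lborel (?J i)"
      unfolding I_eq using \<open>0 < q\<close> strict_mono_less_eq[OF F(1), of "fst i - snd i" "fst i + snd i"]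
      by (simp add: ennreal_mult[symmetric] del: ennreal_mult)
  qed
  also have "\<dots> = emeasure lborel (\<Union>i \<in> C. ?J i)"
    using C(1) disjJ by (simp add: emeasure_UN_countable)
  also have "\<dots> \<le> emeasure lborel W"
  proof (rule emeasure_mono)
    show "(\<Union>i\<in>C. ?J i) \<subseteq> W"
    proof
      fix y assume "y \<in> (\<Union>i\<in>C. ?J i)"
      then obtain i where i: "i \<in> C" "y \<in> ?J i" by blast
      obtain x where x: "x \<in> ?I i" "y = F x" using iffD1[OF J_vimage i(2)] by blast
      have "?I i \<subseteq> U" using subsetD[OF C(2) i(1)] by (simp add: K_def case_prod_unfold)
      then show "y \<in> W" using x by (auto simp: U_def)
    qed
  qed (use W in auto)
  also have "W = F ` E \<union> (W - F ` E)" using W by auto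
  also have "emeasure lborel \<dots> \<le> emeasure lborel (F ` E) + emeasure lborel (W - F ` E)"
    using W FE by (intro emeasure_subadditive) auto
  also have "\<dots> \<le> emeasure lborel (F ` E) + ennreal e"
    using W(3) by (intro add_left_mono) auto
  finally show "ennreal q * emeasure lborel E \<le> emeasure lborel (F ` E) + ennreal e" .
qed

text \<open>Lebesgue's comparison of derivates. Where difference quotients at arbitrarily small
  scales fall below \<open>p\<close> and others exceed \<open>q > p\<close>, the function expands
  measure by at least \<open>q\<close> while its inverse expands it by at least
  \<open>1 / p\<close>; so \<open>q * m \<le> p * m\<close> and the set is null. Rational pairs
  exhaust the points without a derivative.\<close>

lemma Lipschitz_differentiable_ae_real:
  fixes f :: "real \<Rightarrow> real"
  assumes lip: "\<And>x y. \<bar>f x - f y\<bar> \<le> L * \<bar>x - y\<bar>"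
  shows "negligible {x. \<not> (\<exists>d. ((\<lambda>h. (f (x + h) - f x) / h) \<longlongrightarrow> d) (at 0))}"
proof -
  have L0: "0 \<le> L" using lip[of 1 0] by (simp add: order_trans[OF abs_ge_zero])
  \<comment> \<open>The added slope \<open>L + 1\<close> confines all difference quotients to the
    interval from 1 to \<open>2 * L + 1\<close>, so \<open>F\<close> is an increasing homeomorphism
    with Lipschitz inverse.\<close>
  define F where "F x = f x + (L + 1) * x" for x
  have slope1: "y - x \<le> F y - F x" and slope2: "F y - F x \<le> (2 * L + 1) * (y - x)" if "x \<le> y" for x y
    using lip[of y x] that by (auto simp: F_def algebra_simps abs_if split: if_splits)
  have mono: "strict_mono F"
    using slope1 by (intro strict_monoI) (smt (verit))
  have F_le: "F x \<le> F y \<longleftrightarrow> x \<le> y" and F_less: "F x < F y \<longleftrightarrow> x < y" for x y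
    using strict_mono_less_eq[OF mono] strict_mono_less[OF mono] by auto
  have F_dist: "\<bar>F x - F y\<bar> \<le> (2 * L + 1) * \<bar>x - y\<bar>" for x y
    using slope2[of x y] slope2[of y x] slope1[of x y] slope1[of y x] by (cases "x \<le> y") auto
  have cont: "continuous_on A F" for A
    by (rule lipschitz_on_continuous_on[of "2 * L + 1"])
      (use L0 F_dist in \<open>auto intro!: lipschitz_onI simp: dist_real_def\<close>)
  have surj: "surj F"
  proof (rule surjI)
    fix y
    have "\<exists>x. F x = y"
    proof -
      let ?m = "\<bar>y - F 0\<bar>"
      have "F (- ?m) \<le> y" "y \<le> F ?m" using slope1[of "- ?m" 0] slope1[of 0 ?m] by auto
      then show ?thesis using IVT'[of F "- ?m" y ?m] cont by auto
    qed
    then show "F (SOME x. F x = y) = y" by (rule someI_ex)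
  qed
  define G where "G = inv F"
  have GF[simp]: "G (F x) = x" for x using mono by (simp add: G_def strict_mono_imp_inj_on)
  have FG[simp]: "F (G y) = y" for y using surj by (simp add: G_def surj_f_inv_f)
  have G_mono: "strict_mono G"
  proof (rule strict_monoI)
    fix x y :: real assume "x < y" then show "G x < G y" using F_less[of "G x" "G y"] by simp
  qed
  have G_dist: "\<bar>G x - G y\<bar> \<le> 1 * \<bar>x - y\<bar>" for x y
    using slope1[of "G x" "G y"] slope1[of "G y" "G x"] by (cases "G x \<le> G y") auto
  have G_cont: "continuous_on A G" for A
    by (rule lipschitz_on_continuous_on[of 1]) (use G_dist in \<open>auto intro!: lipschitz_onI simp: dist_real_def\<close>)
  have G_surj: "surj G" by (metis GF surjI)
  define Q where "Q x h = (F (x + h) - F x) / h" for x h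
  have Q1: "1 \<le> Q x h" and Q2: "Q x h \<le> 2 * L + 1" if "h \<noteq> 0" for x h
    using that slope1[of x "x + h"] slope1[of "x + h" x] slope2[of x "x + h"] slope2[of "x + h" x]
    by (cases "0 < h"; simp add: Q_def field_simps)+
  \<comment> \<open>Restricting the scales to \<open>1 / Suc n\<close> exhibits \<open>lo p\<close>
    and \<open>up q\<close> as countable intersections of open sets, hence as Borel sets.\<close>
  define lo where "lo p = (\<Inter>n::nat. \<Union>h\<in>{h. h \<noteq> 0 \<and> \<bar>h\<bar> < 1 / Suc n}. {x. Q x h < p})" for p
  define up where "up q = (\<Inter>n::nat. \<Union>h\<in>{h. h \<noteq> 0 \<and> \<bar>h\<bar> < 1 / Suc n}. {x. q < Q x h})" for q
  have Q_cont: "continuous_on UNIV (\<lambda>x. Q x h)" for h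
    unfolding Q_def by (cases "h = 0") (auto intro!: continuous_intros continuous_on_compose2[OF cont])
  have lo_sets: "lo p \<in> sets borel" and up_sets: "up p \<in> sets borel" for p
    unfolding lo_def up_def
    by (intro sets.countable_INT; force intro!: borel_open open_UN open_Collect_less Q_cont)+
  \<comment> \<open>Intersecting with a bounded interval makes the measure \<open>m\<close> finite,
    so that \<open>q * m \<le> p * m\<close> forces \<open>m = 0\<close>.\<close>
  have zero: "emeasure lborel (lo p \<inter> up q \<inter> {-real N..real N}) = 0" if pq: "p < q" for p q N
  proof (cases "1 \<le> p")
    case False
    have "x \<notin> lo p" for x
    proof
      assume "x \<in> lo p"
      then obtain h where "h \<noteq> 0" "Q x h < p" unfolding lo_def by blast
      then show False using False Q1[of h x] by simp
    qed
    then have "lo p = {}" by auto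
    then show ?thesis by simp
  next
    case True
    let ?E = "lo p \<inter> up q \<inter> {-real N..real N}"
    have E: "?E \<in> sets borel" using lo_sets up_sets by auto
    have "F ` ?E = G -` ?E \<inter> space borel" by (force simp: image_iff)
    also have "\<dots> \<in> sets borel"
      by (rule measurable_sets[OF borel_measurable_continuous_onI[OF G_cont] E])
    finally have FE: "F ` ?E \<in> sets borel" .
    have GFE: "G ` F ` ?E = ?E" by (simp add: image_image)
    have 1: "ennreal q * emeasure lborel ?E \<le> emeasure lborel (F ` ?E)"
    proof (rule Vitali_expansion[OF mono cont surj E FE])
      show "0 < q" using pq True by simp
      fix x d :: real assume x: "x \<in> ?E" and d: "0 < d"
      obtain n where n: "1 / Suc n < d" using d nat_approx_posE by blast
      obtain h where h: "h \<noteq> 0" "\<bar>h\<bar> < 1 / Suc n" "q < Q x h" using x unfolding up_def by blast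
      have hd: "\<bar>h\<bar> < d" using h(2) n by simp
      show "\<exists>a b. a < b \<and> x \<in> {a..b} \<and> b - a < d \<and> q * (b - a) < F b - F a"
      proof (cases "0 < h")
        case True
        then show ?thesis using h(3) hd by (intro exI[of _ x] exI[of _ "x + h"]) (auto simp: Q_def field_simps)
      next
        case False
        then show ?thesis using h(1,3) hd by (intro exI[of _ "x + h"] exI[of _ x]) (auto simp: Q_def field_simps)
      qed
    qed
    have 2: "ennreal (1 / p) * emeasure lborel (F ` ?E) \<le> emeasure lborel (G ` F ` ?E)"
    proof (rule Vitali_expansion[OF G_mono G_cont G_surj FE])
      show "G ` F ` ?E \<in> sets borel" unfolding GFE by (rule E)
      show "0 < 1 / p" using True by simp
      fix y d :: real assume "y \<in> F ` ?E" and d: "0 < d"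
      then obtain x where x: "x \<in> ?E" "y = F x" by blast
      \<comment> \<open>The short interval is needed around \<open>y\<close>, in the image, and
        \<open>F\<close> lengthens intervals by a factor of at most
        \<open>2 * L + 1\<close>.\<close>
      obtain n where n: "1 / Suc n < d / (2 * L + 1)" using d L0 nat_approx_posE by (metis add_nonneg_pos divide_pos_pos mult_nonneg_nonneg zero_less_one zero_le_numeral)
      obtain h where h: "h \<noteq> 0" "\<bar>h\<bar> < 1 / Suc n" "Q x h < p" using x unfolding lo_def by blast
      have small: "(2 * L + 1) * \<bar>h\<bar> < d"
        using h n L0 by (smt (verit, best) less_divide_eq mult.commute)
      show "\<exists>a b. a < b \<and> y \<in> {a..b} \<and> b - a < d \<and> 1 / p * (b - a) < G b - G a"
      proof (cases "0 < h")
        case pos: True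
        then have "F (x + h) - F x < d" using small slope2[of x "x + h"] by simp
        then show ?thesis using h x True pos
          by (intro exI[of _ "F x"] exI[of _ "F (x + h)"]) (auto simp: Q_def F_le F_less field_simps)
      next
        case neg: False
        then have "F x - F (x + h) < d" using small slope2[of "x + h" x] by simp
        then show ?thesis using h x True neg
          by (intro exI[of _ "F (x + h)"] exI[of _ "F x"]) (auto simp: Q_def F_le F_less field_simps)
      qed
    qed
    have fin: "emeasure lborel ?E < \<infinity>"
      using emeasure_mono[of ?E "{-real N..real N}" lborel] by (auto simp: less_top[symmetric] top_unique)
    define m where "m = measure lborel ?E"
    have m: "emeasure lborel ?E = ennreal m" "0 \<le> m"
      using fin by (auto simp: m_def emeasure_eq_ennreal_measure)
    have "ennreal (1 / p) * (ennreal q * ennreal m) \<le> ennreal (1 / p) * emeasure lborel (F ` ?E)"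
      using 1 m by (intro mult_left_mono) auto
    also have "\<dots> \<le> ennreal m" using 2 m unfolding GFE by simp
    finally have "1 / p * (q * m) \<le> m" using True pq m by (simp add: ennreal_mult[symmetric] del: ennreal_mult)
    then have "q * m \<le> p * m" using True by (simp add: field_simps)
    then have "m = 0" using pq m(2) by (smt (verit) mult_right_mono mult_strict_right_mono)
    then show ?thesis using m by simp
  qed
  let ?B = "\<lambda>(N, p, q). lo p \<inter> up q \<inter> {- real N .. real N}"
    and ?I = "{(N, p, q). p \<in> \<rat> \<and> q \<in> \<rat> \<and> p < q} :: (nat \<times> real \<times> real) set"
  have "countable ?I"
    by (rule countable_subset[of _ "UNIV \<times> \<rat> \<times> \<rat>"]) (auto simp: countable_rat)
  moreover have "negligible (?B i)" if "i \<in> ?I" for i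
    using that zero lo_sets up_sets by (auto simp: negligible_borel_iff)
  ultimately have "negligible (\<Union>(?B ` ?I))"
    by (intro negligible_countable_Union) auto
  moreover have "\<exists>d. ((\<lambda>h. (f (x + h) - f x) / h) \<longlongrightarrow> d) (at 0)" if x: "x \<notin> \<Union>(?B ` ?I)" for x
  proof -
    have lo: "x \<in> lo p" if fr: "\<exists>\<^sub>F h in at 0. Q x h < p" for p
      unfolding lo_def
    proof (intro INT_I)
      fix n :: nat
      obtain h where "h \<noteq> 0" "dist h 0 < 1 / Suc n" "Q x h < p"
        using fr[unfolded frequently_at, rule_format, of "1 / Suc n"] by (auto simp del: of_nat_Suc)
      then show "x \<in> (\<Union>h\<in>{h. h \<noteq> 0 \<and> \<bar>h\<bar> < 1 / Suc n}. {x. Q x h < p})" by auto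
    qed
    have up: "x \<in> up p" if fr: "\<exists>\<^sub>F h in at 0. p < Q x h" for p
      unfolding up_def
    proof (intro INT_I)
      fix n :: nat
      obtain h where "h \<noteq> 0" "dist h 0 < 1 / Suc n" "p < Q x h"
        using fr[unfolded frequently_at, rule_format, of "1 / Suc n"] by (auto simp del: of_nat_Suc)
      then show "x \<in> (\<Union>h\<in>{h. h \<noteq> 0 \<and> \<bar>h\<bar> < 1 / Suc n}. {x. p < Q x h})" by auto
    qed
    obtain N :: nat where N: "\<bar>x\<bar> \<le> real N" using real_arch_simple by blast
    have dich: "\<not> (\<exists>\<^sub>F h in at 0. Q x h < p) \<or> \<not> (\<exists>\<^sub>F h in at 0. q < Q x h)"
      if "p \<in> \<rat>" "q \<in> \<rat>" "p < q" for p q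
    proof (rule ccontr)
      assume "\<not> ?thesis"
      then have "x \<in> ?B (N, p, q)" using lo up N by auto
      then show False using x that by blast
    qed
    have ev: "\<forall>\<^sub>F h in at 0. 1 \<le> Q x h" "\<forall>\<^sub>F h in at 0. Q x h \<le> 2 * L + 1"
      using Q1 Q2 by (auto simp: eventually_at intro!: exI[of _ 1])
    \<comment> \<open>\<open>Sup S\<close> is the upper limit of the quotients at 0, the candidate
      for the derivative of \<open>F\<close>.\<close>
    define S where "S = {q. \<exists>\<^sub>F h in at 0. q < Q x h}"
    have "0 \<in> S"
      unfolding S_def using ev(1)
      by (auto intro!: eventually_frequently elim: eventually_mono)
    have bdd: "bdd_above S"
    proof (rule bdd_aboveI)
      fix q assume "q \<in> S"
      then have "\<exists>\<^sub>F h in at 0. Q x h \<le> 2 * L + 1 \<and> q < Q x h"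
        unfolding S_def by (intro frequently_eventually_conj ev(2)) simp
      then obtain h where "Q x h \<le> 2 * L + 1 \<and> q < Q x h" using frequently_ex by blast
      then show "q \<le> 2 * L + 1" by simp
    qed
    have Q_lim: "(Q x \<longlongrightarrow> Sup S) (at 0)"
    proof (rule order_tendstoI)
      fix a assume a: "a < Sup S"
      \<comment> \<open>Two rationals are placed between \<open>a\<close> and \<open>Sup S\<close>:
        the quotients exceed \<open>q\<close> at arbitrarily small scales, so by \<open>dich\<close>
        they cannot fall below \<open>p\<close> at arbitrarily small scales.\<close>
      obtain p where p: "p \<in> \<rat>" "a < p" "p < Sup S" using Rats_dense_in_real[OF a] by blast
      obtain q where q: "q \<in> \<rat>" "p < q" "q < Sup S" using Rats_dense_in_real[OF p(3)] by blast
      obtain r where "r \<in> S" "q < r" using less_cSupD[of S q] q \<open>0 \<in> S\<close> by blast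
      then have "\<exists>\<^sub>F h in at 0. q < Q x h" unfolding S_def by (auto elim: frequently_elim1)
      then have "\<forall>\<^sub>F h in at 0. \<not> Q x h < p" using dich[OF p(1) q(1) q(2)] by (simp add: not_frequently)
      then show "\<forall>\<^sub>F h in at 0. a < Q x h" by (rule eventually_mono) (use p in auto)
    next
      fix a assume a: "Sup S < a"
      obtain q where q: "Sup S < q" "q < a" using dense[OF a] by blast
      then have "q \<notin> S" using cSup_upper[OF _ bdd, of q] by auto
      then have "\<forall>\<^sub>F h in at 0. \<not> q < Q x h" by (simp add: S_def not_frequently)
      then show "\<forall>\<^sub>F h in at 0. Q x h < a" by (rule eventually_mono) (use q in auto)
    qed
    have "((\<lambda>h. Q x h - (L + 1)) \<longlongrightarrow> Sup S - (L + 1)) (at 0)"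
      by (intro tendsto_intros Q_lim)
    moreover have "\<forall>\<^sub>F h in at 0. Q x h - (L + 1) = (f (x + h) - f x) / h"
      by (auto simp: eventually_at Q_def F_def field_simps intro!: exI[of _ 1])
    ultimately have "((\<lambda>h. (f (x + h) - f x) / h) \<longlongrightarrow> Sup S - (L + 1)) (at 0)"
      by (rule Lim_transform_eventually)
    then show ?thesis by blast
  qed
  ultimately show ?thesis by (elim negligible_subset) blast
qed

section \<open>Directional derivatives of Lipschitz functions\<close>

definition has_dir_deriv :: "('a::real_vector \<Rightarrow> real) \<Rightarrow> 'a \<Rightarrow> real \<Rightarrow> 'a \<Rightarrow> bool" where
  "has_dir_deriv f v d x \<longleftrightarrow> ((\<lambda>h. (f (x + h *\<^sub>R v) - f x) / h) \<longlongrightarrow> d) (at 0)"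

text \<open>Averaging the translates of the set along \<open>v\<close> replaces Fubini in an adapted coordinate system.\<close>

lemma negligible_lines:
  fixes B :: "'a::euclidean_space set"
  assumes B: "B \<in> sets borel" and line: "\<And>x. negligible {t::real. x + t *\<^sub>R v \<in> B}"
  shows "negligible B"
proof -
  have m: "(\<lambda>(t, x). indicator B (x + t *\<^sub>R v) :: ennreal) \<in> borel_measurable (lborel \<Otimes>\<^sub>M lborel)"
  proof -
    have "(\<lambda>p. snd p + fst p *\<^sub>R v) \<in> borel \<Otimes>\<^sub>M borel \<rightarrow>\<^sub>M (borel :: 'a measure)"
      by measurable
    then have "(\<lambda>p. indicator B (snd p + fst p *\<^sub>R v) :: ennreal) \<in> borel_measurable (borel \<Otimes>\<^sub>M borel)"
      using B by measurable
    then show ?thesis by (simp add: case_prod_unfold cong: measurable_cong_sets sets_pair_measure_cong)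
  qed
  have m': "(\<lambda>(t, x). indicator {0..1} t * indicator B (x + t *\<^sub>R v) :: ennreal) \<in> borel_measurable (lborel \<Otimes>\<^sub>M lborel)"
  proof -
    have "(\<lambda>p. indicator {0..1} (fst p) * (case p of (t, x) \<Rightarrow> indicator B (x + t *\<^sub>R v)) :: ennreal) \<in> borel_measurable (lborel \<Otimes>\<^sub>M lborel)"
      using m by measurable
    then show ?thesis by (simp add: case_prod_unfold)
  qed
  have trans: "(\<integral>\<^sup>+x. indicator B (x + t *\<^sub>R v) \<partial>lborel) = emeasure lborel B" for t
  proof -
    have "emeasure lborel B = (\<integral>\<^sup>+x. indicator B x \<partial>distr lborel borel ((+) (t *\<^sub>R v)))"
      using B by (simp add: lborel_distr_plus)
    also have "\<dots> = (\<integral>\<^sup>+x. indicator B (x + t *\<^sub>R v) \<partial>lborel)"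
      using B by (subst nn_integral_distr) (auto simp: add.commute)
    finally show ?thesis by simp
  qed
  have slice: "(\<integral>\<^sup>+t. indicator {0..1} t * indicator B (x + t *\<^sub>R v) \<partial>lborel) = (0::ennreal)" for x
  proof -
    have "{t::real. x + t *\<^sub>R v \<in> B} = (\<lambda>t. x + t *\<^sub>R v) -` B \<inter> space borel" by auto
    also have "\<dots> \<in> sets borel" using B by (rule measurable_sets[rotated]) measurable
    finally have sets: "{t::real. x + t *\<^sub>R v \<in> B} \<in> sets borel" .
    then have "emeasure lborel {t::real. x + t *\<^sub>R v \<in> B} = 0"
      using line[of x] by (simp add: negligible_borel_iff)
    then have "AE t in lborel. \<not> x + t *\<^sub>R v \<in> B"
      using sets by (intro AE_I') (auto simp: null_sets_def)
    then have "AE t in lborel. indicator {0..1} t * indicator B (x + t *\<^sub>R v) = (0::ennreal)"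
      by eventually_elim auto
    then show ?thesis by (subst nn_integral_cong_AE[of _ "\<lambda>_. 0"]) auto
  qed
  \<comment> \<open>The interval of averaging has length 1, so integrating out \<open>t\<close>
    returns the measure of \<open>B\<close> itself.\<close>
  have "emeasure lborel B = (\<integral>\<^sup>+t. indicator {0..1::real} t * emeasure lborel B \<partial>lborel)"
    by (simp add: nn_integral_multc)
  also have "\<dots> = (\<integral>\<^sup>+t. (\<integral>\<^sup>+x. indicator {0..1::real} t * indicator B (x + t *\<^sub>R v) \<partial>lborel) \<partial>lborel)"
  proof (rule nn_integral_cong)
    fix t :: real
    have "(\<lambda>x. indicator B (x + t *\<^sub>R v) :: ennreal) \<in> borel_measurable lborel" using B by measurable
    then show "indicator {0..1::real} t * emeasure lborel B = (\<integral>\<^sup>+x. indicator {0..1::real} t * indicator B (x + t *\<^sub>R v) \<partial>lborel)"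
      by (simp add: nn_integral_cmult trans)
  qed
  also have "\<dots> = (\<integral>\<^sup>+x. (\<integral>\<^sup>+t. indicator {0..1::real} t * indicator B (x + t *\<^sub>R v) \<partial>lborel) \<partial>lborel)"
    by (rule lborel_pair.Fubini'[OF m', symmetric])
  also have "\<dots> = 0" by (simp add: slice)
  finally show ?thesis using B by (simp add: negligible_borel_iff)
qed

text \<open>Tolerances \<open>1 / Suc m\<close> and scales \<open>1 / Suc n\<close> reduce the
  Cauchy criterion to countably many conditions, so that its failure set is Borel when the quotient
  depends on a point.\<close>

lemma Cauchy_quotient_limit:
  fixes q :: "real \<Rightarrow> real"
  assumes "\<And>m::nat. \<exists>n::nat. \<forall>h k. h \<noteq> 0 \<and> \<bar>h\<bar> < 1 / Suc n \<and> k \<noteq> 0 \<and> \<bar>k\<bar> < 1 / Suc n \<longrightarrow> \<bar>q h - q k\<bar> \<le> 1 / Suc m"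
  shows "\<exists>d. (q \<longlongrightarrow> d) (at 0)"
proof -
  \<comment> \<open>The double successor keeps the sample points with index at least
    \<open>n0\<close> strictly below the scale \<open>1 / Suc n0\<close>.\<close>
  define s where "s n = q (1 / Suc (Suc n))" for n
  have small: "1 / real (Suc (Suc n)) < 1 / real (Suc n0)" if "n0 \<le> n" for n n0 :: nat
    using that by (simp add: frac_less2)
  have "Cauchy s"
  proof (rule metric_CauchyI)
    fix e :: real assume "0 < e"
    then obtain m where m: "1 / Suc m < e" using nat_approx_posE by blast
    obtain n0 where n0: "\<And>h k. h \<noteq> 0 \<and> \<bar>h\<bar> < 1 / Suc n0 \<and> k \<noteq> 0 \<and> \<bar>k\<bar> < 1 / Suc n0 \<Longrightarrow> \<bar>q h - q k\<bar> \<le> 1 / Suc m"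
      using assms[of m] by blast
    show "\<exists>M. \<forall>i\<ge>M. \<forall>j\<ge>M. dist (s i) (s j) < e"
    proof (intro exI[of _ n0] allI impI)
      fix i j assume "n0 \<le> i" "n0 \<le> j"
      then have "\<bar>s i - s j\<bar> \<le> 1 / Suc m" unfolding s_def by (intro n0) (simp add: small del: of_nat_Suc)
      then show "dist (s i) (s j) < e" using m by (simp add: dist_real_def)
    qed
  qed
  then obtain d where d: "s \<longlonglongrightarrow> d" using Cauchy_convergent convergent_def by blast
  have "(q \<longlongrightarrow> d) (at 0)"
  proof (rule LIM_I)
    fix e :: real assume "0 < e"
    then obtain m where m: "1 / Suc m < e" using nat_approx_posE by blast
    obtain n0 where n0: "\<And>h k. h \<noteq> 0 \<and> \<bar>h\<bar> < 1 / Suc n0 \<and> k \<noteq> 0 \<and> \<bar>k\<bar> < 1 / Suc n0 \<Longrightarrow> \<bar>q h - q k\<bar> \<le> 1 / Suc m"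
      using assms[of m] by blast
    have "\<bar>q h - d\<bar> \<le> 1 / Suc m" if h: "h \<noteq> 0" "\<bar>h\<bar> < 1 / Suc n0" for h
    proof (rule tendsto_upperbound[of "\<lambda>i. \<bar>q h - s i\<bar>"])
      show "(\<lambda>i. \<bar>q h - s i\<bar>) \<longlonglongrightarrow> \<bar>q h - d\<bar>" by (intro tendsto_intros d)
      show "\<forall>\<^sub>F i in sequentially. \<bar>q h - s i\<bar> \<le> 1 / Suc m"
        unfolding s_def eventually_sequentially using h
        by (intro exI[of _ n0] allI impI n0) (simp add: small del: of_nat_Suc)
    qed simp
    then show "\<exists>r>0. \<forall>x. x \<noteq> 0 \<and> norm (x - 0) < r \<longrightarrow> norm (q x - d) < e"
      using m by (intro exI[of _ "1 / Suc n0"]) force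
  qed
  then show ?thesis by blast
qed

text \<open>\<open>B\<close> collects the points at which the quotients along \<open>v\<close>
  violate the Cauchy criterion. It is Borel because continuity of \<open>f\<close> makes the
  violation for fixed \<open>h\<close> and \<open>k\<close> an open condition, and each line in
  direction \<open>v\<close> meets it in a null set by the one-dimensional result.\<close>

lemma Lipschitz_dir_deriv_ae:
  fixes f :: "'a::euclidean_space \<Rightarrow> real"
  assumes lip: "\<And>x y. \<bar>f x - f y\<bar> \<le> L * norm (x - y)"
  shows "AE x in lborel. \<exists>d. has_dir_deriv f v d x"
proof -
  have cont: "continuous_on UNIV f"
  proof (rule lipschitz_on_continuous_on[of "\<bar>L\<bar>"])
    show "\<bar>L\<bar>-lipschitz_on UNIV f"
    proof (rule lipschitz_onI)
      fix x y show "dist (f x) (f y) \<le> \<bar>L\<bar> * dist x y"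
        using order_trans[OF lip mult_right_mono[OF abs_ge_self norm_ge_zero]] by (simp add: dist_norm)
    qed simp
  qed
  let ?q = "\<lambda>x h. (f (x + h *\<^sub>R v) - f x) / h"
  define H where "H n = {(h, k). h \<noteq> 0 \<and> \<bar>h\<bar> < 1 / Suc n \<and> k \<noteq> 0 \<and> \<bar>k\<bar> < 1 / Suc n}" for n :: nat
  define B where "B = (\<Union>m::nat. \<Inter>n::nat. \<Union>(h, k)\<in>H n. {x. 1 / Suc m < \<bar>?q x h - ?q x k\<bar>})"
  have q_cont: "continuous_on UNIV (\<lambda>x. ?q x h)" for h
    by (cases "h = 0") (auto intro!: continuous_intros continuous_on_compose2[OF cont])
  have op: "open (\<Union>(h, k)\<in>H n. {x. 1 / Suc m < \<bar>?q x h - ?q x k\<bar>})" for n m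
    by (intro open_UN) (auto simp del: of_nat_Suc intro!: open_Collect_less continuous_intros q_cont)
  have B: "B \<in> sets borel"
    unfolding B_def by (intro sets.countable_UN sets.countable_INT image_subsetI borel_open op) auto
  have notB: "\<exists>d. has_dir_deriv f v d x" if "x \<notin> B" for x
    unfolding has_dir_deriv_def
  proof (rule Cauchy_quotient_limit)
    fix m :: nat
    obtain n where n: "x \<notin> (\<Union>(h, k)\<in>H n. {x. 1 / Suc m < \<bar>?q x h - ?q x k\<bar>})"
      using \<open>x \<notin> B\<close> unfolding B_def by blast
    have "\<bar>?q x h - ?q x k\<bar> \<le> 1 / Suc m" if "h \<noteq> 0 \<and> \<bar>h\<bar> < 1 / Suc n \<and> k \<noteq> 0 \<and> \<bar>k\<bar> < 1 / Suc n" for h k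
    proof (rule ccontr)
      assume "\<not> ?thesis"
      then have "x \<in> {x. 1 / Suc m < \<bar>?q x h - ?q x k\<bar>}" by simp
      moreover have "(h, k) \<in> H n" using that by (simp add: H_def)
      ultimately show False using n by blast
    qed
    then show "\<exists>n::nat. \<forall>h k. h \<noteq> 0 \<and> \<bar>h\<bar> < 1 / Suc n \<and> k \<noteq> 0 \<and> \<bar>k\<bar> < 1 / Suc n \<longrightarrow> \<bar>?q x h - ?q x k\<bar> \<le> 1 / Suc m"
      by blast
  qed
  have Bnot: "x \<notin> B" if d: "has_dir_deriv f v d x" for x d
  proof
    assume "x \<in> B"
    then obtain m where m: "x \<in> (\<Inter>n::nat. \<Union>(h, k)\<in>H n. {x. 1 / Suc m < \<bar>?q x h - ?q x k\<bar>})"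
      unfolding B_def by (rule UN_E)
    have "0 < 1 / (2 * real (Suc m))" by simp
    then obtain r where r: "r > 0" "\<And>h. h \<noteq> 0 \<Longrightarrow> \<bar>h\<bar> < r \<Longrightarrow> \<bar>?q x h - d\<bar> < 1 / (2 * real (Suc m))"
      using LIM_D[OF d[unfolded has_dir_deriv_def]] by (metis diff_zero real_norm_def)
    obtain n where n: "1 / Suc n < r" using r(1) nat_approx_posE by blast
    have "x \<in> (\<Union>(h, k)\<in>H n. {x. 1 / Suc m < \<bar>?q x h - ?q x k\<bar>})" using m by (rule INT_D) simp
    then obtain h k where hk: "(h, k) \<in> H n" "1 / Suc m < \<bar>?q x h - ?q x k\<bar>"
      by (simp only: UN_iff case_prod_unfold mem_Collect_eq) (metis prod.collapse)
    have "\<bar>?q x h - d\<bar> < 1 / (2 * real (Suc m))" "\<bar>?q x k - d\<bar> < 1 / (2 * real (Suc m))"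
      using hk(1) n by (auto simp: H_def simp del: of_nat_Suc intro!: r(2))
    moreover have "\<bar>?q x h - ?q x k\<bar> \<le> \<bar>?q x h - d\<bar> + \<bar>?q x k - d\<bar>"
      using abs_triangle_ineq4[of "?q x h - d" "?q x k - d"] by simp
    ultimately have "\<bar>?q x h - ?q x k\<bar> < 1 / (2 * real (Suc m)) + 1 / (2 * real (Suc m))"
      by (rule_tac order.strict_trans1[OF _ add_strict_mono])
    also have "\<dots> = 1 / real (Suc m)" by (simp del: of_nat_Suc)
    finally show False using hk(2) by simp
  qed
  have "negligible B"
  proof (rule negligible_lines[OF B])
    fix x
    let ?g = "\<lambda>t. f (x + t *\<^sub>R v)"
    have "negligible {t. \<not> (\<exists>d. ((\<lambda>h. (?g (t + h) - ?g t) / h) \<longlongrightarrow> d) (at 0))}"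
    proof (rule Lipschitz_differentiable_ae_real)
      fix s t show "\<bar>?g s - ?g t\<bar> \<le> (L * norm v) * \<bar>s - t\<bar>"
        using lip[of "x + s *\<^sub>R v" "x + t *\<^sub>R v"] by (simp add: scaleR_left_diff_distrib[symmetric] mult_ac)
    qed
    then show "negligible {t. x + t *\<^sub>R v \<in> B}"
    proof (rule negligible_subset, intro subsetI CollectI notI)
      fix t assume t: "t \<in> {t. x + t *\<^sub>R v \<in> B}" and "\<exists>d. ((\<lambda>h. (?g (t + h) - ?g t) / h) \<longlongrightarrow> d) (at 0)"
      then obtain d where "has_dir_deriv f v d (x + t *\<^sub>R v)"
        by (auto simp: has_dir_deriv_def scaleR_left_distrib add.assoc)
      then show False using Bnot t by blast
    qed
  qed
  then have "emeasure lborel B = 0" using B by (simp add: negligible_borel_iff)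
  then show ?thesis using B notB by (intro AE_I'[of B]) (auto simp: null_sets_def)
qed

lemma has_dir_deriv_scale:
  assumes "has_dir_deriv f v d x" shows "has_dir_deriv f (c *\<^sub>R v) (c * d) x"
proof (cases "c = 0")
  case True
  then show ?thesis by (simp add: has_dir_deriv_def)
next
  case False
  have "((\<lambda>h. (f (x + h *\<^sub>R v) - f x) / h) \<longlongrightarrow> d) (at 0)"
    using assms by (simp add: has_dir_deriv_def)
  moreover have "filterlim (\<lambda>h. h * c) (at 0) (at 0)"
    using False unfolding filterlim_at
    by (auto intro!: tendsto_eq_intros simp: eventually_at intro: exI[of _ 1])
  ultimately have "((\<lambda>h. (f (x + (h * c) *\<^sub>R v) - f x) / (h * c)) \<longlongrightarrow> d) (at 0)"
    by (rule filterlim_compose)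
  then have "((\<lambda>h. c * ((f (x + (h * c) *\<^sub>R v) - f x) / (h * c))) \<longlongrightarrow> c * d) (at 0)"
    by (intro tendsto_intros)
  then show ?thesis using False by (simp add: has_dir_deriv_def)
qed

section \<open>Additivity in the direction and total differentiability\<close>

definition dir_quot :: "('a::real_vector \<Rightarrow> real) \<Rightarrow> 'a \<Rightarrow> nat \<Rightarrow> 'a \<Rightarrow> real" where
  "dir_quot f v n x = real (Suc n) * (f (x + (1 / real (Suc n)) *\<^sub>R v) - f x)"

text \<open>The limit along the single sequence \<open>1 / Suc n\<close> gives a function that is
  defined everywhere and, for continuous \<open>f\<close>, Borel.\<close>

definition dir_deriv :: "('a::real_vector \<Rightarrow> real) \<Rightarrow> 'a \<Rightarrow> 'a \<Rightarrow> real" where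
  "dir_deriv f v x = lim (\<lambda>n. dir_quot f v n x)"

lemma dir_quot_tendsto:
  assumes "has_dir_deriv f v d x" shows "(\<lambda>n. dir_quot f v n x) \<longlonglongrightarrow> d"
proof -
  have "filterlim (\<lambda>n. 1 / real (Suc n)) (at 0) sequentially"
    unfolding filterlim_at using LIMSEQ_Suc[OF lim_inverse_n'] by (simp del: of_nat_Suc)
  then have "(\<lambda>n. (f (x + (1 / real (Suc n)) *\<^sub>R v) - f x) / (1 / real (Suc n))) \<longlonglongrightarrow> d"
    using assms unfolding has_dir_deriv_def by (rule_tac filterlim_compose)
  then show ?thesis by (simp add: dir_quot_def mult.commute)
qed

lemma dir_deriv_eq: "has_dir_deriv f v d x \<Longrightarrow> dir_deriv f v x = d"
  unfolding dir_deriv_def using dir_quot_tendsto limI by blast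

lemma has_dir_deriv_dir_deriv: "\<exists>d. has_dir_deriv f v d x \<Longrightarrow> has_dir_deriv f v (dir_deriv f v x) x"
  using dir_deriv_eq by metis

text \<open>Uniqueness of densities concerns nonnegative functions, so \<open>g\<close> is replaced
  by \<open>1 + g / K\<close>. The measure with this density agrees with Lebesgue measure on boxes,
  hence everywhere, and its density must be 1 almost everywhere.\<close>

lemma AE_eq_0_if_box_integrals:
  fixes g :: "'a::euclidean_space \<Rightarrow> real"
  assumes [measurable]: "g \<in> borel_measurable borel" and bound: "\<And>x. \<bar>g x\<bar> \<le> C"
    and zero: "\<And>l u. (\<integral>x. indicator (box l u) x * g x \<partial>lborel) = 0"
  shows "AE x in lborel. g x = 0"
proof -
  \<comment> \<open>\<open>C + 1\<close> instead of \<open>C\<close> keeps the divisor positive when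
    the bound is 0.\<close>
  define K where "K = C + 1"
  have K: "0 < K" using bound[of 0] by (simp add: K_def)
  have gK: "0 \<le> 1 + g x / K" for x
    using bound[of x] K by (simp add: K_def field_simps abs_if split: if_splits)
  have "lborel = density lborel (\<lambda>x. ennreal (1 + g x / K))"
  proof (rule lborel_eqI)
    fix l u :: 'a assume lu: "\<And>b. b \<in> Basis \<Longrightarrow> l \<bullet> b \<le> u \<bullet> b"
    have i1: "integrable lborel (\<lambda>x. indicator (box l u) x :: real)"
      using emeasure_lborel_box_finite[of l u] by (intro integrable_real_indicator) auto
    have i2: "integrable lborel (\<lambda>x. indicator (box l u) x * g x)"
    proof (rule Bochner_Integration.integrable_bound[of _ "\<lambda>x. C * indicator (box l u) x"])
      show "integrable lborel (\<lambda>x. C * indicator (box l u) x)" using i1 by simp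
      show "AE x in lborel. norm (indicator (box l u) x * g x) \<le> norm (C * indicator (box l u) x)"
        using bound order_trans[OF bound abs_ge_self] by (intro AE_I2) (auto simp: indicator_def)
    qed simp
    have "emeasure (density lborel (\<lambda>x. ennreal (1 + g x / K))) (box l u)
        = (\<integral>\<^sup>+x. ennreal (1 + g x / K) * indicator (box l u) x \<partial>lborel)"
      by (simp add: emeasure_density)
    also have "\<dots> = (\<integral>\<^sup>+x. ennreal (indicator (box l u) x + indicator (box l u) x * g x / K) \<partial>lborel)"
      by (intro nn_integral_cong) (auto simp: indicator_def)
    also have "\<dots> = ennreal (\<integral>x. indicator (box l u) x + indicator (box l u) x * g x / K \<partial>lborel)"
    proof (rule nn_integral_eq_integral)
      show "integrable lborel (\<lambda>x. indicator (box l u) x + indicator (box l u) x * g x / K)"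
        using i1 i2 by (intro Bochner_Integration.integrable_add Bochner_Integration.integrable_divide)
      show "AE x in lborel. 0 \<le> indicator (box l u) x + indicator (box l u) x * g x / K"
        using gK by (intro AE_I2) (auto simp: indicator_def)
    qed
    also have "(\<integral>x. indicator (box l u) x + indicator (box l u) x * g x / K \<partial>lborel) = measure lborel (box l u)"
      using i1 i2 zero[of l u] by simp
    also have "ennreal \<dots> = (\<Prod>b\<in>Basis. (u - l) \<bullet> b)"
      using lu by (simp add: measure_lborel_box)
    finally show "emeasure (density lborel (\<lambda>x. ennreal (1 + g x / K))) (box l u) = ennreal (\<Prod>b\<in>Basis. (u - l) \<bullet> b)" .
  qed simp
  then have "density lborel (\<lambda>x. ennreal (1 + g x / K)) = density lborel (\<lambda>x::'a. 1)"
    by (simp add: density_1)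
  then have "AE x in lborel. ennreal (1 + g x / K) = 1"
    by (subst (asm) sigma_finite_measure.density_unique_iff) (auto intro: lborel.sigma_finite_measure_axioms)
  then show ?thesis
  proof eventually_elim
    fix x assume "ennreal (1 + g x / K) = 1"
    then have "1 + g x / K = 1" using gK[of x] by (metis ennreal_1 ennreal_inj zero_le_one)
    then show "g x = 0" using K by simp
  qed
qed

text \<open>The quotient along \<open>v + w\<close> at \<open>x\<close> is the quotient along
  \<open>v\<close> at \<open>x\<close> plus the one along \<open>w\<close> at a shifted point. The
  shift cannot be controlled pointwise, but after integration over a box it moves onto the indicator
  by translation invariance and disappears in the limit by dominated convergence. Additivity
  therefore holds when tested on boxes.\<close>

lemma dir_deriv_add_ae:
  fixes f :: "'a::euclidean_space \<Rightarrow> real"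
  assumes lip: "\<And>x y. \<bar>f x - f y\<bar> \<le> L * norm (x - y)"
  shows "AE x in lborel. dir_deriv f (v + w) x = dir_deriv f v x + dir_deriv f w x"
proof -
  let ?q = "\<lambda>v n x. dir_quot f v n x" and ?D = "dir_deriv f"
  have "L-lipschitz_on UNIV f"
  proof (rule lipschitz_onI)
    obtain b :: 'a where "b \<in> Basis" using nonempty_Basis by blast
    then show "0 \<le> L" using lip[of b 0] order_trans[OF abs_ge_zero lip[of b 0]] by simp
  qed (use lip in \<open>simp add: dist_norm\<close>)
  then have cont: "continuous_on UNIV f" by (rule lipschitz_on_continuous_on)
  then have [measurable]: "f \<in> borel_measurable borel" by (rule borel_measurable_continuous_onI)
  have q_meas [measurable]: "?q v n \<in> borel_measurable borel" for v n
    unfolding dir_quot_def by measurable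
  have D_meas [measurable]: "?D v \<in> borel_measurable borel" for v
    unfolding dir_deriv_def by (rule borel_measurable_lim_metric) measurable
  have q_bound: "\<bar>?q v n x\<bar> \<le> L * norm v" for v n x
  proof -
    have "\<bar>?q v n x\<bar> = real (Suc n) * \<bar>f (x + (1 / real (Suc n)) *\<^sub>R v) - f x\<bar>"
      by (simp add: dir_quot_def abs_mult)
    also have "\<dots> \<le> real (Suc n) * (L * norm ((1 / real (Suc n)) *\<^sub>R v))"
      using lip[of "x + (1 / real (Suc n)) *\<^sub>R v" x] by (intro mult_left_mono) (simp_all del: of_nat_Suc)
    finally show ?thesis by (simp del: of_nat_Suc)
  qed
  have conv: "AE x in lborel. (\<lambda>n. ?q v n x) \<longlonglongrightarrow> ?D v x" for v
    using Lipschitz_dir_deriv_ae[OF lip, of v]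
    by eventually_elim (metis dir_quot_tendsto has_dir_deriv_dir_deriv)
  have D_bound: "AE x in lborel. \<bar>?D v x\<bar> \<le> L * norm v" for v
    using conv[of v]
  proof eventually_elim
    fix x assume "(\<lambda>n. ?q v n x) \<longlonglongrightarrow> ?D v x"
    then have "(\<lambda>n. \<bar>?q v n x\<bar>) \<longlonglongrightarrow> \<bar>?D v x\<bar>" by (rule tendsto_rabs)
    then show "\<bar>?D v x\<bar> \<le> L * norm v" by (rule LIMSEQ_le_const2) (use q_bound in auto)
  qed
  define C where "C = L * norm (v + w) + L * norm v + L * norm w"
  \<comment> \<open>The derivatives are bounded only almost everywhere; truncation at
    \<open>C\<close> gives the bound at every point that the test on boxes asks for, and changes
    nothing outside a null set.\<close>
  define g where "g x = (let d = ?D (v + w) x - ?D v x - ?D w x in if \<bar>d\<bar> \<le> C then d else 0)" for x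
  have [measurable]: "g \<in> borel_measurable borel" unfolding g_def Let_def by measurable
  have g_eq: "AE x in lborel. g x = ?D (v + w) x - ?D v x - ?D w x"
    using D_bound[of "v + w"] D_bound[of v] D_bound[of w]
  proof eventually_elim
    fix x assume "\<bar>?D (v + w) x\<bar> \<le> L * norm (v + w)" "\<bar>?D v x\<bar> \<le> L * norm v" "\<bar>?D w x\<bar> \<le> L * norm w"
    then have "\<bar>?D (v + w) x - ?D v x - ?D w x\<bar> \<le> C" unfolding C_def by linarith
    then show "g x = ?D (v + w) x - ?D v x - ?D w x" by (simp add: g_def Let_def)
  qed
  have int_box: "integrable lborel (\<lambda>x. indicator (box l u) x :: real)" for l u :: 'a
    using emeasure_lborel_box_finite[of l u] by (intro integrable_real_indicator) auto
  have "AE x in lborel. g x = 0"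
  proof (rule AE_eq_0_if_box_integrals[where C = C])
    show "\<bar>g x\<bar> \<le> C" for x
    proof -
      have "0 \<le> C" using q_bound[of "v + w" 0 0] q_bound[of v 0 0] q_bound[of w 0 0] by (simp add: C_def)
      then show ?thesis by (simp add: g_def Let_def)
    qed
    fix l u :: 'a
    let ?E = "box l u"
    have lim: "(\<lambda>n. \<integral>x. indicator ?E x * ?q v n x \<partial>lborel) \<longlonglongrightarrow> (\<integral>x. indicator ?E x * ?D v x \<partial>lborel)"
      and intq: "integrable lborel (\<lambda>x. indicator ?E x * ?q v n x)"
      and intD: "integrable lborel (\<lambda>x. indicator ?E x * ?D v x)" for v n
    proof -
      have dom: "integrable lborel (\<lambda>x. (L * norm v) * indicator ?E x)" using int_box by simp
      have c: "AE x in lborel. (\<lambda>n. indicator ?E x * ?q v n x) \<longlonglongrightarrow> indicator ?E x * ?D v x"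
        using conv[of v] by eventually_elim (intro tendsto_intros)
      have b: "AE x in lborel. norm (indicator ?E x * ?q v n x) \<le> (L * norm v) * indicator ?E x" for n
        using q_bound[of v n] by (intro AE_I2) (auto simp: indicator_def)
      show "(\<lambda>n. \<integral>x. indicator ?E x * ?q v n x \<partial>lborel) \<longlonglongrightarrow> (\<integral>x. indicator ?E x * ?D v x \<partial>lborel)"
        by (rule integral_dominated_convergence[OF _ _ dom c b]) measurable
      show "integrable lborel (\<lambda>x. indicator ?E x * ?D v x)"
        by (rule integrable_dominated_convergence[OF _ _ dom c b]) measurable
      show "integrable lborel (\<lambda>x. indicator ?E x * ?q v n x)"
        by (rule integrable_dominated_convergence2[OF _ _ dom c b]) measurable
    qed
    let ?s = "\<lambda>n. (1 / real (Suc n)) *\<^sub>R v"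
    obtain R where R: "\<And>x. x \<in> ?E \<Longrightarrow> norm x \<le> R"
      using bounded_box[of l u] by (auto simp: bounded_iff)
    \<comment> \<open>This ball contains all translates of the box by \<open>?s n\<close>, since no
      shift is longer than \<open>norm v\<close>; its indicator provides the integrable
      majorant.\<close>
    let ?K = "cball (0::'a) (R + norm v)"
    have s_le: "norm (?s n) \<le> norm v" for n
      using mult_left_mono[of 1 "real (Suc n)" "norm v"] by (simp add: divide_simps)
    have shift: "(\<integral>x. indicator ?E x * ?q w n (x + ?s n) \<partial>lborel) = (\<integral>x. indicator ?E (x - ?s n) * ?q w n x \<partial>lborel)" for n
    proof -
      have "(\<integral>x. indicator ?E (x - ?s n) * ?q w n x \<partial>lborel) = (\<integral>x. indicator ?E (x - ?s n) * ?q w n x \<partial>distr lborel borel ((+) (?s n)))"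
        by (simp add: lborel_distr_plus)
      also have "\<dots> = (\<integral>x. indicator ?E (?s n + x - ?s n) * ?q w n (?s n + x) \<partial>lborel)"
        by (rule integral_distr) measurable
      finally show ?thesis by (simp add: add.commute)
    qed
    have lim_shift: "(\<lambda>n. \<integral>x. indicator ?E (x - ?s n) * ?q w n x \<partial>lborel) \<longlonglongrightarrow> (\<integral>x. indicator ?E x * ?D w x \<partial>lborel)"
    proof (rule integral_dominated_convergence[where w = "\<lambda>x. (L * norm w) * indicator ?K x"])
      show "integrable lborel (\<lambda>x. (L * norm w) * indicator ?K x)"
        using emeasure_lborel_cball_finite[of "0::'a" "R + norm v"]
        by (intro integrable_mult_right integrable_real_indicator) auto
      \<comment> \<open>Off the boundary of the box, which is null, the shifted indicator eventually
        equals the unshifted one.\<close>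
      have fr: "AE x in lborel. x \<notin> frontier ?E"
      proof (rule AE_I')
        have "negligible (frontier ?E)" by (intro negligible_convex_frontier convex_box)
        then show "frontier ?E \<in> null_sets lborel" by (simp add: negligible_borel_iff null_sets_def borel_closed)
      qed auto
      show "AE x in lborel. (\<lambda>n. indicator ?E (x - ?s n) * ?q w n x) \<longlonglongrightarrow> indicator ?E x * ?D w x"
        using fr conv[of w]
      proof eventually_elim
        fix x assume x: "x \<notin> frontier ?E" and c: "(\<lambda>n. ?q w n x) \<longlonglongrightarrow> ?D w x"
        have s0: "(\<lambda>n. x - ?s n) \<longlonglongrightarrow> x - 0 *\<^sub>R v"
          using LIMSEQ_Suc[OF lim_inverse_n'] by (intro tendsto_intros) (simp del: of_nat_Suc)
        have "\<forall>\<^sub>F n in sequentially. indicator ?E (x - ?s n) = (indicator ?E x :: real)"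
        proof (cases "x \<in> ?E")
          case True
          then have "\<forall>\<^sub>F n in sequentially. x - ?s n \<in> ?E" using topological_tendstoD[OF s0 open_box] by simp
          then show ?thesis by eventually_elim (use True in simp)
        next
          case False
          then have "x \<in> - closure ?E" using x by (simp add: frontier_def interior_open open_box)
          then have "\<forall>\<^sub>F n in sequentially. x - ?s n \<in> - closure ?E"
            using topological_tendstoD[OF s0, of "- closure ?E"] by (simp add: open_Compl)
          then show ?thesis by eventually_elim (use False closure_subset in \<open>auto simp: indicator_def\<close>)
        qed
        then have "(\<lambda>n. indicator ?E (x - ?s n) :: real) \<longlonglongrightarrow> indicator ?E x"
          by (rule tendsto_eventually)
        then show "(\<lambda>n. indicator ?E (x - ?s n) * ?q w n x) \<longlonglongrightarrow> indicator ?E x * ?D w x"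
          using c by (intro tendsto_intros)
      qed
      show "AE x in lborel. norm (indicator ?E (x - ?s n) * ?q w n x) \<le> (L * norm w) * indicator ?K x" for n
      proof (intro AE_I2)
        fix x
        have "x \<in> ?K" if "x - ?s n \<in> ?E"
          using R[OF that] s_le[of n] norm_triangle_ineq[of "x - ?s n" "?s n"] by simp
        then show "norm (indicator ?E (x - ?s n) * ?q w n x) \<le> (L * norm w) * indicator ?K x"
          using q_bound[of w n x] order_trans[OF abs_ge_zero q_bound[of w n x]] by (auto simp: indicator_def)
      qed
    qed measurable
    have "?q (v + w) n x = ?q w n (x + ?s n) + ?q v n x" for n x
      by (simp add: dir_quot_def scaleR_add_right algebra_simps)
    then have split: "(\<integral>x. indicator ?E x * ?q (v + w) n x \<partial>lborel)
       = (\<integral>x. indicator ?E (x - ?s n) * ?q w n x \<partial>lborel) + (\<integral>x. indicator ?E x * ?q v n x \<partial>lborel)" for n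
    proof -
      have "indicator ?E x * ?q w n (x + ?s n) = indicator ?E x * ?q (v + w) n x - indicator ?E x * ?q v n x" for x
        using \<open>\<And>x n. ?q (v + w) n x = ?q w n (x + ?s n) + ?q v n x\<close> by (simp add: algebra_simps)
      then have "(\<integral>x. indicator ?E x * ?q w n (x + ?s n) \<partial>lborel)
          = (\<integral>x. indicator ?E x * ?q (v + w) n x \<partial>lborel) - (\<integral>x. indicator ?E x * ?q v n x \<partial>lborel)"
        using intq by simp
      then show ?thesis using shift[of n] by simp
    qed
    have "(\<lambda>n. \<integral>x. indicator ?E x * ?q (v + w) n x \<partial>lborel)
       \<longlonglongrightarrow> (\<integral>x. indicator ?E x * ?D w x \<partial>lborel) + (\<integral>x. indicator ?E x * ?D v x \<partial>lborel)"
      unfolding split by (intro tendsto_intros lim_shift lim)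
    then have eq: "(\<integral>x. indicator ?E x * ?D (v + w) x \<partial>lborel)
       = (\<integral>x. indicator ?E x * ?D w x \<partial>lborel) + (\<integral>x. indicator ?E x * ?D v x \<partial>lborel)"
      using lim[of "v + w"] LIMSEQ_unique by blast
    have "(\<integral>x. indicator ?E x * g x \<partial>lborel)
       = (\<integral>x. indicator ?E x * ?D (v + w) x - indicator ?E x * ?D v x - indicator ?E x * ?D w x \<partial>lborel)"
    proof (rule integral_cong_AE)
      show "AE x in lborel. indicator ?E x * g x
          = indicator ?E x * ?D (v + w) x - indicator ?E x * ?D v x - indicator ?E x * ?D w x"
        using g_eq by eventually_elim (simp only: right_diff_distrib)
    qed measurable
    also have "\<dots> = 0" using eq intD by simp
    finally show "(\<integral>x. indicator ?E x * g x \<partial>lborel) = 0" .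
  qed measurable
  then show ?thesis using g_eq by eventually_elim simp
qed

text \<open>The exceptional null set of linearity depends on the direction, so only countably many
  directions can be treated at once. A countable dense set suffices: finitely many small balls
  around its points cover the sphere, and the Lipschitz bound carries the estimate to nearby
  directions.\<close>

theorem Rademacher:
  fixes f :: "'a::euclidean_space \<Rightarrow> real"
  assumes lip: "\<And>x y. \<bar>f x - f y\<bar> \<le> L * norm (x - y)"
  shows "AE x in lborel. f differentiable (at x)"
proof -
  let ?D = "dir_deriv f"
  have L0: "0 \<le> L"
  proof -
    obtain b :: 'a where "b \<in> Basis" using nonempty_Basis by blast
    then show "0 \<le> L" using order_trans[OF abs_ge_zero lip[of b 0]] by simp
  qed
  have dd: "AE x in lborel. has_dir_deriv f v (?D v x) x" for v
    using Lipschitz_dir_deriv_ae[OF lip, of v] by eventually_elim (rule has_dir_deriv_dir_deriv)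
  have scale: "AE x in lborel. ?D (c *\<^sub>R v) x = c * ?D v x" for c v
    using dd[of v] by eventually_elim (intro dir_deriv_eq has_dir_deriv_scale)
  have sum: "AE x in lborel. ?D (\<Sum>b\<in>F. (v \<bullet> b) *\<^sub>R b) x = (\<Sum>b\<in>F. (v \<bullet> b) * ?D b x)" if "finite F" for F v
    using that
  proof (induction F)
    case empty
    have "?D 0 x = 0" for x
      using dir_deriv_eq[of f 0 0 x] by (simp add: has_dir_deriv_def)
    then show ?case by simp
  next
    case (insert b F)
    show ?case
      using insert.IH dir_deriv_add_ae[OF lip, of "(v \<bullet> b) *\<^sub>R b" "\<Sum>b\<in>F. (v \<bullet> b) *\<^sub>R b"] scale[of "v \<bullet> b" b]
      by eventually_elim (simp add: insert.hyps)
  qed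
  define G where "G x = (\<Sum>b\<in>Basis. ?D b x *\<^sub>R b)" for x
  have lin: "AE x in lborel. has_dir_deriv f v (G x \<bullet> v) x" for v
    using dd[of v] sum[OF finite_Basis, of v]
  proof eventually_elim
    fix x assume 1: "has_dir_deriv f v (?D v x) x" and 2: "?D (\<Sum>b\<in>Basis. (v \<bullet> b) *\<^sub>R b) x = (\<Sum>b\<in>Basis. (v \<bullet> b) * ?D b x)"
    have "?D v x = G x \<bullet> v"
      using 2 unfolding euclidean_representation by (simp add: G_def inner_sum_left mult.commute inner_commute[of v])
    then show "has_dir_deriv f v (G x \<bullet> v) x" using 1 by simp
  qed
  obtain Q :: "'a set" where Q: "countable Q" "\<And>S. open S \<Longrightarrow> S \<noteq> {} \<Longrightarrow> \<exists>v\<in>Q. v \<in> S"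
    using countable_dense_exists by blast
  have "AE x in lborel. \<forall>v\<in>Q. has_dir_deriv f v (G x \<bullet> v) x"
    using Q(1) lin by (simp add: AE_ball_countable)
  then show ?thesis
  proof eventually_elim
    fix x assume der: "\<forall>v\<in>Q. has_dir_deriv f v (G x \<bullet> v) x"
    have "(f has_derivative (\<lambda>y. G x \<bullet> y)) (at x)"
      unfolding has_derivative_at_alt
    proof (intro conjI allI impI)
      show "bounded_linear ((\<bullet>) (G x))" by (rule bounded_linear_inner_right)
      fix e :: real assume "0 < e"
      define M where "M = L + norm (G x) + 1"
      \<comment> \<open>A direction error below \<open>\<eta>\<close> costs at most
        \<open>(L + norm (G x)) * \<eta> * h\<close>, which is at most \<open>e / 2 * h\<close>; the
        other half pays for the difference quotient along the chosen direction.\<close>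
      define \<eta> where "\<eta> = e / (2 * M)"
      have M: "0 < M" "L + norm (G x) \<le> M" using L0 by (auto simp: M_def add_nonneg_pos)
      have \<eta>: "0 < \<eta>" "M * \<eta> = e / 2" using M \<open>0 < e\<close> by (simp_all add: \<eta>_def)
      have "sphere (0::'a) 1 \<subseteq> (\<Union>v\<in>Q. ball v \<eta>)"
      proof
        fix u :: 'a
        obtain v where "v \<in> Q" "v \<in> ball u \<eta>" using Q(2)[of "ball u \<eta>"] \<eta> by auto
        then show "u \<in> (\<Union>v\<in>Q. ball v \<eta>)" by (auto simp: dist_commute)
      qed
      then obtain V where V: "V \<subseteq> Q" "finite V" "sphere 0 1 \<subseteq> (\<Union>v\<in>V. ball v \<eta>)"
        using compactE_image[OF compact_sphere, of Q "\<lambda>v. ball v \<eta>"] by (metis open_ball)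
      have "\<exists>r>0. \<forall>h. h \<noteq> 0 \<and> \<bar>h\<bar> < r \<longrightarrow> \<bar>(f (x + h *\<^sub>R v) - f x) / h - G x \<bullet> v\<bar> < e / 2" if "v \<in> V" for v
      proof -
        have "((\<lambda>h. (f (x + h *\<^sub>R v) - f x) / h) \<longlongrightarrow> G x \<bullet> v) (at 0)"
          using der V(1) that by (auto simp: has_dir_deriv_def)
        from LIM_D[OF this, of "e / 2"] show ?thesis using \<open>0 < e\<close> by simp
      qed
      then obtain r where r: "\<And>v. v \<in> V \<Longrightarrow> 0 < r v"
          "\<And>v h. v \<in> V \<Longrightarrow> h \<noteq> 0 \<Longrightarrow> \<bar>h\<bar> < r v \<Longrightarrow> \<bar>(f (x + h *\<^sub>R v) - f x) / h - G x \<bullet> v\<bar> < e / 2"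
        by metis
      define d where "d = Min (insert 1 (r ` V))"
      have d: "0 < d" "\<And>v. v \<in> V \<Longrightarrow> d \<le> r v" using V(2) r(1) by (auto simp: d_def)
      show "\<exists>d>0. \<forall>y. norm (y - x) < d \<longrightarrow> norm (f y - f x - G x \<bullet> (y - x)) \<le> e * norm (y - x)"
      proof (intro exI[of _ d] conjI allI impI d(1))
        fix y assume y: "norm (y - x) < d"
        show "norm (f y - f x - G x \<bullet> (y - x)) \<le> e * norm (y - x)"
        proof (cases "y = x")
          case False
          define h where "h = norm (y - x)"
          define u where "u = (1 / h) *\<^sub>R (y - x)"
          have h: "0 < h" "h < d" using False y by (auto simp: h_def)
          have y_eq: "y = x + h *\<^sub>R u" and "norm u = 1" using h by (auto simp: u_def h_def)
          then obtain v where v: "v \<in> V" "norm (u - v) < \<eta>"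
            using V(3) by (force simp: dist_norm norm_minus_commute)
          have 1: "\<bar>f (x + h *\<^sub>R u) - f (x + h *\<^sub>R v)\<bar> \<le> L * (h * \<eta>)"
          proof -
            have "\<bar>f (x + h *\<^sub>R u) - f (x + h *\<^sub>R v)\<bar> \<le> L * norm (h *\<^sub>R (u - v))"
              using lip[of "x + h *\<^sub>R u" "x + h *\<^sub>R v"] by (simp add: scaleR_diff_right)
            also have "\<dots> \<le> L * (h * \<eta>)" using L0 h v by (intro mult_left_mono) auto
            finally show ?thesis .
          qed
          have "\<bar>(f (x + h *\<^sub>R v) - f x) / h - G x \<bullet> v\<bar> < e / 2"
            using r(2)[OF v(1), of h] d(2)[OF v(1)] h by simp
          then have "\<bar>((f (x + h *\<^sub>R v) - f x) / h - G x \<bullet> v) * h\<bar> \<le> e / 2 * h"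
            unfolding abs_mult using h \<open>0 < e\<close> by (intro mult_mono) auto
          then have 2: "\<bar>f (x + h *\<^sub>R v) - f x - h * (G x \<bullet> v)\<bar> \<le> e / 2 * h"
          proof -
            have "((f (x + h *\<^sub>R v) - f x) / h - G x \<bullet> v) * h = f (x + h *\<^sub>R v) - f x - h * (G x \<bullet> v)"
              using h by (simp add: field_simps)
            then show ?thesis
              using \<open>\<bar>((f (x + h *\<^sub>R v) - f x) / h - G x \<bullet> v) * h\<bar> \<le> e / 2 * h\<close> by simp
          qed
          have 3: "\<bar>h * (G x \<bullet> (v - u))\<bar> \<le> h * (norm (G x) * \<eta>)"
          proof -
            have "\<bar>G x \<bullet> (v - u)\<bar> \<le> norm (G x) * norm (v - u)" by (rule Cauchy_Schwarz_ineq2)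
            also have "\<dots> \<le> norm (G x) * \<eta>" using v by (intro mult_left_mono) (auto simp: norm_minus_commute)
            finally show ?thesis using h by (simp add: abs_mult)
          qed
          have "f y - f x - G x \<bullet> (y - x)
             = (f (x + h *\<^sub>R u) - f (x + h *\<^sub>R v)) + (f (x + h *\<^sub>R v) - f x - h * (G x \<bullet> v)) + h * (G x \<bullet> (v - u))"
            by (simp add: y_eq inner_diff_right algebra_simps)
          then have "\<bar>f y - f x - G x \<bullet> (y - x)\<bar> \<le> L * (h * \<eta>) + e / 2 * h + h * (norm (G x) * \<eta>)"
            using 1 2 3 by linarith
          also have "\<dots> = (L + norm (G x)) * \<eta> * h + e / 2 * h" by (simp add: algebra_simps)
          also have "\<dots> \<le> M * \<eta> * h + e / 2 * h"
            using M(2) \<eta> h by (intro add_right_mono mult_right_mono) auto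
          also have "\<dots> = e * h" by (simp add: \<eta>(2))
          finally show ?thesis by (simp add: h_def)
        qed simp
      qed
    qed
    then show "f differentiable (at x)" by (auto simp: differentiable_def)
  qed
qed

subsection \<open>Almost everywhere differentiability of gradients of convex functions\<close>

lemma convex_on_subgradient:
  fixes f :: "'a::real_inner \<Rightarrow> real"
  assumes f: "convex_on S f" and x: "x \<in> S" and z: "z \<in> S" and der: "GDERIV f x :> p"
  shows "f x + p \<bullet> (z - x) \<le> f z"
proof -
  let ?l = "\<lambda>\<tau>::real. x + \<tau> *\<^sub>R (z - x)"
  have "(?l has_derivative (\<lambda>\<tau>. \<tau> *\<^sub>R (z - x))) (at 0)"
    by (auto intro!: derivative_eq_intros)
  moreover have "(f has_derivative (\<lambda>h. h \<bullet> p)) (at (?l 0))"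
    using der by (simp add: gderiv_def)
  ultimately have "((\<lambda>\<tau>. f (?l \<tau>)) has_derivative (\<lambda>\<tau>. (\<tau> *\<^sub>R (z - x)) \<bullet> p)) (at 0)"
    by (rule has_derivative_compose)
  then have "((\<lambda>\<tau>. f (?l \<tau>)) has_real_derivative p \<bullet> (z - x)) (at 0)"
    by (simp add: has_field_derivative_def inner_commute mult_commute_abs)
  then have "((\<lambda>\<tau>. (f (?l \<tau>) - f x) / \<tau>) \<longlongrightarrow> p \<bullet> (z - x)) (at 0)"
    by (simp add: has_field_derivative_iff)
  then have "((\<lambda>\<tau>. (f (?l \<tau>) - f x) / \<tau>) \<longlongrightarrow> p \<bullet> (z - x)) (at_right 0)"
    by (rule tendsto_within_subset) simp
  moreover have "\<forall>\<^sub>F \<tau> in at_right 0. (f (?l \<tau>) - f x) / \<tau> \<le> f z - f x"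
  proof -
    have "(f (?l \<tau>) - f x) / \<tau> \<le> f z - f x" if "0 < \<tau>" "\<tau> < 1" for \<tau>
    proof -
      have "f ((1 - \<tau>) *\<^sub>R x + \<tau> *\<^sub>R z) \<le> (1 - \<tau>) * f x + \<tau> * f z"
        using convex_onD[OF f _ _ x z, of \<tau>] that by simp
      moreover have "(1 - \<tau>) *\<^sub>R x + \<tau> *\<^sub>R z = ?l \<tau>" by (simp add: algebra_simps)
      ultimately show ?thesis using that by (simp add: field_simps)
    qed
    then show ?thesis by (auto simp: eventually_at_right_field intro: exI[of _ 1])
  qed
  ultimately have "p \<bullet> (z - x) \<le> f z - f x"
    by (rule tendsto_upperbound) simp
  then show ?thesis by simp
qed

text \<open>The subgradient inequality at \<open>x'\<close> is evaluated at distance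
  \<open>r\<close> from \<open>x\<close> in the direction of \<open>t x' - t x\<close>. Compared
  with the first-order expansion of \<open>f\<close> at \<open>x\<close>, it bounds \<open>r\<close>
  times the norm of that difference; the bound \<open>B\<close> pays for moving the base point from
  \<open>x\<close> to \<open>x'\<close>.\<close>

lemma subgradient_continuous_on:
  fixes f :: "'a::real_inner \<Rightarrow> real" and t :: "'a \<Rightarrow> 'a"
  assumes U: "open U" "D \<subseteq> U"
    and sub: "\<And>x z. x \<in> D \<Longrightarrow> z \<in> U \<Longrightarrow> f x + t x \<bullet> (z - x) \<le> f z"
    and der: "\<And>x. x \<in> D \<Longrightarrow> GDERIV f x :> t x"
    and bound: "\<And>x. x \<in> D \<Longrightarrow> norm (t x) \<le> B"
  shows "continuous_on D t"
proof (unfold continuous_on_iff, intro ballI allI impI)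
  fix x e assume x: "x \<in> D" and e: "0 < (e::real)"
  have B: "0 \<le> B" using bound[OF x] norm_ge_zero order_trans by blast
  obtain d0 where d0: "0 < d0" "\<And>y. norm (y - x) < d0 \<Longrightarrow> norm (f y - f x - (y - x) \<bullet> t x) \<le> e / 4 * norm (y - x)"
    using der[OF x] e unfolding gderiv_def has_derivative_at_alt by (metis divide_pos_pos zero_less_numeral)
  obtain d1 where d1: "0 < d1" "ball x d1 \<subseteq> U"
    using U x open_contains_ball by (metis subsetD)
  define r where "r = min d0 d1 / 2"
  have r: "0 < r" "r < d0" "r < d1" using d0 d1 by (auto simp: r_def)
  \<comment> \<open>Chosen so that the base-point term \<open>(2 * B) * k\<close> is at most
    \<open>e * r / 4\<close>; the extra 1 in the denominator covers \<open>B = 0\<close>.\<close>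
  define k where "k = e * r / (4 * (2 * B + 1))"
  have k: "0 < k" "(2 * B) * k \<le> e * r / 4" using e r B by (auto simp: k_def field_simps)
  show "\<exists>d>0. \<forall>x'\<in>D. dist x' x < d \<longrightarrow> dist (t x') (t x) < e"
  proof (intro exI[of _ k] conjI ballI impI k(1))
    fix x' assume x': "x' \<in> D" "dist x' x < k"
    show "dist (t x') (t x) < e"
    proof (cases "t x' = t x")
      case False
      define \<delta> where "\<delta> = norm (t x' - t x)"
      have \<delta>: "0 < \<delta>" using False by (simp add: \<delta>_def)
      define w where "w = (1 / \<delta>) *\<^sub>R (t x' - t x)"
      have w: "norm w = 1" "(t x' - t x) \<bullet> w = \<delta>"
        using \<delta> by (auto simp: w_def \<delta>_def dot_square_norm power2_eq_square)
      let ?z = "x + r *\<^sub>R w"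
      have zU: "?z \<in> U" using d1 r w by (intro subsetD[OF d1(2)]) (simp add: dist_norm)
      have "norm (f ?z - f x - (?z - x) \<bullet> t x) \<le> e / 4 * norm (?z - x)"
        by (rule d0(2)) (use r w in simp)
      then have "\<bar>f ?z - f x - r * (t x \<bullet> w)\<bar> \<le> e / 4 * r"
        using r w by (simp add: inner_commute)
      then have 1: "f ?z \<le> f x + r * (t x \<bullet> w) + e / 4 * r" using abs_le_D1 by fastforce
      have 2: "f x' + t x' \<bullet> (?z - x') \<le> f ?z" by (rule sub[OF x'(1) zU])
      have 3: "f x + t x \<bullet> (x' - x) \<le> f x'" using sub[OF x] x' U by blast
      have "r * ((t x' - t x) \<bullet> w) - (t x' - t x) \<bullet> (x' - x) \<le> e / 4 * r"
        using 1 2 3 by (simp add: inner_diff_left inner_diff_right inner_add_right algebra_simps)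
      moreover have "(t x' - t x) \<bullet> (x' - x) \<le> (2 * B) * k"
      proof -
        have "(t x' - t x) \<bullet> (x' - x) \<le> norm (t x' - t x) * norm (x' - x)" by (rule norm_cauchy_schwarz)
        also have "\<dots> \<le> (2 * B) * k"
          using norm_triangle_ineq4[of "t x'" "t x"] bound[OF x] bound[OF x'(1)] x'(2) B
          by (intro mult_mono) (auto simp: dist_norm)
        finally show ?thesis .
      qed
      ultimately have "r * \<delta> \<le> e / 4 * r + e * r / 4" using k(2) w(2) by simp
      then have "r * \<delta> \<le> r * (e / 2)" by (simp add: algebra_simps)
      then have "\<delta> \<le> e / 2" using r by simp
      then show ?thesis using e by (simp add: \<delta>_def dist_norm)
    qed (use e in simp)
  qed
qed

section \<open>Differentiability through the resolvent\<close>

text \<open>The infimum of \<open>f z + norm (y - z)\<close> over \<open>S\<close> is the largest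
  extension with Lipschitz constant 1. The resolvent lives only on the range of
  \<open>x + t x\<close>, whereas Rademacher's theorem concerns functions on the whole
  space.\<close>

lemma McShane_extension:
  fixes f :: "'a::real_normed_vector \<Rightarrow> real"
  assumes lip: "\<And>x y. x \<in> S \<Longrightarrow> y \<in> S \<Longrightarrow> \<bar>f x - f y\<bar> \<le> norm (x - y)"
  obtains F where "\<And>x. x \<in> S \<Longrightarrow> F x = f x" "\<And>x y. \<bar>F x - F y\<bar> \<le> 1 * norm (x - y)"
proof (cases "S = {}")
  case True
  then show ?thesis using that[of "\<lambda>_. 0"] by simp
next
  case False
  then obtain s where s: "s \<in> S" by blast
  define F where "F y = (INF z\<in>S. f z + norm (y - z))" for y
  have lower: "f s - norm (y - s) \<le> f z + norm (y - z)" if "z \<in> S" for y z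
    using lip[OF s that] norm_triangle_ineq4[of "y - z" "y - s"] by (simp add: abs_le_iff norm_minus_commute)
  have bdd: "bdd_below ((\<lambda>z. f z + norm (y - z)) ` S)" for y
    using lower by (intro bdd_belowI2)
  have "F x = f x" if x: "x \<in> S" for x
  proof (rule antisym)
    show "F x \<le> f x" unfolding F_def using cINF_lower[OF bdd x, of x] by simp
    show "f x \<le> F x" unfolding F_def
    proof (rule cINF_greatest[OF False])
      fix z assume "z \<in> S" then show "f x \<le> f z + norm (x - z)" using lip[OF x] by (simp add: abs_le_iff) (metis add.commute diff_le_eq)
    qed
  qed
  moreover have F_le: "F x \<le> F y + norm (x - y)" for x y
  proof -
    have "F x - norm (x - y) \<le> F y" unfolding F_def[of y]
    proof (rule cINF_greatest[OF False])
      fix z assume z: "z \<in> S"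
      have "F x \<le> f z + norm (x - z)" unfolding F_def by (rule cINF_lower[OF bdd z])
      then show "F x - norm (x - y) \<le> f z + norm (y - z)"
        using norm_triangle_ineq[of "x - y" "y - z"] by simp
    qed
    then show ?thesis by simp
  qed
  moreover have "\<bar>F x - F y\<bar> \<le> 1 * norm (x - y)" for x y
    using F_le[of x y] F_le[of y x] by (simp add: abs_le_iff norm_minus_commute)
  ultimately show ?thesis using that by blast
qed

text \<open>Minty's trick: the resolvent of a monotone map is Lipschitz, so Rademacher's theorem applies to it.\<close>

lemma monotone_differentiable_ae:
  fixes t :: "real^'n \<Rightarrow> real^'n"
  assumes mono: "\<And>x y. x \<in> D \<Longrightarrow> y \<in> D \<Longrightarrow> 0 \<le> (t x - t y) \<bullet> (x - y)"
    and cont: "continuous_on D t"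
  shows "negligible {x \<in> D. \<not> t differentiable (at x within D)}"
proof -
  define g where "g x = x + t x" for x
  \<comment> \<open>Adding a monotone map to the identity cannot shorten distances, so
    \<open>g\<close> has an inverse with Lipschitz constant 1 on its range.\<close>
  have expand: "norm (x - y) \<le> norm (g x - g y)" if "x \<in> D" "y \<in> D" for x y
  proof (cases "x = y")
    case False
    have "norm (x - y) * norm (x - y) = (x - y) \<bullet> (x - y)" by (simp add: dot_square_norm power2_eq_square)
    also have "\<dots> \<le> (g x - g y) \<bullet> (x - y)"
      using mono[OF that] by (simp add: g_def inner_diff_left inner_add_left algebra_simps)
    also have "\<dots> \<le> norm (g x - g y) * norm (x - y)" by (rule norm_cauchy_schwarz)
    finally show ?thesis using False by simp
  qed simp
  have inj: "inj_on g D"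
  proof (rule inj_onI)
    fix x y assume "x \<in> D" "y \<in> D" "g x = g y"
    then show "x = y" using expand[of x y] by simp
  qed
  define G where "G = g ` D"
  define f where "f = inv_into D g"
  have fg: "f (g x) = x" if "x \<in> D" for x using inj that by (simp add: f_def)
  have fD: "f y \<in> D" "g (f y) = y" if "y \<in> G" for y
    using that fg by (auto simp: G_def)
  have comp: "\<exists>F. (\<forall>y\<in>G. F y = f y $ i) \<and> (\<forall>x y. \<bar>F x - F y\<bar> \<le> 1 * norm (x - y))" for i
  proof -
    have "\<bar>f x $ i - f y $ i\<bar> \<le> norm (x - y)" if "x \<in> G" "y \<in> G" for x y
      using component_le_norm_cart[of "f x - f y" i] expand[OF fD(1)[OF that(1)] fD(1)[OF that(2)]] fD that
      by simp
    then show ?thesis using McShane_extension[of G "\<lambda>y. f y $ i"] by metis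
  qed
  then obtain F' where F': "\<And>i y. y \<in> G \<Longrightarrow> F' i y = f y $ i" "\<And>i x y. \<bar>F' i x - F' i y\<bar> \<le> 1 * norm (x - y)"
    by metis
  define F where "F y = (\<chi> i. F' i y)" for y
  have Ff: "F y = f y" if "y \<in> G" for y using F'(1)[OF that] by (simp add: F_def vec_eq_iff)
  have F_lip: "norm (F x - F y) \<le> real CARD('n) * norm (x - y)" for x y
  proof -
    have "norm (F x - F y) \<le> (\<Sum>i\<in>UNIV. \<bar>(F x - F y) $ i\<bar>)" by (rule norm_le_l1_cart)
    also have "\<dots> \<le> (\<Sum>i\<in>(UNIV::'n set). norm (x - y))"
      using F'(2)[of _ x y] by (intro sum_mono) (simp add: F_def)
    finally show ?thesis by simp
  qed
  have "AE y in lborel. \<forall>i. F' i differentiable (at y)"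
    using Rademacher[OF F'(2)] by (subst AE_all_countable) blast
  then have "AE y in lborel. F differentiable (at y)"
  proof eventually_elim
    fix y assume "\<forall>i. F' i differentiable (at y)"
    then obtain d where "\<And>i. (F' i has_derivative d i) (at y)" unfolding differentiable_def by metis
    then have "(F has_derivative (\<lambda>h. \<chi> i. d i h)) (at y)"
      unfolding F_def by (subst has_derivative_componentwise_within) (auto simp: Basis_vec_def inner_axis)
    then show "F differentiable (at y)" unfolding differentiable_def by blast
  qed
  then obtain N where N: "N \<in> null_sets lborel" "\<And>y. y \<notin> N \<Longrightarrow> F differentiable (at y)"
    by (auto elim!: AE_E3)
  then have "negligible N" by (simp add: negligible_iff_null_sets null_sets_completionI)
  then have neg1: "negligible (F ` N)"
    using F_lip by (intro negligible_locally_Lipschitz_image) (auto intro!: exI[of _ UNIV] exI[of _ "real CARD('n)"])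
  \<comment> \<open>Two kinds of exceptional points remain: images under \<open>F\<close> of points
    where \<open>F\<close> is not differentiable, null because \<open>F\<close> is Lipschitz, and of
    points where its derivative is singular, null by Sard's lemma. Elsewhere \<open>g\<close> gets
    the inverse derivative.\<close>
  define Z where "Z = {y \<in> G. y \<notin> N \<and> det (matrix (frechet_derivative F (at y))) = 0}"
  have F_der: "(F has_derivative frechet_derivative F (at y)) (at y)" if "y \<notin> N" for y
    using N(2)[OF that] by (simp add: frechet_derivative_works[symmetric])
  have neg2: "negligible (F ` Z)"
    by (rule negligible_image_det_zero[where g' = "\<lambda>y. frechet_derivative F (at y)"])
      (auto simp: Z_def intro: has_derivative_at_withinI F_der)
  have "t differentiable (at x within D)" if x: "x \<in> D" "x \<notin> F ` N" "x \<notin> F ` Z" for x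
  proof -
    have gx: "g x \<in> G" "F (g x) = x" using x fg Ff by (auto simp: G_def)
    have nN: "g x \<notin> N" using x(2) gx by (metis imageI)
    let ?F' = "frechet_derivative F (at (g x))"
    have "det (matrix ?F') \<noteq> 0" using x(3) gx nN unfolding Z_def by (metis (mono_tags, lifting) imageI mem_Collect_eq)
    moreover have lin: "linear ?F'" using F_der[OF nN] has_derivative_linear by blast
    ultimately obtain h where h: "linear h" "h \<circ> ?F' = id"
      using det_nz_iff_inj linear_injective_left_inverse by metis
    have im: "F ` G = D" using fD fg Ff by (force simp: G_def)
    \<comment> \<open>Continuity of \<open>t\<close> enters here: the rule for the derivative of an
      inverse asks for continuity of the inverse, which is \<open>g\<close>.\<close>
    have "continuous_on D g" unfolding g_def by (intro continuous_intros cont)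
    then have c: "continuous (at (F (g x)) within F ` G) g"
      using x(1) gx im by (simp add: continuous_on_eq_continuous_within)
    have "(g has_derivative h) (at (F (g x)) within F ` G)"
      by (rule has_derivative_inverse_within[OF has_derivative_at_withinI[OF F_der[OF nN]] c gx(1) h])
        (use Ff fD in auto)
    then have "(g has_derivative h) (at x within D)" using gx im by simp
    then have "((\<lambda>y. g y - y) has_derivative (\<lambda>v. h v - v)) (at x within D)"
      by (intro derivative_intros)
    then show ?thesis unfolding differentiable_def by (auto simp: g_def)
  qed
  then have "{x \<in> D. \<not> t differentiable (at x within D)} \<subseteq> F ` N \<union> F ` Z" by blast
  then show ?thesis using neg1 neg2 negligible_subset negligible_Un by blast
qed

section \<open>Blow-up along sets of full measure\<close>

text \<open>A set of full measure may miss a whole ray from \<open>x\<close>, but it meets the ball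
  of radius \<open>?r m * ?r m\<close> around the point of the ray at parameter \<open>?r m\<close>;
  divided by \<open>?r m\<close>, this error still tends to 0.\<close>

lemma dense_blow_up:
  fixes x w :: "'a::euclidean_space"
  assumes "open U" "x \<in> U" "negligible (U - D)"
  shows "\<exists>w'. w' \<longlonglongrightarrow> w \<and> (\<forall>\<^sub>F m in sequentially. x + (1 / real (Suc m)) *\<^sub>R w' m \<in> D)"
proof -
  let ?r = "\<lambda>m. 1 / real (Suc m)"
  have r0: "?r \<longlonglongrightarrow> 0" using LIMSEQ_Suc[OF lim_inverse_n'] by (simp del: of_nat_Suc)
  have "\<exists>p. x + ?r m *\<^sub>R w \<in> U \<longrightarrow> p \<in> D \<and> dist (x + ?r m *\<^sub>R w) p < ?r m * ?r m" for m
  proof (cases "x + ?r m *\<^sub>R w \<in> U")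
    case True
    let ?B = "U \<inter> ball (x + ?r m *\<^sub>R w) (?r m * ?r m)"
    have "open ?B" "?B \<noteq> {}" using True assms(1) by (auto simp del: of_nat_Suc)
    then have "\<not> negligible ?B" using open_not_negligible by blast
    then have "\<not> ?B \<subseteq> U - D" using assms(3) negligible_subset by blast
    then show ?thesis by auto
  qed simp
  then obtain p where p: "\<And>m. x + ?r m *\<^sub>R w \<in> U \<Longrightarrow> p m \<in> D \<and> dist (x + ?r m *\<^sub>R w) (p m) < ?r m * ?r m"
    by metis
  define w' where "w' m = real (Suc m) *\<^sub>R (p m - x)" for m
  have w': "x + ?r m *\<^sub>R w' m = p m" for m by (simp add: w'_def del: of_nat_Suc)
  have "(\<lambda>m. x + ?r m *\<^sub>R w) \<longlonglongrightarrow> x + 0 *\<^sub>R w" by (intro tendsto_intros r0)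
  then have ev: "\<forall>\<^sub>F m in sequentially. x + ?r m *\<^sub>R w \<in> U"
    using topological_tendstoD assms(1,2) by fastforce
  have "\<forall>\<^sub>F m in sequentially. norm (w' m - w) \<le> ?r m"
    using ev
  proof eventually_elim
    fix m assume "x + ?r m *\<^sub>R w \<in> U"
    then have "norm (p m - (x + ?r m *\<^sub>R w)) < ?r m * ?r m" using p by (simp add: dist_norm norm_minus_commute)
    also have "p m - (x + ?r m *\<^sub>R w) = ?r m *\<^sub>R (w' m - w)"
      by (simp add: w'_def scaleR_diff_right del: of_nat_Suc)
    finally have "?r m * norm (w' m - w) < ?r m * ?r m" by (simp del: of_nat_Suc)
    then have "norm (w' m - w) < ?r m" by (rule mult_left_less_imp_less) simp
    then show "norm (w' m - w) \<le> ?r m" by simp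
  qed
  then have "(\<lambda>m. w' m - w) \<longlonglongrightarrow> 0" by (rule Lim_null_comparison[OF _ r0])
  then have "w' \<longlonglongrightarrow> w" by (simp add: LIM_zero_iff)
  moreover have "\<forall>\<^sub>F m in sequentially. x + ?r m *\<^sub>R w' m \<in> D"
    unfolding w' using ev by eventually_elim (use p in blast)
  ultimately show ?thesis by blast
qed

lemma derivative_blow_up:
  fixes t :: "'a::euclidean_space \<Rightarrow> 'b::real_normed_vector"
  assumes der: "(t has_derivative A) (at x within D)" and w: "w \<longlonglongrightarrow> v"
    and D: "\<forall>\<^sub>F m in sequentially. x + (1 / real (Suc m)) *\<^sub>R w m \<in> D"
  shows "(\<lambda>m. real (Suc m) *\<^sub>R (t (x + (1 / real (Suc m)) *\<^sub>R w m) - t x)) \<longlonglongrightarrow> A v"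
proof -
  let ?r = "\<lambda>m. 1 / real (Suc m)"
  let ?q = "\<lambda>m. real (Suc m) *\<^sub>R (t (x + ?r m *\<^sub>R w m) - t x)"
  have r0: "?r \<longlonglongrightarrow> 0" using LIMSEQ_Suc[OF lim_inverse_n'] by (simp del: of_nat_Suc)
  have bl: "bounded_linear A" using der by (rule has_derivative_bounded_linear)
  have Aw: "(\<lambda>m. A (w m)) \<longlonglongrightarrow> A v" by (rule bounded_linear.tendsto[OF bl w])
  have wr: "(\<lambda>m. ?r m *\<^sub>R w m) \<longlonglongrightarrow> 0 *\<^sub>R v" by (intro tendsto_intros r0 w)
  obtain W where W: "0 < W" "\<And>m. norm (w m) \<le> W"
    using w convergent_imp_Bseq[of w] by (auto simp: convergent_def Bseq_def)
  have "(\<lambda>m. ?q m - A (w m)) \<longlonglongrightarrow> 0"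
  proof (rule tendstoI)
    fix e :: real assume e: "0 < e"
    obtain d where d: "0 < d" "\<And>y. y \<in> D \<Longrightarrow> norm (y - x) < d \<Longrightarrow> norm (t y - t x - A (y - x)) \<le> e / (2 * W) * norm (y - x)"
      using der e W(1) unfolding has_derivative_within_alt by (metis divide_pos_pos mult_pos_pos zero_less_numeral)
    have "\<forall>\<^sub>F m in sequentially. norm (?r m *\<^sub>R w m) < d"
      using tendstoD[OF wr d(1)] by (simp add: dist_norm)
    then show "\<forall>\<^sub>F m in sequentially. dist (?q m - A (w m)) 0 < e"
      using D
    proof eventually_elim
      fix m assume 1: "norm (?r m *\<^sub>R w m) < d" and 2: "x + ?r m *\<^sub>R w m \<in> D"
      have "norm (t (x + ?r m *\<^sub>R w m) - t x - A (?r m *\<^sub>R w m)) \<le> e / (2 * W) * norm (?r m *\<^sub>R w m)"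
        using d(2)[OF 2] 1 by simp
      then have "real (Suc m) * norm (t (x + ?r m *\<^sub>R w m) - t x - A (?r m *\<^sub>R w m)) \<le> real (Suc m) * (e / (2 * W) * norm (?r m *\<^sub>R w m))"
        by (rule mult_left_mono) (rule of_nat_0_le_iff)
      also have "real (Suc m) * (e / (2 * W) * norm (?r m *\<^sub>R w m)) = e / (2 * W) * norm (w m)"
        by (simp del: of_nat_Suc)
      also have "\<dots> \<le> e / (2 * W) * W" using W e by (intro mult_left_mono) auto
      also have "\<dots> < e" using W e by simp
      also have "real (Suc m) * norm (t (x + ?r m *\<^sub>R w m) - t x - A (?r m *\<^sub>R w m))
          = norm (real (Suc m) *\<^sub>R (t (x + ?r m *\<^sub>R w m) - t x - A (?r m *\<^sub>R w m)))" by simp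
      also have "real (Suc m) *\<^sub>R (t (x + ?r m *\<^sub>R w m) - t x - A (?r m *\<^sub>R w m)) = ?q m - A (w m)"
        by (simp add: scaleR_diff_right linear_cmul[OF bounded_linear.linear[OF bl]] del: of_nat_Suc)
      finally show "dist (?q m - A (w m)) 0 < e" by simp
    qed
  qed
  from tendsto_add[OF this Aw] show ?thesis by simp
qed

text \<open>Surjectivity provides \<open>v\<close> with \<open>A v = y - x\<close>. Monotonicity
  between \<open>y\<close> and points approaching \<open>x\<close> along \<open>v\<close> becomes
  \<open>0 \<le> A v \<bullet> (x - y)\<close> in the limit, and the right-hand side is minus the
  squared distance of \<open>x\<close> and \<open>y\<close>. Nondegeneracy at \<open>x\<close> thus
  separates the value at \<open>x\<close> from all others.\<close>

lemma monotone_derivative_injective: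
  fixes t :: "'a::euclidean_space \<Rightarrow> 'a"
  assumes U: "open U" "x \<in> U" "negligible (U - D)"
    and mono: "\<And>x y. x \<in> D \<Longrightarrow> y \<in> D \<Longrightarrow> 0 \<le> (t x - t y) \<bullet> (x - y)"
    and der: "(t has_derivative A) (at x within D)" and surj: "surj A"
    and y: "y \<in> D" "t y = t x"
  shows "y = x"
proof -
  obtain v where v: "A v = y - x" using surj by (metis surjD)
  obtain w where w: "w \<longlonglongrightarrow> v" "\<forall>\<^sub>F m in sequentially. x + (1 / real (Suc m)) *\<^sub>R w m \<in> D"
    using dense_blow_up[OF U] by blast
  let ?r = "\<lambda>m. 1 / real (Suc m)"
  let ?p = "\<lambda>m. x + ?r m *\<^sub>R w m"
  have "?r \<longlonglongrightarrow> 0" using LIMSEQ_Suc[OF lim_inverse_n'] by (simp del: of_nat_Suc)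
  then have "(\<lambda>m. (real (Suc m) *\<^sub>R (t (?p m) - t x)) \<bullet> (?p m - y)) \<longlonglongrightarrow> A v \<bullet> (x + 0 *\<^sub>R v - y)"
    by (intro tendsto_intros derivative_blow_up[OF der w] w)
  moreover have "\<forall>\<^sub>F m in sequentially. 0 \<le> (real (Suc m) *\<^sub>R (t (?p m) - t x)) \<bullet> (?p m - y)"
    using w(2) by eventually_elim (use mono[OF _ y(1)] y(2) in \<open>simp del: of_nat_Suc\<close>)
  ultimately have "0 \<le> A v \<bullet> (x + 0 *\<^sub>R v - y)"
    by (rule tendsto_lowerbound) simp
  then have "\<not> 0 < (y - x) \<bullet> (y - x)" by (simp add: v inner_diff_right)
  then show ?thesis by (simp only: inner_gt_zero_iff) simp
qed

lemma monotone_derivative_nonneg: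
  fixes t :: "'a::euclidean_space \<Rightarrow> 'a"
  assumes U: "open U" "x \<in> U" "negligible (U - D)" and x: "x \<in> D"
    and mono: "\<And>x y. x \<in> D \<Longrightarrow> y \<in> D \<Longrightarrow> 0 \<le> (t x - t y) \<bullet> (x - y)"
    and der: "(t has_derivative A) (at x within D)"
  shows "0 \<le> A v \<bullet> v"
proof -
  obtain w where w: "w \<longlonglongrightarrow> v" "\<forall>\<^sub>F m in sequentially. x + (1 / real (Suc m)) *\<^sub>R w m \<in> D"
    using dense_blow_up[OF U] by blast
  let ?p = "\<lambda>m. x + (1 / real (Suc m)) *\<^sub>R w m"
  have "(\<lambda>m. (real (Suc m) *\<^sub>R (t (?p m) - t x)) \<bullet> w m) \<longlonglongrightarrow> A v \<bullet> v"
    by (intro tendsto_intros derivative_blow_up[OF der w] w)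
  moreover have "\<forall>\<^sub>F m in sequentially. 0 \<le> (real (Suc m) *\<^sub>R (t (?p m) - t x)) \<bullet> w m"
    using w(2)
  proof eventually_elim
    fix m assume "?p m \<in> D"
    then have "0 \<le> (t (?p m) - t x) \<bullet> ((1 / real (Suc m)) *\<^sub>R w m)" using mono[OF _ x] by force
    then show "0 \<le> (real (Suc m) *\<^sub>R (t (?p m) - t x)) \<bullet> w m"
      by (simp add: zero_le_mult_iff zero_le_divide_iff del: of_nat_Suc)
  qed
  ultimately show ?thesis by (rule tendsto_lowerbound) simp
qed

text \<open>Cyclic monotonicity at points near \<open>x + w i / Suc m\<close>, rescaled by the
  square of \<open>Suc m\<close>: one factor turns differences of \<open>t\<close> into difference
  quotients, the other turns differences of points into differences of directions.\<close>

lemma cyclic_derivative: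
  fixes t :: "'a::euclidean_space \<Rightarrow> 'a"
  assumes U: "open U" "x \<in> U" "negligible (U - D)"
    and sub: "\<And>x z. x \<in> D \<Longrightarrow> z \<in> D \<Longrightarrow> f x + t x \<bullet> (z - x) \<le> f z"
    and der: "(t has_derivative A) (at x within D)"
    and cyc: "w n = w 0"
  shows "(\<Sum>i<n. A (w i) \<bullet> (w (Suc i) - w i)) \<le> 0"
proof -
  have "\<exists>u. u \<longlonglongrightarrow> w i \<and> (\<forall>\<^sub>F m in sequentially. x + (1 / real (Suc m)) *\<^sub>R u m \<in> D)" for i
    using dense_blow_up[OF U] by blast
  then obtain u' where u': "\<And>i. u' i \<longlonglongrightarrow> w i" "\<And>i. \<forall>\<^sub>F m in sequentially. x + (1 / real (Suc m)) *\<^sub>R u' i m \<in> D"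
    by metis
  \<comment> \<open>Approximants of the first and the last vertex are chosen independently; reusing
    the first one closes the polygon exactly, so that the sum below telescopes to 0.\<close>
  define u where "u i = (if i = n then u' 0 else u' i)" for i
  have u: "u i \<longlonglongrightarrow> w i" "\<forall>\<^sub>F m in sequentially. x + (1 / real (Suc m)) *\<^sub>R u i m \<in> D" for i
    using u' cyc by (auto simp: u_def)
  have u_cyc: "u n = u 0" by (simp add: u_def)
  let ?p = "\<lambda>i m. x + (1 / real (Suc m)) *\<^sub>R u i m"
  let ?q = "\<lambda>i m. real (Suc m) *\<^sub>R (t (?p i m) - t x)"
  have "(\<lambda>m. \<Sum>i<n. ?q i m \<bullet> (u (Suc i) m - u i m)) \<longlonglongrightarrow> (\<Sum>i<n. A (w i) \<bullet> (w (Suc i) - w i))"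
    by (intro tendsto_intros derivative_blow_up[OF der] u)
  moreover have "\<forall>\<^sub>F m in sequentially. \<forall>i\<in>{..n}. ?p i m \<in> D"
    using u(2) by (intro eventually_ball_finite) auto
  then have "\<forall>\<^sub>F m in sequentially. (\<Sum>i<n. ?q i m \<bullet> (u (Suc i) m - u i m)) \<le> 0"
  proof eventually_elim
    fix m assume D: "\<forall>i\<in>{..n}. ?p i m \<in> D"
    let ?k = "real (Suc m)"
    \<comment> \<open>Subtracting the constant \<open>t x\<close> from \<open>t\<close> amounts to
      subtracting a linear function from \<open>f\<close>, which preserves the subgradient
      inequality and the telescoping.\<close>
    have step: "?q i m \<bullet> (u (Suc i) m - u i m) \<le> ?k * ?k * ((f (?p (Suc i) m) - t x \<bullet> ?p (Suc i) m) - (f (?p i m) - t x \<bullet> ?p i m))"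
      if "i < n" for i
    proof -
      have "f (?p i m) + t (?p i m) \<bullet> (?p (Suc i) m - ?p i m) \<le> f (?p (Suc i) m)"
        using D that by (intro sub) auto
      then have "(t (?p i m) - t x) \<bullet> (?p (Suc i) m - ?p i m) \<le> (f (?p (Suc i) m) - t x \<bullet> ?p (Suc i) m) - (f (?p i m) - t x \<bullet> ?p i m)"
        by (simp only: inner_diff_left inner_diff_right)
      then have "?k * ?k * ((t (?p i m) - t x) \<bullet> (?p (Suc i) m - ?p i m)) \<le> ?k * ?k * ((f (?p (Suc i) m) - t x \<bullet> ?p (Suc i) m) - (f (?p i m) - t x \<bullet> ?p i m))"
        by (intro mult_left_mono) auto
      moreover have "?p (Suc i) m - ?p i m = (1 / ?k) *\<^sub>R (u (Suc i) m - u i m)"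
        by (simp add: scaleR_diff_right del: of_nat_Suc)
      then have "?q i m \<bullet> (u (Suc i) m - u i m) = ?k * ?k * ((t (?p i m) - t x) \<bullet> (?p (Suc i) m - ?p i m))"
        by (simp del: of_nat_Suc)
      ultimately show ?thesis by simp
    qed
    have "(\<Sum>i<n. ?q i m \<bullet> (u (Suc i) m - u i m)) \<le> (\<Sum>i<n. ?k * ?k * ((f (?p (Suc i) m) - t x \<bullet> ?p (Suc i) m) - (f (?p i m) - t x \<bullet> ?p i m)))"
      using step by (intro sum_mono) simp
    also have "\<dots> = ?k * ?k * (\<Sum>i<n. (f (?p (Suc i) m) - t x \<bullet> ?p (Suc i) m) - (f (?p i m) - t x \<bullet> ?p i m))"
      by (simp only: sum_distrib_left)
    also have "\<dots> = 0"
      using sum_lessThan_telescope[of "\<lambda>i. f (?p i m) - t x \<bullet> ?p i m" n] by (simp only: u_cyc) simp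
    finally show "(\<Sum>i<n. ?q i m \<bullet> (u (Suc i) m - u i m)) \<le> 0" .
  qed
  ultimately show ?thesis by (rule tendsto_upperbound) simp
qed

text \<open>Cyclic monotonicity along a regular polygon in the plane of \<open>u\<close> and \<open>v\<close>; its defect is of second order.\<close>

lemma cyclic_monotone_linear_symmetric:
  fixes A :: "'a::euclidean_space \<Rightarrow> 'a"
  assumes A: "linear A"
    and cyc: "\<And>n w. w n = w 0 \<Longrightarrow> (\<Sum>i<n. A (w i) \<bullet> (w (Suc i) - w i)) \<le> 0"
  shows "A u \<bullet> v = u \<bullet> A v"
proof -
  obtain K where K: "\<And>x. norm (A x) \<le> norm x * K" and "0 < K"
    using bounded_linear.pos_bounded[OF linear_conv_bounded_linear[THEN iffD1, OF A]] by blast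
  have le: "A u \<bullet> v - A v \<bullet> u \<le> 0" for u v
  proof -
    define M where "M = K * (norm u + norm v)\<^sup>2"
    have "(A u \<bullet> v - A v \<bullet> u) * (sin (2 * pi / real (Suc n)) * real (Suc n)) \<le> M * (2 * pi) * (2 * pi / real (Suc n))" for n
    proof -
      let ?N = "Suc n"
      define \<theta> where "\<theta> = 2 * pi / real ?N"
      have \<theta>: "0 \<le> \<theta>" "real ?N * \<theta> = 2 * pi" by (simp_all add: \<theta>_def del: of_nat_Suc)
      define w where "w i = cos (real i * \<theta>) *\<^sub>R u + sin (real i * \<theta>) *\<^sub>R v" for i
      have wN: "w ?N = w 0" unfolding w_def \<theta>(2) by simp
      have A_add: "A (x + y) = A x + A y" and A_diff: "A (x - y) = A x - A y" and A_scale: "A (c *\<^sub>R x) = c *\<^sub>R A x" for x y c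
        using A by (simp_all add: linear_add linear_diff linear_cmul)
      have Aw: "A (w i) = cos (real i * \<theta>) *\<^sub>R A u + sin (real i * \<theta>) *\<^sub>R A v" for i
        by (simp add: w_def A_add A_scale)
      have rot: "A (w i) \<bullet> w (Suc i) - A (w (Suc i)) \<bullet> w i = (A u \<bullet> v - A v \<bullet> u) * sin \<theta>" for i
      proof -
        have "\<theta> = real (Suc i) * \<theta> - real i * \<theta>" by (simp add: algebra_simps)
        then have s: "sin \<theta> = sin (real (Suc i) * \<theta>) * cos (real i * \<theta>) - cos (real (Suc i) * \<theta>) * sin (real i * \<theta>)"
          by (metis sin_diff)
        show ?thesis unfolding Aw unfolding w_def s by (simp add: inner_add_left inner_add_right algebra_simps del: of_nat_Suc)
      qed
      have step: "norm (w (Suc i) - w i) \<le> \<theta> * (norm u + norm v)" for i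
      proof -
        have c: "\<bar>cos (real (Suc i) * \<theta>) - cos (real i * \<theta>)\<bar> \<le> \<theta>" and s: "\<bar>sin (real (Suc i) * \<theta>) - sin (real i * \<theta>)\<bar> \<le> \<theta>"
        proof -
          have "real (Suc i) * \<theta> - real i * \<theta> = \<theta>" by (simp add: algebra_simps)
          moreover have "\<bar>cos a - cos b\<bar> \<le> \<bar>a - b\<bar>" "\<bar>sin a - sin b\<bar> \<le> \<bar>a - b\<bar>" for a b :: real
          proof -
            have 1: "\<bar>sin x * y\<bar> \<le> \<bar>x\<bar>" if "\<bar>y\<bar> \<le> 1" for x y :: real
              using mult_mono[OF abs_sin_x_le_abs_x that, of x] by (simp add: abs_mult)
            show "\<bar>cos a - cos b\<bar> \<le> \<bar>a - b\<bar>"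
              using 1[of "sin ((a + b) / 2)" "(b - a) / 2"] by (simp add: cos_diff_cos abs_mult mult_ac)
            show "\<bar>sin a - sin b\<bar> \<le> \<bar>a - b\<bar>"
              using 1[of "cos ((a + b) / 2)" "(a - b) / 2"] by (simp add: sin_diff_sin abs_mult mult_ac)
          qed
          ultimately show "\<bar>cos (real (Suc i) * \<theta>) - cos (real i * \<theta>)\<bar> \<le> \<theta>" "\<bar>sin (real (Suc i) * \<theta>) - sin (real i * \<theta>)\<bar> \<le> \<theta>"
            using \<theta>(1) by (metis abs_of_nonneg)+
        qed
        have "w (Suc i) - w i = (cos (real (Suc i) * \<theta>) - cos (real i * \<theta>)) *\<^sub>R u + (sin (real (Suc i) * \<theta>) - sin (real i * \<theta>)) *\<^sub>R v"
          by (simp add: w_def algebra_simps del: of_nat_Suc)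
        also have "norm \<dots> \<le> \<bar>cos (real (Suc i) * \<theta>) - cos (real i * \<theta>)\<bar> * norm u + \<bar>sin (real (Suc i) * \<theta>) - sin (real i * \<theta>)\<bar> * norm v"
          using norm_triangle_ineq by (metis norm_scaleR)
        also have "\<dots> \<le> \<theta> * norm u + \<theta> * norm v"
          by (intro add_mono mult_right_mono c s) auto
        finally show ?thesis by (simp add: distrib_left)
      qed
      have quad: "A (w (Suc i) - w i) \<bullet> (w (Suc i) - w i) \<le> M * \<theta>\<^sup>2" for i
      proof -
        let ?d = "w (Suc i) - w i"
        have "A ?d \<bullet> ?d \<le> norm (A ?d) * norm ?d" by (rule norm_cauchy_schwarz)
        also have "\<dots> \<le> (norm ?d * K) * norm ?d" by (intro mult_right_mono K) simp
        also have "\<dots> = K * (norm ?d)\<^sup>2" by (simp add: power2_eq_square)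
        also have "\<dots> \<le> K * (\<theta> * (norm u + norm v))\<^sup>2"
          using step[of i] \<open>0 < K\<close> by (intro mult_left_mono power_mono) auto
        finally show ?thesis by (simp add: M_def power_mult_distrib mult_ac)
      qed
      \<comment> \<open>An edge term splits into a part that telescopes around the polygon, a
        quadratic defect of size at most \<open>M * \<theta>\<^sup>2\<close>, and the antisymmetric
        part of \<open>A\<close>, which by \<open>rot\<close> is the same on every edge.\<close>
      have id: "A (w i) \<bullet> (w (Suc i) - w i) = ((A (w (Suc i)) \<bullet> w (Suc i) - A (w i) \<bullet> w i)
          - A (w (Suc i) - w i) \<bullet> (w (Suc i) - w i) + (A (w i) \<bullet> w (Suc i) - A (w (Suc i)) \<bullet> w i)) / 2" for i
        by (simp add: A_diff inner_diff_left inner_diff_right)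
      have halve: "b \<le> a" if "(0 - a + b) / 2 \<le> c" "c \<le> 0" for a b c :: real
      proof -
        have "(0 - a + b) / 2 \<le> 0" using that by (rule order_trans)
        then show ?thesis by simp
      qed
      have "(\<Sum>i<?N. A (w i) \<bullet> (w (Suc i) - w i)) \<ge> (\<Sum>i<?N. ((A (w (Suc i)) \<bullet> w (Suc i) - A (w i) \<bullet> w i)
          - M * \<theta>\<^sup>2 + (A u \<bullet> v - A v \<bullet> u) * sin \<theta>) / 2)"
        unfolding id rot using quad by (intro sum_mono divide_right_mono add_right_mono diff_left_mono) auto
      also have "(\<Sum>i<?N. ((A (w (Suc i)) \<bullet> w (Suc i) - A (w i) \<bullet> w i) - M * \<theta>\<^sup>2 + (A u \<bullet> v - A v \<bullet> u) * sin \<theta>) / 2)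
         = ((\<Sum>i<?N. A (w (Suc i)) \<bullet> w (Suc i) - A (w i) \<bullet> w i) - real ?N * (M * \<theta>\<^sup>2) + real ?N * ((A u \<bullet> v - A v \<bullet> u) * sin \<theta>)) / 2"
        by (simp only: sum_divide_distrib[symmetric] sum.distrib sum_subtractf sum_constant card_lessThan)
      also have "(\<Sum>i<?N. A (w (Suc i)) \<bullet> w (Suc i) - A (w i) \<bullet> w i) = 0"
        by (subst sum_lessThan_telescope) (simp add: wN)
      finally have "real ?N * ((A u \<bullet> v - A v \<bullet> u) * sin \<theta>) \<le> real ?N * (M * \<theta>\<^sup>2)"
        using halve[OF _ cyc[OF wN]] by blast
      also have "real ?N * (M * \<theta>\<^sup>2) = M * (real ?N * \<theta>) * \<theta>" by (simp add: power2_eq_square)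
      finally show ?thesis unfolding \<theta>(2) unfolding \<theta>_def by (simp add: mult_ac)
    qed
    then have ev: "\<forall>\<^sub>F n in sequentially. (A u \<bullet> v - A v \<bullet> u) * (sin (2 * pi / real (Suc n)) * real (Suc n)) \<le> M * (2 * pi) * (2 * pi / real (Suc n))"
      by simp
    have r0: "(\<lambda>n. 2 * pi * (1 / real (Suc n))) \<longlonglongrightarrow> 2 * pi * 0"
      using LIMSEQ_Suc[OF lim_inverse_n'] by (intro tendsto_intros) (simp del: of_nat_Suc)
    then have r0': "(\<lambda>n. 2 * pi / real (Suc n)) \<longlonglongrightarrow> 0" by simp
    have "((\<lambda>x::real. sin x / x) \<longlongrightarrow> 1) (at 0)"
      using DERIV_sin[of 0] by (simp add: has_field_derivative_iff)
    moreover have "filterlim (\<lambda>n. 2 * pi / real (Suc n)) (at 0) sequentially"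
      using r0' by (simp add: filterlim_at)
    ultimately have "(\<lambda>n. sin (2 * pi / real (Suc n)) / (2 * pi / real (Suc n))) \<longlonglongrightarrow> 1"
      by (rule filterlim_compose)
    then have "(\<lambda>n. 2 * pi * (sin (2 * pi / real (Suc n)) / (2 * pi / real (Suc n)))) \<longlonglongrightarrow> 2 * pi * 1"
      by (intro tendsto_intros)
    then have s: "(\<lambda>n. sin (2 * pi / real (Suc n)) * real (Suc n)) \<longlonglongrightarrow> 2 * pi"
      by (simp del: of_nat_Suc)
    \<comment> \<open>Summed over the edges, the antisymmetric part keeps the weight
      \<open>2 * pi\<close> in the limit, while the total defect is of order \<open>\<theta>\<close>
      and vanishes.\<close>
    have "(A u \<bullet> v - A v \<bullet> u) * (2 * pi) \<le> M * (2 * pi) * 0"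
      by (rule tendsto_le[OF _ tendsto_mult_left[OF r0'] tendsto_mult_left[OF s] ev]) simp
    then show ?thesis using pi_gt_zero by (auto simp: mult_le_0_iff)
  qed
  show ?thesis using le[of u v] le[of v u] by (simp add: inner_commute)
qed

text \<open>Blow-ups run in \<open>D\<close>; only afterwards is the derivative restricted to
  \<open>E\<close>, so that \<open>t\<close> is differentiable within one and the same set at all of
  its points.\<close>

lemma convex_gradient_differentiable_ae:
  fixes t :: "real^'n \<Rightarrow> real^'n"
  assumes U: "open U" "U \<subseteq> C" and f: "convex_on C f"
    and D: "D \<subseteq> U" "negligible (U - D)"
    and der: "\<And>x. x \<in> D \<Longrightarrow> GDERIV f x :> t x"
    and bound: "\<And>x. x \<in> D \<Longrightarrow> norm (t x) \<le> B"
  obtains E where "E \<subseteq> D" "negligible (U - E)"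
    "\<And>x y. x \<in> E \<Longrightarrow> y \<in> E \<Longrightarrow> 0 \<le> (t x - t y) \<bullet> (x - y)"
    "\<And>x. x \<in> E \<Longrightarrow> \<exists>A. (t has_derivative A) (at x within E) \<and> (\<forall>u v. A u \<bullet> v = u \<bullet> A v) \<and> (\<forall>v. 0 \<le> A v \<bullet> v)"
proof -
  have sub: "f x + t x \<bullet> (z - x) \<le> f z" if "x \<in> D" "z \<in> U" for x z
    using that U D by (intro convex_on_subgradient[OF f _ _ der]) auto
  have mono: "0 \<le> (t x - t y) \<bullet> (x - y)" if "x \<in> D" "y \<in> D" for x y
  proof -
    have "f x + t x \<bullet> (y - x) \<le> f y" "f y + t y \<bullet> (x - y) \<le> f x"
      using that D(1) by (auto intro!: sub)
    then show ?thesis by (simp add: inner_diff_left inner_diff_right)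
  qed
  have "continuous_on D t"
    using subgradient_continuous_on[OF U(1) D(1) sub der bound] .
  then have neg: "negligible {x \<in> D. \<not> t differentiable (at x within D)}"
    using monotone_differentiable_ae[OF mono] by blast
  define E where "E = {x \<in> D. t differentiable (at x within D)}"
  have ED: "E \<subseteq> D" by (auto simp: E_def)
  have "U - E = (U - D) \<union> {x \<in> D. \<not> t differentiable (at x within D)}" using D by (auto simp: E_def)
  then have negE: "negligible (U - E)" using neg D by (simp add: negligible_Un)
  have "\<exists>A. (t has_derivative A) (at x within E) \<and> (\<forall>u v. A u \<bullet> v = u \<bullet> A v) \<and> (\<forall>v. 0 \<le> A v \<bullet> v)" if x: "x \<in> E" for x
  proof -
    obtain A where A: "(t has_derivative A) (at x within D)" using x by (auto simp: E_def differentiable_def)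
    have xDU: "x \<in> D" "x \<in> U" using x ED D by auto
    have "A u \<bullet> v = u \<bullet> A v" for u v
    proof (rule cyclic_monotone_linear_symmetric)
      show "linear A" using A by (rule has_derivative_linear)
      show "(\<Sum>i<n. A (w i) \<bullet> (w (Suc i) - w i)) \<le> 0" if "w n = w 0" for n w
        using cyclic_derivative[OF U(1) xDU(2) D(2) _ A that] sub D(1) by blast
    qed
    moreover have "0 \<le> A v \<bullet> v" for v
      using monotone_derivative_nonneg[OF U(1) xDU(2) D(2) xDU(1) mono A] .
    ultimately show ?thesis using has_derivative_subset[OF A ED] by blast
  qed
  then show ?thesis using that[OF ED negE] mono ED by blast
qed

subsection \<open>Minkowski's determinant inequality\<close>

lemma matrix_congruence_component:
  fixes S B :: "real^'n^'n"
  shows "(B ** S ** transpose B) $ i $ j = row i B \<bullet> (S *v row j B)"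
proof -
  have "(B ** S ** transpose B) $ i $ j = (\<Sum>k\<in>UNIV. \<Sum>l\<in>UNIV. B $ i $ l * S $ l $ k * B $ j $ k)"
    by (simp add: matrix_matrix_mult_def transpose_def sum_distrib_right)
  also have "\<dots> = (\<Sum>l\<in>UNIV. \<Sum>k\<in>UNIV. B $ i $ l * S $ l $ k * B $ j $ k)"
    by (rule sum.swap)
  also have "\<dots> = row i B \<bullet> (S *v row j B)"
    by (simp add: inner_vec_def row_def matrix_vector_mult_def sum_distrib_left mult.assoc)
  finally show ?thesis .
qed

text \<open>Gram--Schmidt orthogonalisation of the standard basis for the inner product of \<open>S\<close>.\<close>

lemma congruent_diagonal_aux:
  fixes S :: "real^'n^'n"
  assumes sym: "\<And>x y. x \<bullet> (S *v y) = y \<bullet> (S *v x)" and pos: "\<And>x. x \<noteq> 0 \<Longrightarrow> 0 < x \<bullet> (S *v x)"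
    and F: "finite F"
  shows "\<exists>B::real^'n^'n. det B = 1 \<and> (\<forall>i. i \<notin> F \<longrightarrow> row i B = axis i 1) \<and>
     (\<forall>i\<in>F. \<forall>j\<in>F. i \<noteq> j \<longrightarrow> row i B \<bullet> (S *v row j B) = 0) \<and> (\<forall>i\<in>F. row i B \<bullet> (S *v row i B) \<le> S $ i $ i)"
  using F
proof (induction F)
  case empty
  have "row i (mat 1 :: real^'n^'n) = axis i 1" for i
    by (auto simp: row_def mat_def axis_def vec_eq_iff)
  then show ?case by (intro exI[of _ "mat 1"]) simp
next
  case (insert k F)
  from insert.IH obtain B :: "real^'n^'n" where IH: "det B = 1 \<and> (\<forall>i. i \<notin> F \<longrightarrow> row i B = axis i 1) \<and>
     (\<forall>i\<in>F. \<forall>j\<in>F. i \<noteq> j \<longrightarrow> row i B \<bullet> (S *v row j B) = 0) \<and> (\<forall>i\<in>F. row i B \<bullet> (S *v row i B) \<le> S $ i $ i)"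
    by (elim exE)
  then have B: "det B = 1" "\<And>i. i \<notin> F \<Longrightarrow> row i B = axis i 1"
     "\<And>i j. i \<in> F \<Longrightarrow> j \<in> F \<Longrightarrow> i \<noteq> j \<Longrightarrow> row i B \<bullet> (S *v row j B) = 0"
     "\<And>i. i \<in> F \<Longrightarrow> row i B \<bullet> (S *v row i B) \<le> S $ i $ i"
    by simp_all
  let ?b = "\<lambda>i. row i B"
  have nz: "?b i \<noteq> 0" for i
    using B(1) det_zero_row(1)[of i B] by auto
  have p: "0 < ?b i \<bullet> (S *v ?b i)" for i using pos[OF nz] .
  have bk: "?b k = axis k 1" using B(2) insert.hyps by simp
  \<comment> \<open>Coefficients, with opposite sign, of the projection onto the rows already
    orthogonalised.\<close>
  define c where "c j = - (?b k \<bullet> (S *v ?b j)) / (?b j \<bullet> (S *v ?b j))" for j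
  define x where "x = (\<Sum>j\<in>F. c j *\<^sub>R ?b j)"
  let ?y = "?b k + x"
  have Sx: "z \<bullet> (S *v x) = (\<Sum>j\<in>F. c j * (z \<bullet> (S *v ?b j)))" for z
    unfolding x_def
    by (simp add: linear_sum[OF matrix_vector_mul_linear] matrix_vector_mult_scaleR inner_sum_right)
  have orth: "?b j \<bullet> (S *v ?y) = 0" if j: "j \<in> F" for j
  proof -
    have "?b j \<bullet> (S *v x) = (\<Sum>i\<in>F. if i = j then - (?b k \<bullet> (S *v ?b j)) else 0)"
      unfolding Sx using B(3)[OF j] p[of j] by (intro sum.cong) (auto simp: c_def)
    also have "\<dots> = - (?b k \<bullet> (S *v ?b j))" using insert.hyps(1) j by simp
    finally show ?thesis by (simp add: matrix_vector_right_distrib inner_add_right sym[of "?b j" "?b k"])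
  qed
  then have orth': "?y \<bullet> (S *v ?b j) = 0" if "j \<in> F" for j
    using sym[of ?y "?b j"] that by simp
  have xy: "x \<bullet> (S *v ?y) = 0"
  proof -
    have "x \<bullet> (S *v ?y) = (\<Sum>j\<in>F. c j * (?b j \<bullet> (S *v ?y)))"
      unfolding x_def by (simp add: inner_sum_left)
    also have "\<dots> = 0" using orth by (intro sum.neutral) auto
    finally show ?thesis .
  qed
  \<comment> \<open>Pythagoras for the inner product of \<open>S\<close>: removing the projection
    cannot lengthen the basis vector, whose squared length is \<open>S $ k $ k\<close>.\<close>
  have yy: "?y \<bullet> (S *v ?y) \<le> S $ k $ k"
  proof -
    have "?b k \<bullet> (S *v ?b k) = ?y \<bullet> (S *v ?y) + x \<bullet> (S *v x)"
      using xy sym[of x "?b k"] by (simp add: matrix_vector_right_distrib inner_add_left inner_add_right)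
    moreover have "0 \<le> x \<bullet> (S *v x)" using pos[of x] by (cases "x = 0") auto
    moreover have "?b k \<bullet> (S *v ?b k) = S $ k $ k"
      unfolding bk by (simp add: inner_axis' matrix_vector_mult_basis column_def)
    ultimately show ?thesis by simp
  qed
  define B' where "B' = (\<chi> i. if i = k then ?y else ?b i)"
  have "x \<in> span {row j B |j. j \<noteq> k}"
    unfolding x_def using insert.hyps by (intro span_sum span_scale span_base) auto
  then have det: "det B' = 1"
    unfolding B'_def using det_row_span[of x B k] B(1) by (simp add: span_vec_eq)
  have row: "row i B' = (if i = k then ?y else ?b i)" for i
    by (simp add: B'_def row_def vec_eq_iff)
  show ?case
  proof (intro exI[of _ B'] conjI allI ballI impI det)
    fix i assume "i \<notin> insert k F" then show "row i B' = axis i 1" using B(2) by (simp add: row)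
  next
    fix i j assume "i \<in> insert k F" "j \<in> insert k F" "i \<noteq> j"
    then show "row i B' \<bullet> (S *v row j B') = 0"
      using B(3) orth orth' by (auto simp: row)
  next
    fix i assume "i \<in> insert k F"
    then show "row i B' \<bullet> (S *v row i B') \<le> S $ i $ i" using B(4) yy by (auto simp: row)
  qed
qed

text \<open>Gram-Schmidt uses a matrix of determinant 1, so the determinant of \<open>S\<close> is
  the product of the squared lengths \<open>d i\<close> of the orthogonalised basis. The bound
  \<open>d i \<le> S $ i $ i\<close> turns this into Hadamard's inequality.\<close>

lemma congruent_diagonal:
  fixes S :: "real^'n^'n"
  assumes sym: "\<And>x y. x \<bullet> (S *v y) = y \<bullet> (S *v x)" and pos: "\<And>x. x \<noteq> 0 \<Longrightarrow> 0 < x \<bullet> (S *v x)"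
  obtains B :: "real^'n^'n" and d where "det B = 1" "\<And>i j. (B ** S ** transpose B) $ i $ j = (if i = j then d i else 0)"
    "\<And>i. 0 < d i" "\<And>i. d i \<le> S $ i $ i" "det S = (\<Prod>i\<in>UNIV. d i)"
proof -
  have "\<exists>B::real^'n^'n. det B = 1 \<and> (\<forall>i. i \<notin> UNIV \<longrightarrow> row i B = axis i 1) \<and>
     (\<forall>i\<in>UNIV. \<forall>j\<in>UNIV. i \<noteq> j \<longrightarrow> row i B \<bullet> (S *v row j B) = 0) \<and> (\<forall>i\<in>UNIV. row i B \<bullet> (S *v row i B) \<le> S $ i $ i)"
    by (rule congruent_diagonal_aux[OF sym pos]) simp_all
  then obtain B :: "real^'n^'n" where "det B = 1 \<and> (\<forall>i. i \<notin> UNIV \<longrightarrow> row i B = axis i 1) \<and>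
     (\<forall>i\<in>UNIV. \<forall>j\<in>UNIV. i \<noteq> j \<longrightarrow> row i B \<bullet> (S *v row j B) = 0) \<and> (\<forall>i\<in>UNIV. row i B \<bullet> (S *v row i B) \<le> S $ i $ i)"
    by (elim exE)
  then have B: "det B = 1"
     "\<And>i j. i \<noteq> j \<Longrightarrow> row i B \<bullet> (S *v row j B) = 0" "\<And>i. row i B \<bullet> (S *v row i B) \<le> S $ i $ i"
    by simp_all
  define d where "d i = row i B \<bullet> (S *v row i B)" for i
  have diag: "(B ** S ** transpose B) $ i $ j = (if i = j then d i else 0)" for i j
    using B(2) by (simp add: matrix_congruence_component d_def)
  have "det S = det (B ** S ** transpose B)" by (simp add: det_mul B(1))
  also have "\<dots> = (\<Prod>i\<in>UNIV. (B ** S ** transpose B) $ i $ i)"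
    by (rule det_diagonal) (simp add: diag)
  finally have "det S = (\<Prod>i\<in>UNIV. d i)" by (simp add: diag)
  moreover have "0 < d i" for i
    unfolding d_def using B(1) det_zero_row(1)[of i B] by (intro pos) auto
  ultimately show ?thesis using that[OF B(1) diag] B(3) by (auto simp: d_def)
qed

lemma Hadamard_det_le:
  fixes S :: "real^'n^'n"
  assumes sym: "\<And>x y. x \<bullet> (S *v y) = y \<bullet> (S *v x)" and pos: "\<And>x. x \<noteq> 0 \<Longrightarrow> 0 < x \<bullet> (S *v x)"
  shows "0 < det S" "det S \<le> (\<Prod>i\<in>UNIV. S $ i $ i)"
proof -
  obtain B :: "real^'n^'n" and d where d: "\<And>i. 0 < d i" "\<And>i. d i \<le> S $ i $ i" "det S = (\<Prod>i\<in>UNIV. d i)"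
    using congruent_diagonal[OF sym pos] by metis
  show "0 < det S" unfolding d(3) using d(1) by (simp add: prod_pos)
  show "det S \<le> (\<Prod>i\<in>UNIV. S $ i $ i)" unfolding d(3) using d(1,2) by (intro prod_mono) (auto simp: less_imp_le)
qed

lemma det_ker:
  fixes S :: "real^'n^'n"
  assumes "det S \<noteq> 0" "x \<noteq> 0" shows "S *v x \<noteq> 0"
proof -
  have "\<exists>B. B ** S = mat 1" using assms(1) unfolding invertible_det_nz[symmetric] invertible_def by blast
  then show ?thesis using assms(2) unfolding matrix_left_invertible_ker by blast
qed

text \<open>If the form vanished at \<open>x\<close>, a small step from \<open>x\<close> against the
  nonzero vector \<open>S *v x\<close> would lower it to first order, with only a second-order gain,
  and make it negative.\<close>

lemma psd_det_nonzero_pos: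
  fixes S :: "real^'n^'n"
  assumes sym: "\<And>x y. x \<bullet> (S *v y) = y \<bullet> (S *v x)" and nonneg: "\<And>x. 0 \<le> x \<bullet> (S *v x)" and det: "det S \<noteq> 0"
    and x: "x \<noteq> 0"
  shows "0 < x \<bullet> (S *v x)"
proof (rule ccontr)
  assume "\<not> ?thesis"
  then have 0: "x \<bullet> (S *v x) = 0" using nonneg[of x] by simp
  let ?y = "S *v x"
  have Sx: "?y \<noteq> 0" by (rule det_ker[OF det x])
  have expand: "0 \<le> e * e * (?y \<bullet> (S *v ?y)) - 2 * e * (?y \<bullet> ?y)" for e
  proof -
    have "0 \<le> (x - e *\<^sub>R ?y) \<bullet> (S *v (x - e *\<^sub>R ?y))" by (rule nonneg)
    also have "\<dots> = x \<bullet> ?y - e * (x \<bullet> (S *v ?y)) - e * (?y \<bullet> ?y) + e * e * (?y \<bullet> (S *v ?y))"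
      by (simp add: matrix_vector_mult_diff_distrib matrix_vector_mult_scaleR inner_diff_left inner_diff_right algebra_simps)
    finally show ?thesis using 0 sym[of x ?y] by simp
  qed
  let ?c = "?y \<bullet> (S *v ?y)" and ?d = "?y \<bullet> ?y"
  have d: "0 < ?d" using Sx by simp
  have c: "0 \<le> ?c" by (rule nonneg)
  \<comment> \<open>Small enough that \<open>e * ?c\<close> stays below \<open>?d\<close>, so the
    linear term wins; the added 1 keeps the denominator positive.\<close>
  define e where "e = ?d / (?c + 1)"
  have "e * (?c + 1) = ?d" using c by (simp add: e_def)
  then have e: "0 < e" "e * ?c + e = ?d" using c d by (simp_all add: e_def distrib_left)
  have "e * (2 * ?d) \<le> e * (e * ?c)" using expand[of e] by (simp add: algebra_simps)
  then have "2 * ?d \<le> e * ?c" using e(1) by simp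
  then show False using e d by linarith
qed

text \<open>Only the mixture \<open>S\<close> is diagonalised. In the same coordinates Hadamard's
  inequality replaces the determinants of \<open>S0\<close> and \<open>S1\<close> by products of
  diagonal entries. Relative to the entries of \<open>S\<close>, these have weighted average 1 at
  every index, and the arithmetic-geometric mean inequality finishes.\<close>

lemma Minkowski_det:
  fixes S0 S1 :: "real^'n^'n"
  assumes sym0: "\<And>x y. x \<bullet> (S0 *v y) = y \<bullet> (S0 *v x)" and nn0: "\<And>x. 0 \<le> x \<bullet> (S0 *v x)" and det0: "det S0 \<noteq> 0"
    and sym1: "\<And>x y. x \<bullet> (S1 *v y) = y \<bullet> (S1 *v x)" and nn1: "\<And>x. 0 \<le> x \<bullet> (S1 *v x)" and det1: "det S1 \<noteq> 0"
    and s: "0 < s" "s < 1" and S: "S = (1 - s) *\<^sub>R S0 + s *\<^sub>R S1"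
  shows "0 < det S0" "0 < det S1" "0 < det S"
    "(1 - s) * det S0 powr (1 / CARD('n)) + s * det S1 powr (1 / CARD('n)) \<le> det S powr (1 / CARD('n))"
proof -
  note pos0 = psd_det_nonzero_pos[OF sym0 nn0 det0] and pos1 = psd_det_nonzero_pos[OF sym1 nn1 det1]
  have Sv: "S *v x = (1 - s) *\<^sub>R (S0 *v x) + s *\<^sub>R (S1 *v x)" for x
    unfolding S by (simp add: matrix_vector_mult_add_rdistrib scaleR_matrix_vector_assoc)
  have symS: "x \<bullet> (S *v y) = y \<bullet> (S *v x)" for x y
    unfolding Sv using sym0[of x y] sym1[of x y] by (simp add: inner_add_right)
  have posS: "0 < x \<bullet> (S *v x)" if "x \<noteq> 0" for x
    unfolding Sv using pos0[OF that] pos1[OF that] s by (simp add: inner_add_right add_pos_pos)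
  show p0: "0 < det S0" and p1: "0 < det S1" and pS: "0 < det S"
    using Hadamard_det_le[OF sym0 pos0] Hadamard_det_le[OF sym1 pos1] Hadamard_det_le[OF symS posS] by blast+
  obtain B :: "real^'n^'n" and d where B: "det B = 1" "\<And>i j. (B ** S ** transpose B) $ i $ j = (if i = j then d i else 0)"
    "\<And>i. 0 < d i" "det S = (\<Prod>i\<in>UNIV. d i)"
    using congruent_diagonal[OF symS posS] by metis
  let ?n = "CARD('n)"
  define a0 a1 where "a0 i = (B ** S0 ** transpose B) $ i $ i / d i" and "a1 i = (B ** S1 ** transpose B) $ i $ i / d i" for i
  have congr: "det X \<le> (\<Prod>i\<in>UNIV. (B ** X ** transpose B) $ i $ i)"
    if X: "\<And>x y. x \<bullet> (X *v y) = y \<bullet> (X *v x)" "\<And>x. x \<noteq> 0 \<Longrightarrow> 0 < x \<bullet> (X *v x)" for X :: "real^'n^'n"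
  proof -
    have inner: "x \<bullet> ((B ** X ** transpose B) *v y) = (transpose B *v x) \<bullet> (X *v (transpose B *v y))" for x y
      by (simp add: matrix_vector_mul_assoc[symmetric] dot_lmul_matrix)
    have nz: "transpose B *v x \<noteq> 0" if "x \<noteq> 0" for x
      using that det_ker[of "transpose B" x] B(1) by (simp add: det_transpose)
    have "det X = det (B ** X ** transpose B)" by (simp add: det_mul B(1))
    also have "\<dots> \<le> (\<Prod>i\<in>UNIV. (B ** X ** transpose B) $ i $ i)"
      using X nz by (intro Hadamard_det_le(2)) (auto simp: inner)
    finally show ?thesis .
  qed
  have nn: "0 \<le> (B ** X ** transpose B) $ i $ i" if "\<And>x. 0 \<le> x \<bullet> (X *v x)" for X :: "real^'n^'n" and i
    unfolding matrix_congruence_component by (rule that)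
  have a: "0 \<le> a0 i" "0 \<le> a1 i" "(1 - s) * a0 i + s * a1 i = 1" for i
  proof -
    show "0 \<le> a0 i" "0 \<le> a1 i" using nn[OF nn0] nn[OF nn1] B(3)[of i] by (auto simp: a0_def a1_def)
    have "(1 - s) * a0 i + s * a1 i = (B ** S ** transpose B) $ i $ i / d i"
      unfolding a0_def a1_def matrix_congruence_component Sv by (simp add: inner_add_right add_divide_distrib)
    also have "\<dots> = 1" using B(2)[of i i] B(3)[of i] by simp
    finally show "(1 - s) * a0 i + s * a1 i = 1" .
  qed
  have ratio: "(det X / det S) powr (1 / ?n) \<le> (\<Sum>i\<in>UNIV. a i / ?n)"
    if X: "det X \<le> (\<Prod>i\<in>UNIV. (B ** X ** transpose B) $ i $ i)" "0 < det X"
      and a: "\<And>i. a i = (B ** X ** transpose B) $ i $ i / d i" "\<And>i. 0 \<le> a i" for X :: "real^'n^'n" and a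
  proof -
    have "det X / det S \<le> (\<Prod>i\<in>UNIV. a i)"
      using X(1) pS unfolding B(4) a(1) prod_dividef by (intro divide_right_mono) auto
    then have "(det X / det S) powr (1 / ?n) \<le> (\<Prod>i\<in>UNIV. a i) powr (1 / ?n)"
      using X(2) pS by (intro powr_mono2) auto
    also have "\<dots> \<le> (\<Sum>i\<in>UNIV. a i / ?n)" using a(2) by (intro arith_geom_mean) auto
    finally show ?thesis .
  qed
  have "(1 - s) * (det S0 / det S) powr (1 / ?n) + s * (det S1 / det S) powr (1 / ?n)
      \<le> (1 - s) * (\<Sum>i\<in>UNIV. a0 i / ?n) + s * (\<Sum>i\<in>UNIV. a1 i / ?n)"
    using s ratio[OF congr[OF sym0 pos0] p0 a0_def a(1)] ratio[OF congr[OF sym1 pos1] p1 a1_def a(2)]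
    by (intro add_mono mult_left_mono) auto
  also have "\<dots> = (\<Sum>i\<in>(UNIV::'n set). ((1 - s) * a0 i + s * a1 i) / ?n)"
    by (simp add: sum_distrib_left sum.distrib add_divide_distrib)
  also have "\<dots> = 1" unfolding a(3) by simp
  finally have "(1 - s) * (det S0 / det S) powr (1 / ?n) + s * (det S1 / det S) powr (1 / ?n) \<le> 1" .
  then have "((1 - s) * det S0 powr (1 / ?n) + s * det S1 powr (1 / ?n)) / det S powr (1 / ?n) \<le> 1"
    using p0 p1 pS by (simp add: powr_divide add_divide_distrib)
  then show "(1 - s) * det S0 powr (1 / ?n) + s * det S1 powr (1 / ?n) \<le> det S powr (1 / ?n)"
    using pS by (simp add: divide_le_eq)
qed

subsection \<open>Internal energy and potential\<close>

lemma internal_energy_hstar: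
  assumes "internal_energy P h" "0 < s"
  shows "(hstar h has_real_derivative - P (1 / s)) (at s)"
  using assms by (simp add: internal_energy_def)

text \<open>The mean value theorem for \<open>hstar h\<close> between \<open>s\<close> and
  \<open>2 * s\<close> reads, after division by \<open>s\<close>,
  \<open>2 * h (1 / (2 * s)) - h (1 / s) = - P (1 / z)\<close>. As \<open>s\<close> grows, all
  arguments tend to 0 and continuity of \<open>h\<close> and \<open>P\<close> gives the
  value.\<close>

lemma internal_energy_at_0:
  assumes P: "pressure P" and h: "internal_energy P h"
  shows "h 0 = - P 0"
proof -
  let ?s = "\<lambda>n. real (Suc n)"
  have "\<exists>z. ?s n < z \<and> z < 2 * ?s n \<and> hstar h (2 * ?s n) - hstar h (?s n) = (2 * ?s n - ?s n) * - P (1 / z)" for n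
    by (rule MVT2) (auto intro!: internal_energy_hstar[OF h])
  then obtain z where z: "\<And>n. ?s n < z n" "\<And>n. z n < 2 * ?s n"
      "\<And>n. hstar h (2 * ?s n) - hstar h (?s n) = (2 * ?s n - ?s n) * - P (1 / z n)"
    by metis
  have eq: "2 * h (1 / (2 * ?s n)) - h (1 / ?s n) = - P (1 / z n)" for n
  proof -
    have "?s n * (2 * h (1 / (2 * ?s n)) - h (1 / ?s n)) = ?s n * - P (1 / z n)"
      using z(3)[of n] by (simp add: hstar_def algebra_simps del: of_nat_Suc)
    moreover have "?s n \<noteq> 0" by (simp del: of_nat_Suc)
    ultimately show ?thesis using mult_left_cancel by blast
  qed
  have r0: "(\<lambda>n. 1 / ?s n) \<longlonglongrightarrow> 0" using LIMSEQ_Suc[OF lim_inverse_n'] by (simp del: of_nat_Suc)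
  have z0: "0 < z n" for n using z(1)[of n] by (rule order.strict_trans[rotated]) simp
  have "1 / z n \<le> 1 / ?s n" for n
    using less_imp_le[OF z(1)[of n]] by (intro frac_le) simp_all
  then have lim_z: "(\<lambda>n. 1 / z n) \<longlonglongrightarrow> 0"
    using z0 by (intro tendsto_sandwich[OF _ _ tendsto_const r0]) (auto intro!: always_eventually simp: less_imp_le)
  have "(\<lambda>n. 1 / 2 * (1 / ?s n)) \<longlonglongrightarrow> 1 / 2 * 0" by (intro tendsto_intros r0)
  then have r1: "(\<lambda>n. 1 / (2 * ?s n)) \<longlonglongrightarrow> 0" by simp
  have ch: "(\<lambda>n. h (x n)) \<longlonglongrightarrow> h 0" if "x \<longlonglongrightarrow> 0" "\<And>n. 0 \<le> x n" for x
    using h that unfolding internal_energy_def continuous_on_sequentially comp_def by force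
  have cP: "(\<lambda>n. P (x n)) \<longlonglongrightarrow> P 0" if "x \<longlonglongrightarrow> 0" "\<And>n. 0 \<le> x n" for x
    using P that unfolding pressure_def continuous_on_sequentially comp_def by force
  have "(\<lambda>n. 2 * h (1 / (2 * ?s n)) - h (1 / ?s n)) \<longlonglongrightarrow> 2 * h 0 - h 0"
    by (intro tendsto_intros ch r0 r1) auto
  moreover have "(\<lambda>n. 2 * h (1 / (2 * ?s n)) - h (1 / ?s n)) \<longlonglongrightarrow> - P 0"
    unfolding eq using z0 by (intro tendsto_intros cP lim_z) (auto intro: less_imp_le)
  ultimately show ?thesis using LIMSEQ_unique by fastforce
qed

lemma pressure_nonneg:
  assumes "pressure P" "0 \<le> r" shows "P 0 \<le> P r"
  using assms strict_mono_on_leD[of "{0..}" P 0 r] by (auto simp: pressure_def)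

text \<open>In the variable \<open>r = 1 / l ^ n\<close> the derivative is \<open>- n\<close> times
  McCann's quotient. The identity \<open>h 0 = - P 0\<close> is what completes \<open>P\<close> to
  \<open>P r - P 0\<close>.\<close>

lemma rescaled_energy_deriv:
  assumes P: "pressure P" and h: "internal_energy P h" and l: "0 < l" and n: "0 < n"
  shows "((\<lambda>l. l ^ n * (h (1 / l ^ n) - h 0)) has_real_derivative
      - (real n * ((P (1 / l ^ n) - P 0) / (1 / l ^ n) powr (1 - 1 / real n)))) (at l)"
proof -
  have "((\<lambda>l. hstar h (l ^ n) - h 0 * l ^ n) has_real_derivative
      - P (1 / l ^ n) * (real n * l ^ (n - 1)) - h 0 * (real n * l ^ (n - 1))) (at l)"
  proof (rule DERIV_diff)
    have "((\<lambda>l. l ^ n) has_real_derivative real n * l ^ (n - 1)) (at l)"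
      by (auto intro!: derivative_eq_intros)
    then show "((\<lambda>l. hstar h (l ^ n)) has_real_derivative - P (1 / l ^ n) * (real n * l ^ (n - 1))) (at l)"
      using DERIV_chain2[where f = "hstar h" and g = "\<lambda>l. l ^ n", OF internal_energy_hstar[OF h]] l by simp
    show "((\<lambda>l. h 0 * l ^ n) has_real_derivative h 0 * (real n * l ^ (n - 1))) (at l)"
      by (auto intro!: derivative_eq_intros)
  qed
  moreover have "(\<lambda>l. hstar h (l ^ n) - h 0 * l ^ n) = (\<lambda>l. l ^ n * (h (1 / l ^ n) - h 0))"
    by (simp add: hstar_def algebra_simps)
  moreover have "(1 / l ^ n) powr (1 - 1 / real n) = 1 / l ^ (n - 1)"
  proof -
    have "l powr (real n * (1 - 1 / real n)) = l powr real (n - 1)"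
      using n by (simp add: right_diff_distrib of_nat_diff)
    then have "(l ^ n) powr (1 - 1 / real n) = l ^ (n - 1)"
      using l by (simp add: powr_realpow[symmetric] powr_powr)
    then show ?thesis using l by (simp add: powr_divide)
  qed
  ultimately show ?thesis using internal_energy_at_0[OF P h] by (simp add: algebra_simps)
qed

text \<open>The derivative is nonpositive because \<open>P\<close> is increasing, and it is
  nondecreasing by McCann's condition, read in the decreasing variable
  \<open>1 / l ^ n\<close>.\<close>

lemma rescaled_energy:
  assumes P: "pressure P" and h: "internal_energy P h" and n: "0 < n"
  shows rescaled_energy_antimono: "0 < k \<Longrightarrow> k \<le> l \<Longrightarrow> l ^ n * (h (1 / l ^ n) - h 0) \<le> k ^ n * (h (1 / k ^ n) - h 0)"
    and rescaled_energy_convex: "McCann_condition n P \<Longrightarrow> convex_on {0<..} (\<lambda>l. l ^ n * (h (1 / l ^ n) - h 0))"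
proof -
  let ?\<psi> = "\<lambda>l. l ^ n * (h (1 / l ^ n) - h 0)"
    and ?d = "\<lambda>l. - (real n * ((P (1 / l ^ n) - P 0) / (1 / l ^ n) powr (1 - 1 / real n)))"
  note der = rescaled_energy_deriv[OF P h _ n]
  show "?\<psi> l \<le> ?\<psi> k" if "0 < k" "k \<le> l"
  proof (rule DERIV_nonpos_imp_nonincreasing[OF that(2)])
    fix x assume "k \<le> x" "x \<le> l"
    then have x: "0 < x" using that by simp
    then have "?d x \<le> 0" using pressure_nonneg[OF P, of "1 / x ^ n"] by simp
    then show "\<exists>y. (?\<psi> has_real_derivative y) (at x) \<and> y \<le> 0" using der[OF x] by blast
  qed
  show "convex_on {0<..} ?\<psi>" if M: "McCann_condition n P"
  proof (rule convex_on_realI)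
    fix x y :: real assume xy: "x \<in> {0<..}" "y \<in> {0<..}" "x \<le> y"
    then have le: "1 / y ^ n \<le> 1 / x ^ n" by (intro divide_left_mono power_mono) auto
    have "(P (1 / y ^ n) - P 0) / (1 / y ^ n) powr (1 - 1 / real n) \<le> (P (1 / x ^ n) - P 0) / (1 / x ^ n) powr (1 - 1 / real n)"
      by (rule mono_onD[OF M[unfolded McCann_condition_def] _ _ le]) (use xy in auto)
    then show "?d x \<le> ?d y" by (intro le_imp_neg_le mult_left_mono) auto
  qed (use der in auto)
qed

text \<open>\<open>J * (h (\<rho> / J) - h 0)\<close> is the integrand of the internal energy after the change of variables.\<close>

lemma energy_of_Jacobian_le:
  assumes P: "pressure P" and h: "internal_energy P h" and n: "0 < n" and M: "McCann_condition n P"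
    and s: "0 < s" "s < 1" and \<rho>: "0 < \<rho>" and J: "0 < J0" "0 < J1" "0 < J"
    and root: "(1 - s) * J0 powr (1 / real n) + s * J1 powr (1 / real n) \<le> J powr (1 / real n)"
  shows "J * (h (\<rho> / J) - h 0) \<le> (1 - s) * (J0 * (h (\<rho> / J0) - h 0)) + s * (J1 * (h (\<rho> / J1) - h 0))"
proof -
  let ?\<psi> = "\<lambda>l. l ^ n * (h (1 / l ^ n) - h 0)"
  \<comment> \<open>The \<open>n\<close>-th root of the Jacobian relative to \<open>\<rho>\<close>,
    so that \<open>\<rho> / X = 1 / l X ^ n\<close>.\<close>
  define l where "l X = (X / \<rho>) powr (1 / real n)" for X
  have l: "0 < l X" "l X ^ n = X / \<rho>" if "0 < X" for X
  proof -
    show "0 < l X" using that \<rho> by (simp add: l_def)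
    then show "l X ^ n = X / \<rho>" using that \<rho> n by (simp add: l_def powr_realpow[symmetric] powr_powr)
  qed
  have \<psi>: "X * (h (\<rho> / X) - h 0) = \<rho> * ?\<psi> (l X)" if "0 < X" for X
    using l(2)[OF that] \<rho> by simp
  have l_eq: "l X = X powr (1 / real n) / \<rho> powr (1 / real n)" if "0 < X" for X
    using that \<rho> by (simp add: l_def powr_divide)
  have "((1 - s) * J0 powr (1 / real n) + s * J1 powr (1 / real n)) / \<rho> powr (1 / real n) \<le> J powr (1 / real n) / \<rho> powr (1 / real n)"
    using root by (rule divide_right_mono) simp
  then have le: "(1 - s) * l J0 + s * l J1 \<le> l J"
    using J by (simp add: l_eq add_divide_distrib)
  have "0 < (1 - s) * l J0 + s * l J1" using l(1) J s by (simp add: add_pos_pos)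
  then have "?\<psi> (l J) \<le> ?\<psi> ((1 - s) * l J0 + s * l J1)"
    using le by (rule rescaled_energy_antimono[OF P h n])
  also have "\<dots> \<le> (1 - s) * ?\<psi> (l J0) + s * ?\<psi> (l J1)"
    using convex_onD[OF rescaled_energy_convex[OF P h n M], of s "l J0" "l J1"] l(1) J s by simp
  finally have "\<rho> * ?\<psi> (l J) \<le> \<rho> * ((1 - s) * ?\<psi> (l J0) + s * ?\<psi> (l J1))"
    using \<rho> by (intro mult_left_mono) auto
  then show ?thesis unfolding \<psi>[OF J(1)] \<psi>[OF J(2)] \<psi>[OF J(3)] by (simp add: algebra_simps)
qed

text \<open>Up to 1 continuity suffices. Beyond 1, monotonicity of the rescaled energy for
  \<open>n = 1\<close> says that \<open>(h r - h 0) / r\<close> is at least its value at 1.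
  Consequently a density of finite mass on the cube has an internal energy with integrable negative
  part.\<close>

lemma internal_energy_lower_bound:
  assumes P: "pressure P" and h: "internal_energy P h"
  obtains C where "0 \<le> C" "\<And>r. 0 \<le> r \<Longrightarrow> - (C * (1 + r)) \<le> h r - h 0"
proof -
  have "compact (h ` {0..1})"
    using h unfolding internal_energy_def by (intro compact_continuous_image) (auto intro: continuous_on_subset)
  then obtain B where B: "\<And>r. r \<in> {0..1} \<Longrightarrow> \<bar>h r\<bar> \<le> B"
    using compact_imp_bounded bounded_iff by (metis imageI real_norm_def)
  define C where "C = \<bar>B\<bar> + \<bar>h 0\<bar> + \<bar>h 1 - h 0\<bar>"
  have "- (C * (1 + r)) \<le> h r - h 0" if r: "0 \<le> r" for r
  proof (cases "r \<le> 1")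
    case True
    have "- C \<le> h r - h 0"
      using B[of r] r True abs_ge_minus_self[of "h r"] abs_ge_self[of B] abs_ge_self[of "h 0"] abs_ge_zero[of "h 1 - h 0"]
      by (simp add: C_def)
    moreover have "C \<le> C * (1 + r)" using r by (simp add: C_def mult_le_cancel_left1 distrib_left)
    ultimately show ?thesis by simp
  next
    case False
    then have "1 * (h 1 - h 0) \<le> 1 / r * (h r - h 0)"
      using rescaled_energy_antimono[OF P h, of 1 "1 / r" 1] by simp
    then have "r * (h 1 - h 0) \<le> h r - h 0" using False by (simp add: field_simps)
    moreover have "- (C * (1 + r)) \<le> r * (h 1 - h 0)"
    proof -
      have "- (r * (h 1 - h 0)) \<le> r * \<bar>h 1 - h 0\<bar>" using r by (metis abs_ge_minus_self abs_mult abs_of_nonneg)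
      also have "\<dots> \<le> (1 + r) * C" using r by (intro mult_mono) (auto simp: C_def)
      finally show ?thesis by (simp add: mult.commute)
    qed
    ultimately show ?thesis by simp
  qed
  moreover have "0 \<le> C" by (simp add: C_def)
  ultimately show ?thesis using that by blast
qed

section \<open>The cube and convexity of the potential along segments\<close>

lemma open_cube: "open (cube :: (real^'n) set)"
proof -
  have "cube = (\<Inter>i. {x::real^'n. 0 < x $ i} \<inter> {x. x $ i < 1})" by (auto simp: cube_def)
  also have "open \<dots>"
    by (intro open_INT ballI open_Int open_Collect_less continuous_intros) auto
  finally show ?thesis .
qed

lemma convex_cube: "convex (cube :: (real^'n) set)"
proof (rule convexI)
  fix x y :: "real^'n" and u v :: real
  assume "x \<in> cube" "y \<in> cube" "0 \<le> u" "0 \<le> v" "u + v = 1"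
  then show "u *\<^sub>R x + v *\<^sub>R y \<in> cube"
    using convexD[of "{0<..<1::real}"] by (auto simp: cube_def)
qed

lemma norm_cube: "x \<in> cube \<Longrightarrow> norm (x :: real^'n) \<le> real CARD('n)"
proof -
  assume x: "x \<in> cube"
  have "norm x \<le> (\<Sum>i\<in>UNIV. \<bar>x $ i\<bar>)" by (rule norm_le_l1_cart)
  also have "\<dots> \<le> (\<Sum>i\<in>(UNIV::'n set). 1)" using x by (intro sum_mono) (auto simp: cube_def less_imp_le abs_of_pos)
  finally show ?thesis by simp
qed

text \<open>Derivatives up to the boundary become ordinary ones inside, while the partial
  derivatives keep their regularity on the closed cube, so that the step can be repeated.\<close>

lemma smooth_on_cube_deriv:
  fixes f :: "real^'n \<Rightarrow> real"
  assumes "Ck_on (Suc k) (closure cube) f"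
  shows "\<exists>g. (\<forall>x\<in>cube. (f has_derivative (\<lambda>v. \<Sum>b\<in>Basis. (v \<bullet> b) * g b x)) (at x)) \<and>
    (\<forall>b\<in>Basis. Ck_on k (closure cube) (g b))"
proof -
  obtain g where g: "\<And>x. x \<in> closure cube \<Longrightarrow> (f has_derivative (\<lambda>v. \<Sum>b\<in>Basis. (v \<bullet> b) * g b x)) (at x within closure cube)"
    "\<And>b. b \<in> Basis \<Longrightarrow> Ck_on k (closure cube) (g b)"
    using assms by auto
  have "(f has_derivative (\<lambda>v. \<Sum>b\<in>Basis. (v \<bullet> b) * g b x)) (at x)" if x: "x \<in> cube" for x
  proof -
    have "(f has_derivative (\<lambda>v. \<Sum>b\<in>Basis. (v \<bullet> b) * g b x)) (at x within cube)"
      using x closure_subset by (intro has_derivative_subset[OF g(1) closure_subset]) auto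
    then show ?thesis using at_within_open[OF x open_cube] by simp
  qed
  then show ?thesis using g(2) by blast
qed

text \<open>Along the segment, subtracting
  \<open>lam / 2 * (norm d)\<^sup>2 * \<tau>\<^sup>2\<close> leaves a second derivative that the
  Hessian bound makes nonnegative. The work lies in matching \<open>hessian\<close>, an iterated
  Frechet derivative, with the partial derivatives supplied by smoothness.\<close>

lemma hessian_convex_along_segments:
  fixes V :: "real^'n \<Rightarrow> real"
  assumes V: "smooth_on (closure cube) V"
    and hess: "\<And>x \<xi>. x \<in> cube \<Longrightarrow> lam * (\<xi> \<bullet> \<xi>) \<le> \<xi> \<bullet> (hessian V x *v \<xi>)"
    and y: "y0 \<in> cube" "y1 \<in> cube" and s: "0 \<le> s" "s \<le> 1"
  shows "V ((1 - s) *\<^sub>R y0 + s *\<^sub>R y1) \<le> (1 - s) * V y0 + s * V y1 - lam / 2 * s * (1 - s) * (norm (y1 - y0))\<^sup>2"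
proof -
  have "Ck_on (Suc (Suc 0)) (closure cube) V" using V unfolding smooth_on_def by blast
  from smooth_on_cube_deriv[OF this] obtain g where gg: "(\<forall>x\<in>cube. (V has_derivative (\<lambda>v. \<Sum>b\<in>Basis. (v \<bullet> b) * g b x)) (at x)) \<and>
    (\<forall>b\<in>Basis. Ck_on (Suc 0) (closure cube) (g b))"
    by (elim exE)
  note g = bspec[OF conjunct1[OF gg]] and g1 = bspec[OF conjunct2[OF gg]]
  have "\<exists>k. \<forall>x\<in>cube. (g b has_derivative (\<lambda>v. \<Sum>c\<in>Basis. (v \<bullet> c) * k c x)) (at x)" if "b \<in> Basis" for b
    using smooth_on_cube_deriv[OF g1[OF that]] by blast
  then have "\<forall>b\<in>Basis. \<exists>k. \<forall>x\<in>cube. (g b has_derivative (\<lambda>v. \<Sum>c\<in>Basis. (v \<bullet> c) * k c x)) (at x)"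
    by (intro ballI)
  from bchoice[OF this] obtain k where kk: "\<forall>b\<in>Basis. \<forall>x\<in>cube. (g b has_derivative (\<lambda>v. \<Sum>c\<in>Basis. (v \<bullet> c) * k b c x)) (at x)" ..
  note k = bspec[OF bspec[OF kk]]
  have Basis_sum: "(\<Sum>b\<in>Basis. F b) = (\<Sum>i\<in>UNIV. F (axis i (1::real)))" for F :: "real^'n \<Rightarrow> real"
  proof -
    have B: "(Basis :: (real^'n) set) = range (\<lambda>i. axis i 1)" by (auto simp: Basis_vec_def)
    show ?thesis unfolding B by (subst sum.reindex) (auto intro!: injI simp: axis_eq_axis)
  qed
  have fV: "frechet_derivative V (at x) (axis j 1) = g (axis j 1) x" if "x \<in> cube" for x j
  proof -
    have "frechet_derivative V (at x) = (\<lambda>v. \<Sum>b\<in>Basis. (v \<bullet> b) * g b x)"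
      using frechet_derivative_at[OF g[OF that]] by simp
    then show ?thesis by (simp add: Basis_sum inner_axis_axis if_distrib[of "\<lambda>a. a * _"] cong: if_cong)
  qed
  have H: "hessian V x $ i $ j = k (axis j 1) (axis i 1) x" if x: "x \<in> cube" for x i j
  proof -
    have "((\<lambda>y. frechet_derivative V (at y) (axis j 1)) has_derivative (\<lambda>v. \<Sum>c\<in>Basis. (v \<bullet> c) * k (axis j 1) c x)) (at x)"
      by (rule has_derivative_transform_within_open[OF k open_cube x]) (use x fV in auto)
    then have "frechet_derivative (\<lambda>y. frechet_derivative V (at y) (axis j 1)) (at x) = (\<lambda>v. \<Sum>c\<in>Basis. (v \<bullet> c) * k (axis j 1) c x)"
      using frechet_derivative_at by fastforce
    then show ?thesis
      by (simp add: hessian_def Basis_sum inner_axis_axis if_distrib[of "\<lambda>a. a * _"] cong: if_cong)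
  qed
  define d where "d = y1 - y0"
  have seg: "y0 + \<tau> *\<^sub>R d \<in> cube" if "\<tau> \<in> {0..1}" for \<tau>
  proof -
    have "(1 - \<tau>) *\<^sub>R y0 + \<tau> *\<^sub>R y1 \<in> cube" using that y convexD_alt[OF convex_cube y] by simp
    then show ?thesis by (simp add: d_def algebra_simps)
  qed
  let ?q = "\<lambda>\<tau>::real. lam / 2 * (norm d)\<^sup>2 * \<tau>\<^sup>2"
  let ?\<gamma> = "\<lambda>\<tau>. V (y0 + \<tau> *\<^sub>R d)"
  let ?\<gamma>1 = "\<lambda>\<tau>. \<Sum>b\<in>Basis. (d \<bullet> b) * g b (y0 + \<tau> *\<^sub>R d)"
  let ?\<gamma>2 = "\<lambda>\<tau>. \<Sum>b\<in>Basis. (d \<bullet> b) * (\<Sum>c\<in>Basis. (d \<bullet> c) * k b c (y0 + \<tau> *\<^sub>R d))"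
  have chain: "((\<lambda>\<tau>. f (y0 + \<tau> *\<^sub>R d)) has_real_derivative (\<Sum>c\<in>Basis. (d \<bullet> c) * a c)) (at \<tau>)"
    if "(f has_derivative (\<lambda>v. \<Sum>c\<in>Basis. (v \<bullet> c) * a c)) (at (y0 + \<tau> *\<^sub>R d))" for f a \<tau>
  proof -
    have "((\<lambda>\<tau>. y0 + \<tau> *\<^sub>R d) has_derivative (\<lambda>h. h *\<^sub>R d)) (at \<tau>)"
      by (auto intro!: derivative_eq_intros)
    from has_derivative_compose[OF this that]
    have "((\<lambda>\<tau>. f (y0 + \<tau> *\<^sub>R d)) has_derivative (\<lambda>h. \<Sum>c\<in>Basis. ((h *\<^sub>R d) \<bullet> c) * a c)) (at \<tau>)" .
    moreover have "(\<lambda>h. \<Sum>c\<in>Basis. ((h *\<^sub>R d) \<bullet> c) * a c) = (*) (\<Sum>c\<in>Basis. (d \<bullet> c) * a c)"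
      by (auto simp: sum_distrib_left mult_ac)
    ultimately show ?thesis by (simp add: has_field_derivative_def)
  qed
  have "convex_on {0..1} (\<lambda>\<tau>. ?\<gamma> \<tau> - ?q \<tau>)"
  proof (rule f''_ge0_imp_convex[where f' = "\<lambda>\<tau>. ?\<gamma>1 \<tau> - lam * (norm d)\<^sup>2 * \<tau>" and f'' = "\<lambda>\<tau>. ?\<gamma>2 \<tau> - lam * (norm d)\<^sup>2"])
    fix \<tau> :: real assume \<tau>: "\<tau> \<in> {0..1}"
    let ?x = "y0 + \<tau> *\<^sub>R d"
    show "((\<lambda>\<tau>. ?\<gamma> \<tau> - ?q \<tau>) has_real_derivative ?\<gamma>1 \<tau> - lam * (norm d)\<^sup>2 * \<tau>) (at \<tau>)"
      by (rule DERIV_diff[OF chain[OF g[OF seg[OF \<tau>]]]]) (auto intro!: derivative_eq_intros)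
    have "(?\<gamma>1 has_real_derivative ?\<gamma>2 \<tau>) (at \<tau>)"
      by (intro DERIV_sum DERIV_cmult chain k seg \<tau>)
    then show "((\<lambda>\<tau>. ?\<gamma>1 \<tau> - lam * (norm d)\<^sup>2 * \<tau>) has_real_derivative ?\<gamma>2 \<tau> - lam * (norm d)\<^sup>2) (at \<tau>)"
      by (rule DERIV_diff) (auto intro!: derivative_eq_intros)
    have "?\<gamma>2 \<tau> = d \<bullet> (hessian V ?x *v d)"
    proof -
      have "?\<gamma>2 \<tau> = (\<Sum>j\<in>UNIV. \<Sum>i\<in>UNIV. d $ j * (d $ i * hessian V ?x $ i $ j))"
        by (simp add: Basis_sum inner_axis H[OF seg[OF \<tau>]] sum_distrib_left)
      also have "\<dots> = (\<Sum>i\<in>UNIV. \<Sum>j\<in>UNIV. d $ j * (d $ i * hessian V ?x $ i $ j))"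
        by (rule sum.swap)
      also have "\<dots> = d \<bullet> (hessian V ?x *v d)"
        by (simp add: inner_vec_def matrix_vector_mult_def sum_distrib_left mult_ac)
      finally show ?thesis .
    qed
    then show "0 \<le> ?\<gamma>2 \<tau> - lam * (norm d)\<^sup>2"
      using hess[OF seg[OF \<tau>], of d] by (simp add: dot_square_norm)
  qed auto
  then have "?\<gamma> ((1 - s) * 0 + s * 1) - ?q ((1 - s) * 0 + s * 1) \<le> (1 - s) * (?\<gamma> 0 - ?q 0) + s * (?\<gamma> 1 - ?q 1)"
    using convex_onD[of "{0..1}" "\<lambda>\<tau>. ?\<gamma> \<tau> - ?q \<tau>" s 0 1] s by simp
  moreover have "y0 + s *\<^sub>R d = (1 - s) *\<^sub>R y0 + s *\<^sub>R y1" by (simp add: d_def algebra_simps)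
  ultimately have "V ((1 - s) *\<^sub>R y0 + s *\<^sub>R y1) \<le> (1 - s) * V y0 + s * (V y1 - lam / 2 * (norm d)\<^sup>2) + lam / 2 * (norm d)\<^sup>2 * s\<^sup>2"
    by (simp add: d_def)
  also have "\<dots> = (1 - s) * V y0 + s * V y1 - lam / 2 * s * (1 - s) * (norm d)\<^sup>2"
    by (simp add: field_simps power2_eq_square)
  finally show ?thesis by (simp add: d_def)
qed

subsection \<open>The Jacobian equation\<close>

text \<open>The area formula on preimages of Borel sets says that \<open>g\<close> carries the
  Jacobian density on \<open>S\<close> to Lebesgue measure on the image; integrals of Borel
  functions follow.\<close>

lemma nn_integral_change_of_variables:
  fixes g :: "real^'n \<Rightarrow> real^'n" and f :: "real^'n \<Rightarrow> ennreal"
  assumes S: "S \<in> sets lebesgue" and g: "g \<in> borel_measurable borel"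
    and der: "\<And>x. x \<in> S \<Longrightarrow> (g has_derivative g' x) (at x within S)"
    and inj: "inj_on g S" and f: "f \<in> borel_measurable borel"
  shows "(\<integral>\<^sup>+y\<in>g ` S. f y \<partial>lebesgue) = (\<integral>\<^sup>+x\<in>S. f (g x) * ennreal \<bar>det (matrix (g' x))\<bar> \<partial>lebesgue)"
proof -
  let ?J = "\<lambda>x. ennreal \<bar>det (matrix (g' x))\<bar>"
  have J: "?J \<in> borel_measurable (lebesgue_on S)"
    using differentiable_image_emeasure(2)[OF S der inj] by measurable
  have g_leb: "g \<in> lebesgue \<rightarrow>\<^sub>M borel" using g by (simp add: measurable_completion)
  then have gS: "g \<in> lebesgue_on S \<rightarrow>\<^sub>M borel" by (rule measurable_restrict_space1)
  have im: "g ` S \<in> sets lebesgue" by (rule differentiable_image_emeasure(1)[OF S der inj])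
  have id: "(\<lambda>y. y) \<in> lebesgue_on (g ` S) \<rightarrow>\<^sub>M (borel :: (real^'n) measure)"
    by (intro measurable_restrict_space1) (simp add: measurable_completion)
  have "distr (density (lebesgue_on S) ?J) borel g = distr (lebesgue_on (g ` S)) borel (\<lambda>y. y)"
  proof (rule measure_eqI)
    fix E assume "E \<in> sets (distr (density (lebesgue_on S) ?J) borel g)"
    then have E: "E \<in> sets borel" by simp
    let ?P = "S \<inter> g -` E"
    have P: "?P \<in> sets lebesgue" using S measurable_sets[OF g_leb E] by simp
    have PS: "g -` E \<inter> space (lebesgue_on S) \<in> sets (lebesgue_on S)" by (rule measurable_sets[OF gS E])
    have sp: "g -` E \<inter> space (lebesgue_on S) = ?P" by (auto simp: space_restrict_space)
    have "emeasure (distr (density (lebesgue_on S) ?J) borel g) E = emeasure (density (lebesgue_on S) ?J) ?P"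
      using gS E sp by (subst emeasure_distr) (auto simp: space_restrict_space)
    also have "\<dots> = (\<integral>\<^sup>+x. ?J x * indicator ?P x \<partial>lebesgue_on S)"
      using J PS sp by (intro emeasure_density) auto
    also have "\<dots> = (\<integral>\<^sup>+x\<in>?P. ?J x \<partial>lebesgue)"
      using S by (subst nn_integral_restrict_space) (auto intro!: nn_integral_cong simp: indicator_def)
    also have "\<dots> = emeasure lebesgue (g ` ?P)"
      by (rule differentiable_image_emeasure(3)[OF P, symmetric])
        (auto intro: has_derivative_subset[OF der] inj_on_subset[OF inj])
    also have "g ` ?P = g ` S \<inter> E" by auto
    also have "emeasure lebesgue (g ` S \<inter> E) = emeasure (lebesgue_on (g ` S)) (g ` S \<inter> E)"
      using im by (simp add: emeasure_restrict_space)
    also have "\<dots> = emeasure (distr (lebesgue_on (g ` S)) borel (\<lambda>y. y)) E"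
      using id E by (subst emeasure_distr) (auto simp: space_restrict_space Int_commute)
    finally show "emeasure (distr (density (lebesgue_on S) ?J) borel g) E = emeasure (distr (lebesgue_on (g ` S)) borel (\<lambda>y. y)) E" .
  qed simp
  then have "(\<integral>\<^sup>+y. f y \<partial>distr (density (lebesgue_on S) ?J) borel g) = (\<integral>\<^sup>+y. f y \<partial>distr (lebesgue_on (g ` S)) borel (\<lambda>y. y))"
    by simp
  moreover have "(\<integral>\<^sup>+y. f y \<partial>distr (lebesgue_on (g ` S)) borel (\<lambda>y. y)) = (\<integral>\<^sup>+y\<in>g ` S. f y \<partial>lebesgue)"
    using f id im by (simp add: nn_integral_distr nn_integral_restrict_space)
  moreover have "(\<integral>\<^sup>+y. f y \<partial>distr (density (lebesgue_on S) ?J) borel g) = (\<integral>\<^sup>+x. ?J x * f (g x) \<partial>lebesgue_on S)"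
    using f gS J by (simp add: nn_integral_distr nn_integral_density)
  moreover have "\<dots> = (\<integral>\<^sup>+x\<in>S. f (g x) * ?J x \<partial>lebesgue)"
    using S by (simp add: nn_integral_restrict_space mult.commute)
  ultimately show ?thesis by simp
qed

text \<open>The image of the preimage lies in \<open>N\<close>, so by the area formula the Jacobian
  integrates to 0 over it; as the Jacobian does not vanish, the set is null.\<close>

lemma negligible_preimage_nondegenerate:
  fixes g :: "real^'n \<Rightarrow> real^'n"
  assumes S: "S \<in> sets lebesgue" and g: "g \<in> borel_measurable borel"
    and der: "\<And>x. x \<in> S \<Longrightarrow> (g has_derivative g' x) (at x within S)"
    and inj: "inj_on g S" and det: "\<And>x. x \<in> S \<Longrightarrow> det (matrix (g' x)) \<noteq> 0"
    and N: "N \<in> sets borel" "emeasure lborel N = 0"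
  shows "negligible (S \<inter> g -` N)"
proof -
  let ?P = "S \<inter> g -` N"
  have g_leb: "g \<in> lebesgue \<rightarrow>\<^sub>M borel" using g by (simp add: measurable_completion)
  have P: "?P \<in> sets lebesgue" using S measurable_sets[OF g_leb N(1)] by simp
  have derP: "\<And>x. x \<in> ?P \<Longrightarrow> (g has_derivative g' x) (at x within ?P)"
    by (auto intro: has_derivative_subset[OF der])
  have injP: "inj_on g ?P" by (rule inj_on_subset[OF inj]) auto
  note D = differentiable_image_emeasure[OF P derP injP]
  have "negligible N" using N by (simp add: negligible_borel_iff)
  then have "negligible (g ` ?P)" by (rule negligible_subset) auto
  then have "(\<integral>\<^sup>+x\<in>?P. ennreal \<bar>det (matrix (g' x))\<bar> \<partial>lebesgue) = 0"
    using D(3) null_setsD1 unfolding negligible_iff_null_sets by metis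
  then have "(\<integral>\<^sup>+x. ennreal \<bar>det (matrix (g' x))\<bar> \<partial>lebesgue_on ?P) = 0"
    using P by (simp add: nn_integral_restrict_space)
  then have "AE x in lebesgue_on ?P. ennreal \<bar>det (matrix (g' x))\<bar> = 0"
    using D(2) by (subst (asm) nn_integral_0_iff_AE) auto
  then have "AE x in lebesgue_on ?P. False"
    by (rule AE_mp) (auto intro!: AE_I2 simp: det space_restrict_space)
  then have "AE x in lebesgue. x \<notin> ?P" using P by (simp add: AE_restrict_space_iff)
  then show ?thesis
    by (simp only: negligible_iff_null_sets AE_iff_null_sets[OF P])
qed

text \<open>The push-forward identity compares the two densities only on preimages of Borel sets.
  Since \<open>g\<close> is injective with nondegenerate derivative, every measurable subset of
  \<open>S\<close> is such a preimage up to a null set, so the densities agree almost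
  everywhere.\<close>

lemma Jacobian_equation:
  fixes g :: "real^'n \<Rightarrow> real^'n" and \<rho> u :: "real^'n \<Rightarrow> real"
  assumes S: "S \<in> lmeasurable" and g: "g \<in> borel_measurable borel"
    and der: "\<And>x. x \<in> S \<Longrightarrow> (g has_derivative g' x) (at x within S)"
    and inj: "inj_on g S" and det: "\<And>x. x \<in> S \<Longrightarrow> 0 < det (matrix (g' x))"
    and \<rho>: "\<rho> \<in> borel_measurable borel" "\<And>x. 0 \<le> \<rho> x" and u: "u \<in> borel_measurable borel" "\<And>x. 0 \<le> u x"
    and fin: "(\<integral>\<^sup>+x. ennreal (\<rho> x) \<partial>lborel) < \<infinity>"
    and supp: "AE x in lebesgue. x \<notin> S \<longrightarrow> \<rho> x = 0"
    and push: "distr (density lborel (\<lambda>x. ennreal (\<rho> x))) borel g = density lborel (\<lambda>y. ennreal (u y))"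
  shows "AE x in lebesgue_on S. u (g x) * det (matrix (g' x)) = \<rho> x"
    and "AE y in lebesgue. y \<notin> g ` S \<longrightarrow> u y = 0"
proof -
  let ?J = "\<lambda>x. det (matrix (g' x))"
  have SL: "S \<in> sets lebesgue" using S by auto
  have J: "?J \<in> borel_measurable (lebesgue_on S)"
    using differentiable_image_emeasure(2)[OF SL der inj] .
  have g_leb: "g \<in> lebesgue \<rightarrow>\<^sub>M borel" using g by (simp add: measurable_completion)
  have im: "g ` S \<in> sets lebesgue" by (rule differentiable_image_emeasure(1)[OF SL der inj])
  have \<rho>_leb: "\<rho> \<in> borel_measurable lebesgue" and u_leb: "u \<in> borel_measurable lebesgue"
    using \<rho>(1) u(1) by (simp_all add: measurable_completion)
  have basic: "(\<integral>\<^sup>+x\<in>S. indicator E (g x) * ennreal (\<rho> x) \<partial>lebesgue) = (\<integral>\<^sup>+y. ennreal (u y) * indicator E y \<partial>lebesgue)"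
    if E: "E \<in> sets borel" for E
  proof -
    have "(\<integral>\<^sup>+x\<in>S. indicator E (g x) * ennreal (\<rho> x) \<partial>lebesgue) = (\<integral>\<^sup>+x. indicator E (g x) * ennreal (\<rho> x) \<partial>lebesgue)"
      using supp by (intro nn_integral_cong_AE) (auto elim!: eventually_mono simp: indicator_def)
    also have "\<dots> = (\<integral>\<^sup>+x. ennreal (\<rho> x) * indicator (g -` E) x \<partial>lborel)"
      by (subst nn_integral_completion) (auto intro!: nn_integral_cong simp: indicator_def)
    also have "\<dots> = emeasure (density lborel (\<lambda>x. ennreal (\<rho> x))) (g -` E)"
      using \<rho>(1) measurable_sets[OF g E] by (subst emeasure_density) auto
    also have "\<dots> = emeasure (distr (density lborel (\<lambda>x. ennreal (\<rho> x))) borel g) E"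
      using g E by (subst emeasure_distr) auto
    also have "\<dots> = (\<integral>\<^sup>+y. ennreal (u y) * indicator E y \<partial>lborel)"
      unfolding push using u(1) E by (subst emeasure_density) auto
    also have "\<dots> = (\<integral>\<^sup>+y. ennreal (u y) * indicator E y \<partial>lebesgue)"
      by (simp add: nn_integral_completion)
    finally show ?thesis .
  qed
  show out: "AE y in lebesgue. y \<notin> g ` S \<longrightarrow> u y = 0"
  proof -
    have "- g ` S \<in> sets lebesgue" using sets.compl_sets[OF im] by (simp add: Compl_eq_Diff_UNIV)
    \<comment> \<open>The complement of the image is merely Lebesgue measurable, while the
      push-forward is a Borel measure; it is tested on a Borel part that differs from the complement
      by a null set.\<close>
    then obtain E N N' where E: "- g ` S = E \<union> N" "N \<subseteq> N'" "N' \<in> null_sets lborel" "E \<in> sets lborel"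
      by (auto elim: sets_completionE)
    have "(\<integral>\<^sup>+y. ennreal (u y) * indicator E y \<partial>lebesgue) = (\<integral>\<^sup>+x\<in>S. indicator E (g x) * ennreal (\<rho> x) \<partial>lebesgue)"
      using basic E(4) by simp
    also have "\<dots> = (\<integral>\<^sup>+x. 0 \<partial>(lebesgue :: (real^'n) measure))"
      using E(1) by (intro nn_integral_cong) (auto simp: indicator_def)
    finally have "(\<integral>\<^sup>+y. ennreal (u y) * indicator E y \<partial>lborel) = 0" by (simp add: nn_integral_completion)
    then have "AE y in lborel. ennreal (u y) * indicator E y = 0"
      using u(1) E(4) by (subst (asm) nn_integral_0_iff_AE) auto
    moreover have "AE y in lborel. y \<notin> N'" using E(3) by (rule AE_not_in)
    ultimately have "AE y in lborel. y \<notin> g ` S \<longrightarrow> u y = 0"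
    proof eventually_elim
      fix y assume 1: "ennreal (u y) * indicator E y = 0" and 2: "y \<notin> N'"
      show "y \<notin> g ` S \<longrightarrow> u y = 0"
      proof
        assume "y \<notin> g ` S"
        then have "y \<in> E" using E(1,2) 2 by blast
        then show "u y = 0" using 1 u(2)[of y] by simp
      qed
    qed
    then show ?thesis by (rule AE_completion)
  qed
  have eq: "(\<integral>\<^sup>+x\<in>S. indicator E (g x) * ennreal (\<rho> x) \<partial>lebesgue) = (\<integral>\<^sup>+x\<in>S. indicator E (g x) * ennreal (u (g x) * ?J x) \<partial>lebesgue)"
    if E: "E \<in> sets borel" for E
  proof -
    have "(\<integral>\<^sup>+y. ennreal (u y) * indicator E y \<partial>lebesgue) = (\<integral>\<^sup>+y\<in>g ` S. ennreal (u y) * indicator E y \<partial>lebesgue)"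
      using out by (intro nn_integral_cong_AE) (auto elim!: eventually_mono simp: indicator_def)
    also have "\<dots> = (\<integral>\<^sup>+x\<in>S. (ennreal (u (g x)) * indicator E (g x)) * ennreal \<bar>?J x\<bar> \<partial>lebesgue)"
      using u(1) E by (intro nn_integral_change_of_variables[OF SL g der inj]) auto
    also have "\<dots> = (\<integral>\<^sup>+x\<in>S. indicator E (g x) * ennreal (u (g x) * ?J x) \<partial>lebesgue)"
      using det u(2) by (intro nn_integral_cong) (auto simp: indicator_def ennreal_mult' less_imp_le)
    finally show ?thesis using basic[OF E] by simp
  qed
  have m1: "(\<lambda>x. ennreal (\<rho> x)) \<in> borel_measurable (lebesgue_on S)"
    using measurable_restrict_space1[OF \<rho>_leb] by measurable
  have m2: "(\<lambda>x. ennreal (u (g x) * ?J x)) \<in> borel_measurable (lebesgue_on S)"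
    using measurable_restrict_space1[OF measurable_compose[OF g_leb u(1)]] J by measurable
  have "density (lebesgue_on S) (\<lambda>x. ennreal (\<rho> x)) = density (lebesgue_on S) (\<lambda>x. ennreal (u (g x) * ?J x))"
  proof (rule measure_eqI)
    fix B assume "B \<in> sets (density (lebesgue_on S) (\<lambda>x. ennreal (\<rho> x)))"
    then have BS: "B \<in> sets (lebesgue_on S)" by simp
    then have B: "B \<subseteq> S" "B \<in> sets lebesgue" using SL by (auto simp: sets_restrict_space_iff)
    have "g ` B \<in> sets lebesgue"
      using B by (intro differentiable_image_emeasure(1)) (auto intro: has_derivative_subset[OF der] inj_on_subset[OF inj])
    then obtain E N N' where E: "g ` B = E \<union> N" "N \<subseteq> N'" "N' \<in> null_sets lborel" "E \<in> sets lborel"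
      by (auto elim: sets_completionE)
    \<comment> \<open>The image of \<open>B\<close> is Borel only up to \<open>N'\<close>;
      nondegeneracy makes the preimage of \<open>N'\<close> null as well, so the indicators agree
      almost everywhere.\<close>
    have "negligible (S \<inter> g -` N')"
      using E(3) det by (intro negligible_preimage_nondegenerate[OF SL g der inj]) (auto simp: less_imp_neq[symmetric])
    then have "AE x in lebesgue. x \<notin> S \<inter> g -` N'"
      unfolding negligible_iff_null_sets by (rule AE_not_in)
    then have ind: "AE x in lebesgue. x \<in> S \<longrightarrow> (indicator B x = (indicator E (g x) :: ennreal))"
    proof eventually_elim
      fix x assume x: "x \<notin> S \<inter> g -` N'"
      show "x \<in> S \<longrightarrow> (indicator B x = (indicator E (g x) :: ennreal))"
      proof
        assume xS: "x \<in> S"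
        then have "g x \<in> g ` B \<longleftrightarrow> x \<in> B" using inj B(1) by (auto dest: inj_onD)
        moreover have "g x \<in> g ` B \<longleftrightarrow> g x \<in> E" using E(1,2) x xS by blast
        ultimately show "indicator B x = (indicator E (g x) :: ennreal)" by (simp add: indicator_def)
      qed
    qed
    have *: "emeasure (density (lebesgue_on S) F) B = (\<integral>\<^sup>+x\<in>S. indicator E (g x) * F x \<partial>lebesgue)"
      if F: "F \<in> borel_measurable (lebesgue_on S)" for F
    proof -
      have "emeasure (density (lebesgue_on S) F) B = (\<integral>\<^sup>+x\<in>S. F x * indicator B x \<partial>lebesgue)"
        using F BS SL by (simp add: emeasure_density nn_integral_restrict_space)
      also have "\<dots> = (\<integral>\<^sup>+x\<in>S. indicator E (g x) * F x \<partial>lebesgue)"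
        using ind by (intro nn_integral_cong_AE) (auto elim!: eventually_mono simp: indicator_def)
      finally show ?thesis .
    qed
    show "emeasure (density (lebesgue_on S) (\<lambda>x. ennreal (\<rho> x))) B = emeasure (density (lebesgue_on S) (\<lambda>x. ennreal (u (g x) * ?J x))) B"
      unfolding *[OF m1] *[OF m2] using eq E(4) by simp
  qed simp
  moreover have "sigma_finite_measure (lebesgue_on S)"
    using finite_measure_lebesgue_on[OF S] by (simp add: finite_measure_def)
  ultimately have "AE x in lebesgue_on S. ennreal (\<rho> x) = ennreal (u (g x) * ?J x)"
    using m1 m2 by (subst (asm) sigma_finite_measure.density_unique_iff) auto
  moreover have "AE x in lebesgue_on S. x \<in> S" by (rule AE_I2) (simp add: space_restrict_space)
  ultimately show "AE x in lebesgue_on S. u (g x) * ?J x = \<rho> x"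
  proof eventually_elim
    fix x assume "ennreal (\<rho> x) = ennreal (u (g x) * ?J x)" "x \<in> S"
    then show "u (g x) * ?J x = \<rho> x"
      using \<rho>(2)[of x] u(2)[of "g x"] det[of x] by (simp add: ennreal_inj less_imp_le)
  qed
qed

text \<open>Because \<open>F 0 = 0\<close> and \<open>u\<close> vanishes almost everywhere off the
  image of \<open>S\<close>, the integral over \<open>C\<close> only sees that image.\<close>

lemma nn_integral_density_change_of_variables:
  fixes g :: "real^'n \<Rightarrow> real^'n" and \<rho> u :: "real^'n \<Rightarrow> real" and F :: "real \<Rightarrow> ennreal"
  assumes S: "S \<in> sets lebesgue" and g: "g \<in> borel_measurable borel"
    and der: "\<And>x. x \<in> S \<Longrightarrow> (g has_derivative g' x) (at x within S)"
    and inj: "inj_on g S" and det: "\<And>x. x \<in> S \<Longrightarrow> 0 < det (matrix (g' x))"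
    and u: "u \<in> borel_measurable borel"
    and F: "F \<in> borel_measurable borel" "F 0 = 0"
    and eq: "AE x in lebesgue_on S. u (g x) * det (matrix (g' x)) = \<rho> x"
    and out: "AE y in lebesgue. y \<notin> g ` S \<longrightarrow> u y = 0"
    and C: "g ` S \<subseteq> C"
  shows "(\<integral>\<^sup>+y\<in>C. F (u y) \<partial>lebesgue) = (\<integral>\<^sup>+x. F (\<rho> x / det (matrix (g' x))) * ennreal (det (matrix (g' x))) \<partial>lebesgue_on S)"
proof -
  let ?J = "\<lambda>x. det (matrix (g' x))"
  have "(\<integral>\<^sup>+y\<in>C. F (u y) \<partial>lebesgue) = (\<integral>\<^sup>+y\<in>g ` S. F (u y) \<partial>lebesgue)"
    using out C F(2) by (intro nn_integral_cong_AE) (auto elim!: eventually_mono simp: indicator_def)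
  also have "\<dots> = (\<integral>\<^sup>+x\<in>S. F (u (g x)) * ennreal \<bar>?J x\<bar> \<partial>lebesgue)"
    by (intro nn_integral_change_of_variables[OF S g der inj] measurable_compose[OF u F(1)])
  also have "\<dots> = (\<integral>\<^sup>+x. F (u (g x)) * ennreal \<bar>?J x\<bar> \<partial>lebesgue_on S)"
    using S by (simp add: nn_integral_restrict_space)
  also have "\<dots> = (\<integral>\<^sup>+x. F (\<rho> x / ?J x) * ennreal (?J x) \<partial>lebesgue_on S)"
  proof (rule nn_integral_cong_AE)
    have "AE x in lebesgue_on S. x \<in> S" by (rule AE_I2) (simp add: space_restrict_space)
    then show "AE x in lebesgue_on S. F (u (g x)) * ennreal \<bar>?J x\<bar> = F (\<rho> x / ?J x) * ennreal (?J x)"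
      using eq
    proof eventually_elim
      fix x assume x: "x \<in> S" "u (g x) * ?J x = \<rho> x"
      then have "u (g x) = \<rho> x / ?J x" using det[of x] by (simp add: eq_divide_eq)
      then show "F (u (g x)) * ennreal \<bar>?J x\<bar> = F (\<rho> x / ?J x) * ennreal (?J x)"
        using det[OF x(1)] by simp
    qed
  qed
  finally show ?thesis .
qed

subsection \<open>Push-forwards and their entropy\<close>

lemma C1_map_on_differentiable_on:
  assumes "C1_map_on S F" shows "F differentiable_on S"
proof -
  have "\<exists>d. ((\<lambda>x. F x $ i) has_derivative d) (at x within S)" if "x \<in> S" for x i
    using assms that unfolding C1_map_on_def One_nat_def Ck_on.simps by blast
  then have "\<exists>d. \<forall>i. ((\<lambda>x. F x $ i) has_derivative d i) (at x within S)" if "x \<in> S" for x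
    using that by (intro choice allI)
  then show ?thesis
    unfolding differentiable_on_def differentiable_def
  proof (intro ballI)
    fix x assume "x \<in> S"
    then obtain d where "\<And>i. ((\<lambda>x. F x $ i) has_derivative d i) (at x within S)"
      using \<open>\<And>x. x \<in> S \<Longrightarrow> \<exists>d. \<forall>i. ((\<lambda>x. F x $ i) has_derivative d i) (at x within S)\<close> by blast
    then have "(F has_derivative (\<lambda>h. \<chi> i. d i h)) (at x within S)"
      by (subst has_derivative_componentwise_within) (auto simp: Basis_vec_def inner_axis)
    then show "\<exists>D. (F has_derivative D) (at x within S)" by blast
  qed
qed

lemma lmeasurable_cube: "(cube :: (real^'n) set) \<in> lmeasurable"
  using norm_cube by (intro lmeasurable_open open_cube) (auto simp: bounded_iff)

lemma sets_cube: "(cube :: (real^'n) set) \<in> sets borel"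
  by (rule borel_open[OF open_cube])

lemma push_forward_facts:
  fixes T :: "real^'n \<Rightarrow> real^'n"
  assumes T: "T \<in> Diff_plus" and int: "has_bochner_integral (lebesgue_on cube) ubar M"
    and pos: "\<forall>x\<in>cube. 0 < ubar x"
  shows "sets (push_forward ubar T) = sets borel"
    and "finite_measure (push_forward ubar T)"
    and "absolutely_continuous lborel (push_forward ubar T)"
    and "emeasure (push_forward ubar T) (- cube) = 0"
    and "t \<in> borel_measurable borel \<Longrightarrow> push_forward ubar (t \<circ> T) = distr (push_forward ubar T) borel t"
proof -
  let ?D = "density (lebesgue_on cube) (\<lambda>x. ennreal (ubar x))"
  have bij: "bij_betw T (closure cube) (closure cube)"
    and TC: "C1_map_on (closure cube) T" "C1_map_on (closure cube) (inv_into (closure cube) T)"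
    using T by (auto simp: Diff_plus_def)
  have "continuous_on (closure cube) T"
    by (rule differentiable_imp_continuous_on[OF C1_map_on_differentiable_on[OF TC(1)]])
  then have "continuous_on cube T" using closure_subset continuous_on_subset by blast
  then have T_cube: "T \<in> borel_measurable (lebesgue_on cube)"
    by (rule continuous_imp_measurable_on_sets_lebesgue) (use lmeasurable_cube in auto)
  then have T_meas: "T \<in> borel_measurable ?D" by simp
  have ubar: "integrable (lebesgue_on cube) ubar" using int by (simp add: has_bochner_integral_iff)
  then have ubar_meas: "(\<lambda>x. ennreal (ubar x)) \<in> borel_measurable (lebesgue_on cube)"
    using borel_measurable_integrable by measurable
  show sets: "sets (push_forward ubar T) = sets borel" by (simp add: push_forward_def)
  have space: "space (push_forward ubar T) = UNIV" by (simp add: push_forward_def)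
  show "finite_measure (push_forward ubar T)"
  proof (rule finite_measureI)
    have "emeasure (push_forward ubar T) (space (push_forward ubar T)) = emeasure ?D (space ?D)"
      unfolding push_forward_def using T_meas by (subst emeasure_distr) auto
    also have "\<dots> = (\<integral>\<^sup>+x. ennreal (ubar x) \<partial>lebesgue_on cube)"
      using ubar_meas by (subst emeasure_density) (auto intro!: nn_integral_cong simp: indicator_def)
    also have "\<dots> \<le> (\<integral>\<^sup>+x. ennreal (norm (ubar x)) \<partial>lebesgue_on cube)"
      by (intro nn_integral_mono ennreal_leI) simp
    also have "\<dots> < \<infinity>" using ubar by (simp add: integrable_iff_bounded)
    finally show "emeasure (push_forward ubar T) (space (push_forward ubar T)) \<noteq> \<infinity>" by simp
  qed
  \<comment> \<open>Preimages of null sets under \<open>T\<close> are covered by images under its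
    inverse, which is differentiable on the closed cube and so preserves null sets.\<close>
  have null: "emeasure (push_forward ubar T) A = 0" if A: "A \<in> sets borel" "negligible (A \<inter> closure cube)" for A
  proof -
    let ?B = "T -` A \<inter> cube"
    have "?B \<subseteq> inv_into (closure cube) T ` (A \<inter> closure cube)"
    proof
      fix x assume x: "x \<in> ?B"
      then have xc: "x \<in> closure cube" using closure_subset by blast
      then have "T x \<in> closure cube" "inv_into (closure cube) T (T x) = x"
        using bij by (auto simp: bij_betw_def)
      then show "x \<in> inv_into (closure cube) T ` (A \<inter> closure cube)" using x by (metis IntE IntI imageI vimageD)
    qed
    moreover have "negligible (inv_into (closure cube) T ` (A \<inter> closure cube))"
      using A(2) by (rule negligible_differentiable_image_negligible[OF order_refl])
        (rule differentiable_on_subset[OF C1_map_on_differentiable_on[OF TC(2)]], auto)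
    ultimately have neg: "negligible ?B" by (rule negligible_subset[rotated])
    have vim: "T -` A \<inter> space (lebesgue_on cube) = ?B" by (simp add: space_restrict_space)
    have B: "?B \<in> sets (lebesgue_on cube)" using measurable_sets[OF T_cube A(1)] vim by simp
    have cubeL: "cube \<in> sets lebesgue" using lmeasurable_cube by auto
    have "?B \<in> null_sets (lebesgue_on cube)"
      using neg unfolding null_sets_restrict_space[OF cubeL] negligible_iff_null_sets by blast
    then have "?B \<in> null_sets ?D"
      using ubar_meas by (rule_tac absolutely_continuousI_density[unfolded absolutely_continuous_def, THEN subsetD]) auto
    moreover have "emeasure (push_forward ubar T) A = emeasure ?D ?B"
      unfolding push_forward_def using T_meas A(1) vim by (subst emeasure_distr) (auto simp: space_restrict_space)
    ultimately show ?thesis by auto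
  qed
  show "absolutely_continuous lborel (push_forward ubar T)"
    unfolding absolutely_continuous_def
  proof
    fix A assume A: "A \<in> null_sets (lborel :: (real^'n) measure)"
    then have "negligible A" by (simp add: negligible_borel_iff null_sets_def)
    then have "negligible (A \<inter> closure cube)" by (rule negligible_subset) auto
    then show "A \<in> null_sets (push_forward ubar T)" using A null by (auto simp: null_sets_def sets)
  qed
  \<comment> \<open>\<open>T\<close> maps into the closed cube, so only the boundary could carry
    mass outside the open cube, and it is null.\<close>
  show "emeasure (push_forward ubar T) (- cube) = 0"
  proof (rule null)
    show "- cube \<in> sets borel" using sets_cube sets.compl_sets[of cube borel] by (simp add: Compl_eq_Diff_UNIV)
    have "negligible (frontier (cube :: (real^'n) set))" by (rule negligible_convex_frontier[OF convex_cube])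
    then show "negligible (- cube \<inter> closure (cube :: (real^'n) set))"
      by (rule negligible_subset) (auto simp: frontier_def interior_open[OF open_cube])
  qed
  show "push_forward ubar (t \<circ> T) = distr (push_forward ubar T) borel t" if "t \<in> borel_measurable borel"
    unfolding push_forward_def using that T_meas by (subst distr_distr) auto
qed

section \<open>Extended-valued entropy\<close>

lemma enn2ereal_finite: "x \<noteq> \<infinity> \<Longrightarrow> enn2ereal x = ereal (enn2real x)"
  by (cases x) (auto simp: enn2ereal_ennreal)

lemma ext_integral_integrable:
  assumes "integrable M f" shows "ext_integral M f = ereal (\<integral>x. f x \<partial>M)"
proof -
  have "(\<integral>\<^sup>+x. ennreal (f x) \<partial>M) \<noteq> \<infinity>" "(\<integral>\<^sup>+x. ennreal (- f x) \<partial>M) \<noteq> \<infinity>"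
    using assms unfolding real_integrable_def by blast+
  note this[THEN enn2ereal_finite]
  then show ?thesis unfolding ext_integral_def real_lebesgue_integral_def[OF assms] by simp
qed

lemma ext_integral_not_integrable:
  assumes "f \<in> borel_measurable M" "\<not> integrable M f" "(\<integral>\<^sup>+x. ennreal (- f x) \<partial>M) < \<infinity>"
  shows "ext_integral M f = \<infinity>"
proof -
  have "(\<integral>\<^sup>+x. ennreal (f x) \<partial>M) = \<infinity>" using assms by (auto simp: real_integrable_def)
  moreover have "enn2ereal (\<integral>\<^sup>+x. ennreal (- f x) \<partial>M) = ereal (enn2real (\<integral>\<^sup>+x. ennreal (- f x) \<partial>M))"
    using assms(3) by (intro enn2ereal_finite) auto
  ultimately show ?thesis unfolding ext_integral_def by simp
qed

text \<open>Finite mass makes the Radon-Nikodym derivative finite almost everywhere, so the passage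
  through \<open>enn2real\<close> in \<open>map_entropy\<close> loses nothing.\<close>

lemma finite_density_RN_deriv:
  fixes N :: "'a::euclidean_space measure"
  assumes "finite_measure N" "absolutely_continuous lborel N" "sets N = sets borel"
  shows "density lborel (\<lambda>x. ennreal (enn2real (RN_deriv lborel N x))) = N"
proof -
  have "sigma_finite_measure N" using assms(1) by (simp add: finite_measure_def)
  then have "AE x in lborel. RN_deriv lborel N x \<noteq> \<infinity>"
    using assms by (intro sigma_finite_measure.RN_deriv_finite[OF lborel.sigma_finite_measure_axioms]) auto
  then have "density lborel (\<lambda>x. ennreal (enn2real (RN_deriv lborel N x))) = density lborel (RN_deriv lborel N)"
    by (intro density_cong) (auto elim!: eventually_mono simp: less_top)
  then show ?thesis using sigma_finite_measure.density_RN_deriv[OF lborel.sigma_finite_measure_axioms, of N] assms by simp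
qed

text \<open>\<open>h\<close> is constrained only on nonnegative arguments; clamping gives a Borel
  function on all reals that agrees with \<open>h\<close> on densities.\<close>

lemma internal_energy_measurable:
  assumes "internal_energy P h"
  shows "(\<lambda>r. h (max 0 r)) \<in> borel_measurable borel"
proof -
  have "continuous_on {0..} h" using assms unfolding internal_energy_def by (rule conjunct1)
  then have "continuous_on UNIV (\<lambda>r. h (max 0 r))"
    by (rule continuous_on_compose2) (auto intro!: continuous_intros)
  then show ?thesis by (rule borel_measurable_continuous_onI)
qed

text \<open>\<open>V\<close> is arbitrary off the closed cube, so it is cut off before being
  integrated against measures on the whole space.\<close>

lemma cube_potential:
  fixes V :: "real^'n \<Rightarrow> real"
  assumes V: "continuous_on (closure cube) V"
  shows "(\<lambda>y. indicator cube y * V y) \<in> borel_measurable borel"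
    and "\<exists>B\<ge>0. \<forall>y. \<bar>indicator cube y * V y\<bar> \<le> B"
proof -
  show "(\<lambda>y. indicator cube y * V y) \<in> borel_measurable borel"
    using borel_measurable_continuous_on_indicator[OF sets_cube continuous_on_subset[OF V closure_subset]] by simp
  have "compact (V ` closure cube)"
  proof (rule compact_continuous_image[OF V])
    have "bounded (cube :: (real^'n) set)" using norm_cube by (auto simp: bounded_iff)
    then show "compact (closure (cube :: (real^'n) set))" by (simp add: compact_closure)
  qed
  then obtain B where B: "\<And>x. x \<in> closure cube \<Longrightarrow> \<bar>V x\<bar> \<le> B"
    using compact_imp_bounded bounded_iff by (metis imageI real_norm_def)
  have "\<bar>indicator cube y * V y\<bar> \<le> \<bar>B\<bar>" for y
    using B[of y] closure_subset[of cube] by (auto simp: indicator_def)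
  then show "\<exists>B\<ge>0. \<forall>y. \<bar>indicator cube y * V y\<bar> \<le> B" by (intro exI[of _ "\<bar>B\<bar>"]) simp
qed

text \<open>The negative part is controlled by the mass and the volume of the cube, and the
  potential term is finite because \<open>V\<close> is bounded there. Hence integrability of
  \<open>h (u x) - h 0\<close> alone decides between a real value and infinity.\<close>

lemma relative_entropy_cases:
  fixes u :: "real^'n \<Rightarrow> real"
  assumes P: "pressure P" and h: "internal_energy P h" and V: "continuous_on (closure cube) V"
    and u: "u \<in> borel_measurable borel" "\<And>x. 0 \<le> u x" and fin: "(\<integral>\<^sup>+x. ennreal (u x) \<partial>lborel) < \<infinity>"
  shows "(\<integral>\<^sup>+x. ennreal (- (h (u x) - h 0)) \<partial>lebesgue_on cube) < \<infinity>"
    and "integrable (lebesgue_on cube) (\<lambda>x. h (u x) - h 0) \<Longrightarrow>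
      relative_entropy h V u = ereal (h 0 * measure lebesgue (cube :: (real^'n) set) + (\<integral>x. h (u x) - h 0 \<partial>lebesgue_on cube)
        + (\<integral>x. indicator cube x * V x \<partial>density lborel (\<lambda>x. ennreal (u x))))"
    and "\<not> integrable (lebesgue_on cube) (\<lambda>x. h (u x) - h 0) \<Longrightarrow> relative_entropy h V u = \<infinity>"
proof -
  have cubeL: "(cube :: (real^'n) set) \<in> sets lebesgue" using lmeasurable_cube by auto
  have fm: "finite_measure (lebesgue_on (cube :: (real^'n) set))"
    by (rule finite_measure_lebesgue_on[OF lmeasurable_cube])
  have u_leb: "u \<in> borel_measurable lebesgue" using u(1) by (simp add: measurable_completion)
  have u_cube: "u \<in> borel_measurable (lebesgue_on cube)" by (rule measurable_restrict_space1[OF u_leb])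
  have "integrable lborel u" using u fin by (intro integrableI_nonneg) auto
  then have u_int: "integrable lebesgue u" using u(1) by (simp add: integrable_completion)
  then have u_int_cube: "integrable (lebesgue_on cube) u"
    using cubeL integrable_mult_indicator[OF cubeL u_int] by (simp add: integrable_restrict_space)
  have const: "integrable (lebesgue_on (cube :: (real^'n) set)) (\<lambda>x. c)" for c :: real
    using fm by (rule finite_measure.integrable_const)
  have hu: "(\<lambda>x. h (u x)) \<in> borel_measurable (lebesgue_on cube)"
    using measurable_compose[OF u_cube internal_energy_measurable[OF h]] u(2) by (simp add: max_def)
  obtain C where C: "0 \<le> C" "\<And>r. 0 \<le> r \<Longrightarrow> - (C * (1 + r)) \<le> h r - h 0"
    using internal_energy_lower_bound[OF P h] by blast
  have neg: "(\<integral>\<^sup>+x. ennreal (- (h (u x) - k)) \<partial>lebesgue_on cube) < \<infinity>" for k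
  proof -
    have "(\<integral>\<^sup>+x. ennreal (- (h (u x) - k)) \<partial>lebesgue_on cube) \<le> (\<integral>\<^sup>+x. ennreal (norm (C * (1 + u x) + \<bar>k - h 0\<bar>)) \<partial>lebesgue_on cube)"
    proof (intro nn_integral_mono ennreal_leI)
      fix x
      have "- (C * (1 + u x)) \<le> h (u x) - h 0" by (rule C(2)[OF u(2)])
      then show "- (h (u x) - k) \<le> norm (C * (1 + u x) + \<bar>k - h 0\<bar>)" by (simp del: ring_distribs)
    qed
    also have "\<dots> < \<infinity>"
    proof -
      have "integrable (lebesgue_on cube) (\<lambda>x. C * (1 + u x) + \<bar>k - h 0\<bar>)"
        using u_int_cube const by (intro Bochner_Integration.integrable_add integrable_mult_right) auto
      then show ?thesis by (simp only: integrable_iff_bounded)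
    qed
    finally show ?thesis .
  qed
  from neg show "(\<integral>\<^sup>+x. ennreal (- (h (u x) - h 0)) \<partial>lebesgue_on cube) < \<infinity>" .
  have iff: "integrable (lebesgue_on cube) (\<lambda>x. h (u x) - h 0) \<longleftrightarrow> integrable (lebesgue_on cube) (\<lambda>x. h (u x))"
  proof
    assume "integrable (lebesgue_on cube) (\<lambda>x. h (u x) - h 0)"
    from Bochner_Integration.integrable_add[OF this const[of "h 0"]]
    show "integrable (lebesgue_on cube) (\<lambda>x. h (u x))" by simp
  qed (intro Bochner_Integration.integrable_diff const)
  define V' where "V' x = indicator cube x * V x" for x
  have V'_meas: "V' \<in> borel_measurable borel" unfolding V'_def by (rule cube_potential(1)[OF V])
  obtain B where B: "0 \<le> B" and V'_le: "\<And>x. \<bar>V' x\<bar> \<le> B"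
    using cube_potential(2)[OF V] unfolding V'_def by blast
  have uV_int: "integrable lborel (\<lambda>x. u x * V' x)"
  proof (rule Bochner_Integration.integrable_bound[OF integrable_mult_right[OF \<open>integrable lborel u\<close>, of "B"]])
    show "AE x in lborel. norm (u x * V' x) \<le> norm (B * u x)"
      using mult_left_mono[OF V'_le u(2)] u(2) by (intro AE_I2) (simp add: abs_mult mult.commute[of B] B)
    show "(\<lambda>x. u x * V' x) \<in> borel_measurable lborel" using u(1) V'_meas by measurable
  qed
  have eqV: "(\<lambda>x. indicator cube x * (u x * V x)) = (\<lambda>x. u x * V' x)"
    by (auto simp: V'_def indicator_def)
  have uV_cube: "integrable (lebesgue_on cube) (\<lambda>x. u x * V x)"
    using cubeL uV_int borel_measurable_integrable[OF uV_int] by (subst integrable_restrict_space) (simp_all add: eqV integrable_completion)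
  have "(\<integral>x. u x * V x \<partial>lebesgue_on cube) = (\<integral>x. u x * V' x \<partial>lebesgue)"
    using cubeL by (subst integral_restrict_space) (simp_all add: eqV)
  also have "\<dots> = (\<integral>x. u x * V' x \<partial>lborel)"
    using borel_measurable_integrable[OF uV_int] by (simp add: integral_completion)
  also have "\<dots> = (\<integral>x. V' x \<partial>density lborel (\<lambda>x. ennreal (u x)))"
    using u V'_meas by (subst integral_density) auto
  finally have extV: "ext_integral (lebesgue_on cube) (\<lambda>x. u x * V x) = ereal (\<integral>x. V' x \<partial>density lborel (\<lambda>x. ennreal (u x)))"
    using ext_integral_integrable[OF uV_cube] by simp
  show "relative_entropy h V u = ereal (h 0 * measure lebesgue (cube :: (real^'n) set) + (\<integral>x. h (u x) - h 0 \<partial>lebesgue_on cube)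
        + (\<integral>x. indicator cube x * V x \<partial>density lborel (\<lambda>x. ennreal (u x))))"
    if i: "integrable (lebesgue_on cube) (\<lambda>x. h (u x) - h 0)"
  proof -
    have "(\<integral>x. h (u x) \<partial>lebesgue_on cube) = (\<integral>x. (h (u x) - h 0) + h 0 \<partial>lebesgue_on cube)" by simp
    also have "\<dots> = (\<integral>x. h (u x) - h 0 \<partial>lebesgue_on cube) + (\<integral>x. h 0 \<partial>lebesgue_on (cube :: (real^'n) set))"
      by (rule Bochner_Integration.integral_add[OF i const])
    also have "(\<integral>x. h 0 \<partial>lebesgue_on (cube :: (real^'n) set)) = h 0 * measure lebesgue (cube :: (real^'n) set)"
      using cubeL by (simp add: measure_restrict_space space_restrict_space)
    finally show ?thesis
      using i iff extV unfolding relative_entropy_def V'_def by (simp add: ext_integral_integrable)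
  qed
  show "relative_entropy h V u = \<infinity>" if "\<not> integrable (lebesgue_on cube) (\<lambda>x. h (u x) - h 0)"
  proof -
    have "ext_integral (lebesgue_on cube) (\<lambda>x. h (u x)) = \<infinity>"
      using that iff hu neg[of 0] by (intro ext_integral_not_integrable) auto
    then show ?thesis unfolding relative_entropy_def extV by simp
  qed
qed

text \<open>The internal energy is moved from the image back to \<open>S\<close>, where the
  integrands of different maps can be compared pointwise. Positive and negative parts are
  transported separately, so integrability on the two sides is equivalent and infinite energies are
  covered.\<close>

lemma entropy_of_push_forward:
  fixes g :: "real^'n \<Rightarrow> real^'n" and \<rho> :: "real^'n \<Rightarrow> real"
  assumes P: "pressure P" and h: "internal_energy P h" and V: "continuous_on (closure cube) V"
    and S: "S \<in> sets lebesgue" "S \<subseteq> cube" "g ` S \<subseteq> cube" and g: "g \<in> borel_measurable borel"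
    and der_ball: "\<forall>x\<in>S. (g has_derivative g' x) (at x within S)"
    and inj: "inj_on g S" and det_ball: "\<forall>x\<in>S. 0 < det (matrix (g' x))"
    and \<rho>: "\<rho> \<in> borel_measurable borel" "\<And>x. 0 \<le> \<rho> x" and fin: "(\<integral>\<^sup>+x. ennreal (\<rho> x) \<partial>lborel) < \<infinity>"
    and supp: "AE x in lebesgue. x \<notin> S \<longrightarrow> \<rho> x = 0"
  defines "N \<equiv> distr (density lborel (\<lambda>x. ennreal (\<rho> x))) borel g"
    and "\<Phi> \<equiv> \<lambda>x. det (matrix (g' x)) * (h (\<rho> x / det (matrix (g' x))) - h 0)"
  shows "absolutely_continuous lborel N"
    and "\<Phi> \<in> borel_measurable (lebesgue_on S)"
    and "(\<integral>\<^sup>+x. ennreal (- \<Phi> x) \<partial>lebesgue_on S) < \<infinity>"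
    and "integrable (lebesgue_on S) \<Phi> \<Longrightarrow> relative_entropy h V (\<lambda>x. enn2real (RN_deriv lborel N x))
      = ereal (h 0 * measure lebesgue (cube :: (real^'n) set) + (\<integral>x. \<Phi> x \<partial>lebesgue_on S)
         + (\<integral>x. indicator cube (g x) * V (g x) \<partial>density lborel (\<lambda>x. ennreal (\<rho> x))))"
    and "\<not> integrable (lebesgue_on S) \<Phi> \<Longrightarrow> relative_entropy h V (\<lambda>x. enn2real (RN_deriv lborel N x)) = \<infinity>"
proof -
  let ?J = "\<lambda>x. det (matrix (g' x))" and ?\<mu> = "density lborel (\<lambda>x. ennreal (\<rho> x))"
  note der = bspec[OF der_ball] and det = bspec[OF det_ball]
  have Sm: "S \<in> lmeasurable" using S lmeasurable_cube by (meson fmeasurableI2)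
  have cubeL: "(cube :: (real^'n) set) \<in> sets lebesgue" using lmeasurable_cube by auto
  have det_nz: "\<And>x. x \<in> S \<Longrightarrow> ?J x \<noteq> 0" using det by force
  have g\<mu>: "g \<in> ?\<mu> \<rightarrow>\<^sub>M borel" using g by simp
  show ac: "absolutely_continuous lborel N"
    unfolding absolutely_continuous_def
  proof
    fix A assume A: "A \<in> null_sets (lborel :: (real^'n) measure)"
    then have "negligible (S \<inter> g -` A)"
      by (intro negligible_preimage_nondegenerate[OF S(1) g der inj det_nz]) auto
    then have "AE x in lebesgue. x \<notin> S \<inter> g -` A"
      unfolding negligible_iff_null_sets by (rule AE_not_in)
    then have z: "AE x in lebesgue. ennreal (\<rho> x) * indicator (g -` A) x = 0"
      using supp by eventually_elim (auto simp: indicator_def)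
    have "emeasure N A = emeasure ?\<mu> (g -` A)"
      unfolding N_def using A g\<mu> by (subst emeasure_distr) auto
    also have "\<dots> = (\<integral>\<^sup>+x. ennreal (\<rho> x) * indicator (g -` A) x \<partial>lborel)"
      using \<rho>(1) measurable_sets[OF g, of A] A by (subst emeasure_density) auto
    also have "\<dots> = (\<integral>\<^sup>+x. ennreal (\<rho> x) * indicator (g -` A) x \<partial>lebesgue)"
      by (simp add: nn_integral_completion)
    also have "\<dots> = (\<integral>\<^sup>+x. 0 \<partial>(lebesgue :: (real^'n) measure))" by (rule nn_integral_cong_AE[OF z])
    finally show "A \<in> null_sets N" using A by (auto simp: null_sets_def N_def)
  qed
  define u where "u x = enn2real (RN_deriv lborel N x)" for x
  have setsN: "sets N = sets borel" by (simp add: N_def)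
  have finN: "finite_measure N"
  proof (rule finite_measureI)
    have "emeasure N (space N) = emeasure ?\<mu> UNIV"
      unfolding N_def using g\<mu> by (subst emeasure_distr) auto
    also have "\<dots> = (\<integral>\<^sup>+x. ennreal (\<rho> x) \<partial>lborel)" using \<rho>(1) by (subst emeasure_density) auto
    finally show "emeasure N (space N) \<noteq> \<infinity>" using fin by simp
  qed
  have push: "N = density lborel (\<lambda>x. ennreal (u x))"
    unfolding u_def using finite_density_RN_deriv[OF finN ac setsN] by simp
  have u: "u \<in> borel_measurable borel" "\<And>x. 0 \<le> u x"
    unfolding u_def using borel_measurable_RN_deriv[of lborel N] by (auto intro: borel_measurable_enn2real)
  have u_fin: "(\<integral>\<^sup>+x. ennreal (u x) \<partial>lborel) < \<infinity>"
  proof -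
    have "(\<integral>\<^sup>+x. ennreal (u x) \<partial>lborel) = emeasure N UNIV"
      unfolding push using u(1) by (subst emeasure_density) auto
    also have "\<dots> < \<infinity>" using finite_measure.emeasure_finite[OF finN, of UNIV] by (simp add: less_top)
    finally show ?thesis .
  qed
  have push': "distr ?\<mu> borel g = density lborel (\<lambda>x. ennreal (u x))" using push unfolding N_def .
  have J_eq: "AE x in lebesgue_on S. u (g x) * ?J x = \<rho> x"
    by (rule Jacobian_equation(1)[OF Sm g der inj det \<rho> u fin supp push'])
  have u_out: "AE y in lebesgue. y \<notin> g ` S \<longrightarrow> u y = 0"
    by (rule Jacobian_equation(2)[OF Sm g der inj det \<rho> u fin supp push'])
  note ent = relative_entropy_cases[OF P h V u u_fin]
  have u_leb: "u \<in> borel_measurable (lebesgue_on cube)"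
    using u(1) by (intro measurable_restrict_space1) (simp add: measurable_completion)
  have hu: "(\<lambda>x. h (u x) - h 0) \<in> borel_measurable (lebesgue_on cube)"
    using measurable_compose[OF u_leb internal_energy_measurable[OF h]] u(2) by (simp add: max_def)
  have J: "?J \<in> borel_measurable (lebesgue_on S)" by (rule differentiable_image_emeasure(2)[OF S(1) der inj])
  have \<rho>_S: "\<rho> \<in> borel_measurable (lebesgue_on S)"
    using \<rho>(1) by (intro measurable_restrict_space1) (simp add: measurable_completion)
  have \<Phi>': "\<Phi> x = ?J x * (h (max 0 (\<rho> x / ?J x)) - h 0)" if "x \<in> S" for x
    using det[OF that] \<rho>(2)[of x] by (simp add: \<Phi>_def max_def)
  have quot: "(\<lambda>x. \<rho> x / ?J x) \<in> borel_measurable (lebesgue_on S)" using \<rho>_S J by measurable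
  have "(\<lambda>x. ?J x * (h (max 0 (\<rho> x / ?J x)) - h 0)) \<in> borel_measurable (lebesgue_on S)"
    using measurable_compose[OF quot internal_energy_measurable[OF h]] J by measurable
  then show \<Phi>_meas: "\<Phi> \<in> borel_measurable (lebesgue_on S)"
    by (subst measurable_cong[of _ _ "\<lambda>x. ?J x * (h (max 0 (\<rho> x / ?J x)) - h 0)"]) (auto simp: space_restrict_space intro: \<Phi>')
  \<comment> \<open>Taken with \<open>c = 1\<close> and \<open>c = -1\<close>, one computation
    transports both parts.\<close>
  have sgn: "(\<integral>\<^sup>+y. ennreal (c * (h (u y) - h 0)) \<partial>lebesgue_on cube) = (\<integral>\<^sup>+x. ennreal (c * \<Phi> x) \<partial>lebesgue_on S)" for c
  proof -
    let ?F = "\<lambda>r. ennreal (c * (h (max 0 r) - h 0))"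
    have F: "?F \<in> borel_measurable borel" using internal_energy_measurable[OF h] by measurable
    have F0: "?F 0 = 0" by simp
    have "(\<integral>\<^sup>+y. ennreal (c * (h (u y) - h 0)) \<partial>lebesgue_on cube) = (\<integral>\<^sup>+y\<in>cube. ?F (u y) \<partial>lebesgue)"
      using cubeL u(2) by (simp add: nn_integral_restrict_space max_def)
    also have "\<dots> = (\<integral>\<^sup>+x. ?F (\<rho> x / ?J x) * ennreal (?J x) \<partial>lebesgue_on S)"
      by (rule nn_integral_density_change_of_variables[OF S(1) g der inj det u(1) F F0 J_eq u_out S(3)])
    also have "\<dots> = (\<integral>\<^sup>+x. ennreal (c * \<Phi> x) \<partial>lebesgue_on S)"
    proof (rule nn_integral_cong)
      fix x assume "x \<in> space (lebesgue_on S)"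
      then have x: "x \<in> S" by (simp add: space_restrict_space)
      show "?F (\<rho> x / ?J x) * ennreal (?J x) = ennreal (c * \<Phi> x)"
        using ennreal_mult'[OF less_imp_le[OF det[OF x]], of "c * (h (max 0 (\<rho> x / ?J x)) - h 0)"]
        by (simp add: \<Phi>'[OF x] mult_ac)
    qed
    finally show ?thesis .
  qed
  from sgn[of 1] sgn[of "-1"]
  have sgn1: "(\<integral>\<^sup>+y. ennreal (h (u y) - h 0) \<partial>lebesgue_on cube) = (\<integral>\<^sup>+x. ennreal (\<Phi> x) \<partial>lebesgue_on S)"
    and sgn2: "(\<integral>\<^sup>+y. ennreal (- (h (u y) - h 0)) \<partial>lebesgue_on cube) = (\<integral>\<^sup>+x. ennreal (- \<Phi> x) \<partial>lebesgue_on S)"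
    by simp_all
  show "(\<integral>\<^sup>+x. ennreal (- \<Phi> x) \<partial>lebesgue_on S) < \<infinity>" using ent(1) unfolding sgn2 .
  have iff: "integrable (lebesgue_on cube) (\<lambda>x. h (u x) - h 0) \<longleftrightarrow> integrable (lebesgue_on S) \<Phi>"
    unfolding real_integrable_def sgn1 sgn2 using hu \<Phi>_meas by blast
  have V_N: "(\<integral>x. indicator cube x * V x \<partial>density lborel (\<lambda>x. ennreal (u x))) = (\<integral>x. indicator cube (g x) * V (g x) \<partial>?\<mu>)"
  proof -
    have "(\<lambda>x. indicator cube x * V x) \<in> borel_measurable borel" by (rule cube_potential(1)[OF V])
    then show ?thesis unfolding push'[symmetric] using g\<mu> by (subst integral_distr) auto
  qed
  show "relative_entropy h V (\<lambda>x. enn2real (RN_deriv lborel N x))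
      = ereal (h 0 * measure lebesgue (cube :: (real^'n) set) + (\<integral>x. \<Phi> x \<partial>lebesgue_on S)
         + (\<integral>x. indicator cube (g x) * V (g x) \<partial>?\<mu>))" if i: "integrable (lebesgue_on S) \<Phi>"
  proof -
    have i': "integrable (lebesgue_on cube) (\<lambda>x. h (u x) - h 0)" using i iff by blast
    have "(\<integral>x. h (u x) - h 0 \<partial>lebesgue_on cube) = (\<integral>x. \<Phi> x \<partial>lebesgue_on S)"
      unfolding real_lebesgue_integral_def[OF i] real_lebesgue_integral_def[OF i'] sgn1 sgn2 ..
    then show ?thesis using ent(2)[OF i'] V_N unfolding u_def by simp
  qed
  show "relative_entropy h V (\<lambda>x. enn2real (RN_deriv lborel N x)) = \<infinity>" if "\<not> integrable (lebesgue_on S) \<Phi>"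
    using ent(3) that iff unfolding u_def by blast
qed

subsection \<open>Displacement convexity\<close>

text \<open>The range condition puts the gradients into the bounded cube, which supplies the bound
  that almost everywhere differentiability asks for.\<close>

lemma convex_gradient_structure:
  fixes t :: "real^'n \<Rightarrow> real^'n"
  assumes t: "t \<in> convex_gradients"
  shows "\<exists>E. E \<subseteq> cube \<and> negligible (cube - E) \<and> t ` E \<subseteq> cube \<and>
    (\<forall>x\<in>E. \<forall>y\<in>E. 0 \<le> (t x - t y) \<bullet> (x - y)) \<and>
    (\<forall>x\<in>E. \<exists>A. (t has_derivative A) (at x within E) \<and> (\<forall>u v. A u \<bullet> v = u \<bullet> A v) \<and> (\<forall>v. 0 \<le> A v \<bullet> v))"
proof -
  obtain \<phi> where \<phi>: "convex_on (closure cube) \<phi>" "\<And>x p. x \<in> cube \<Longrightarrow> GDERIV \<phi> x :> p \<Longrightarrow> p \<in> cube"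
    and ae: "AE x in lebesgue_on cube. GDERIV \<phi> x :> t x"
    using t unfolding convex_gradients_def convex_potentials_def by blast
  define D where "D = {x \<in> cube. GDERIV \<phi> x :> t x}"
  have DU: "D \<subseteq> cube" by (auto simp: D_def)
  have "AE x in lebesgue. x \<in> cube \<longrightarrow> GDERIV \<phi> x :> t x"
    using ae lmeasurable_cube by (subst (asm) AE_restrict_space_iff) auto
  then obtain N where N: "N \<in> null_sets lebesgue" "{x \<in> space lebesgue. \<not> (x \<in> cube \<longrightarrow> GDERIV \<phi> x :> t x)} \<subseteq> N"
    unfolding eventually_ae_filter by blast
  have "cube - D \<subseteq> N" using N(2) by (auto simp: D_def)
  then have neg: "negligible (cube - D)" using N(1) negligible_subset unfolding negligible_iff_null_sets[symmetric] by blast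
  have tD: "t x \<in> cube" if "x \<in> D" for x using \<phi>(2) that by (auto simp: D_def)
  have der: "GDERIV \<phi> x :> t x" if "x \<in> D" for x using that by (simp add: D_def)
  obtain E where E: "E \<subseteq> D" "negligible (cube - E)"
    "\<And>x y. x \<in> E \<Longrightarrow> y \<in> E \<Longrightarrow> 0 \<le> (t x - t y) \<bullet> (x - y)"
    "\<And>x. x \<in> E \<Longrightarrow> \<exists>A. (t has_derivative A) (at x within E) \<and> (\<forall>u v. A u \<bullet> v = u \<bullet> A v) \<and> (\<forall>v. 0 \<le> A v \<bullet> v)"
    using convex_gradient_differentiable_ae[OF open_cube closure_subset \<phi>(1) DU neg der norm_cube[OF tD]] by blast
  have "t ` E \<subseteq> cube" "E \<subseteq> cube" using E(1) DU tD by auto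
  then show ?thesis using E(2-4) by (intro exI[of _ E] conjI ballI)
qed

lemma absolutely_continuous_iff_density:
  assumes "sets N = sets (borel :: 'a::euclidean_space measure)"
  shows "(\<exists>u\<in>borel_measurable lborel. density lborel u = N) \<longleftrightarrow> absolutely_continuous lborel N"
proof
  assume "\<exists>u\<in>borel_measurable lborel. density lborel u = N"
  then show "absolutely_continuous lborel N" using absolutely_continuousI_density by blast
next
  assume "absolutely_continuous lborel N"
  then show "\<exists>u\<in>borel_measurable lborel. density lborel u = N"
    using sigma_finite_measure.Radon_Nikodym[OF lborel.sigma_finite_measure_axioms, of N] assms by simp
qed

text \<open>Guarantees that infinities of opposite sign never meet on the right-hand side of the
  convexity inequality.\<close>

lemma relative_entropy_RN_not_MInf:
  fixes N :: "(real^'n) measure"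
  assumes P: "pressure P" and h: "internal_energy P h" and V: "continuous_on (closure cube) V"
    and N: "finite_measure N" "absolutely_continuous lborel N" "sets N = sets borel"
  shows "relative_entropy h V (\<lambda>x. enn2real (RN_deriv lborel N x)) \<noteq> - \<infinity>"
proof -
  define u where "u x = enn2real (RN_deriv lborel N x)" for x
  have push: "N = density lborel (\<lambda>x. ennreal (u x))"
    unfolding u_def using finite_density_RN_deriv[OF N] by simp
  have u: "u \<in> borel_measurable borel" "\<And>x. 0 \<le> u x"
    unfolding u_def using borel_measurable_RN_deriv[of lborel N] by (auto intro: borel_measurable_enn2real)
  have "(\<integral>\<^sup>+x. ennreal (u x) \<partial>lborel) = emeasure N UNIV"
    unfolding push using u(1) by (subst emeasure_density) auto
  also have "\<dots> < \<infinity>" using finite_measure.emeasure_finite[OF N(1), of UNIV] by (simp add: less_top)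
  finally have fin: "(\<integral>\<^sup>+x. ennreal (u x) \<partial>lborel) < \<infinity>" .
  note ent = relative_entropy_cases[OF P h V u fin]
  have "relative_entropy h V u \<noteq> - \<infinity>"
    by (cases "integrable (lebesgue_on cube) (\<lambda>x. h (u x) - h 0)") (simp_all add: ent(2,3))
  then show ?thesis unfolding u_def .
qed

text \<open>If the push-forward has a density, Sard's theorem excludes a degenerate derivative on a set of positive mass.\<close>

lemma nondegenerate_ae:
  fixes t :: "real^'n \<Rightarrow> real^'n" and \<rho> :: "real^'n \<Rightarrow> real"
  assumes t: "t \<in> borel_measurable borel" and \<rho>: "\<rho> \<in> borel_measurable borel" "\<And>x. 0 \<le> \<rho> x"
    and der: "\<And>x. x \<in> E \<Longrightarrow> (t has_derivative A x) (at x within E)"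
    and ac: "absolutely_continuous lborel (distr (density lborel (\<lambda>x. ennreal (\<rho> x))) borel t)"
  obtains N where "N \<in> sets borel" "\<And>x. x \<in> E \<Longrightarrow> t x \<notin> N \<Longrightarrow> det (matrix (A x)) \<noteq> 0"
    "AE x in lborel. t x \<in> N \<longrightarrow> \<rho> x = 0"
proof -
  let ?\<mu> = "density lborel (\<lambda>x. ennreal (\<rho> x))"
  let ?Z = "{x \<in> E. det (matrix (A x)) = 0}"
  have "negligible (t ` ?Z)"
    by (rule negligible_image_det_zero[where g' = A]) (auto intro: has_derivative_subset[OF der])
  \<comment> \<open>The image of the degenerate points need not be Borel; it is enclosed in a Borel
    null set, and points are later discarded according to whether \<open>t\<close> maps them into
    it.\<close>
  then obtain N where N: "N \<in> null_sets lborel" "t ` ?Z \<subseteq> N"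
    unfolding negligible_iff_null_sets null_sets_completion_iff2 by blast
  then have NB: "N \<in> sets borel" by auto
  have "N \<in> null_sets (distr ?\<mu> borel t)" using ac N(1) by (auto simp: absolutely_continuous_def)
  then have "emeasure ?\<mu> (t -` N) = 0"
    using t NB by (auto simp: null_sets_def emeasure_distr)
  then have "(\<integral>\<^sup>+x. ennreal (\<rho> x) * indicator (t -` N) x \<partial>lborel) = 0"
    using \<rho>(1) measurable_sets[OF t NB] by (subst (asm) emeasure_density) auto
  then have "AE x in lborel. ennreal (\<rho> x) * indicator (t -` N) x = 0"
    using \<rho>(1) measurable_sets[OF t NB] by (subst (asm) nn_integral_0_iff_AE) auto
  then have "AE x in lborel. t x \<in> N \<longrightarrow> \<rho> x = 0"
    by eventually_elim (use \<rho>(2) in \<open>auto simp: indicator_def ennreal_eq_0_iff intro: antisym\<close>)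
  then show ?thesis using that[OF NB] N(2) by blast
qed

lemma linear_det_surj:
  fixes A :: "real^'n \<Rightarrow> real^'n"
  assumes "linear A" "det (matrix A) \<noteq> 0" shows "surj A"
  using assms det_nz_iff_inj linear_injective_imp_surjective by blast

lemma displacement_convexity:
  fixes P h :: "real \<Rightarrow> real" and V \<rho> :: "real^'n \<Rightarrow> real" and t0 t1 :: "real^'n \<Rightarrow> real^'n"
  assumes P: "pressure P" and h: "internal_energy P h" and McC: "McCann_condition CARD('n) P"
    and V: "smooth_on (closure cube) V"
    and hess: "\<And>x \<xi>. x \<in> cube \<Longrightarrow> lam * (\<xi> \<bullet> \<xi>) \<le> \<xi> \<bullet> (hessian V x *v \<xi>)"
    and \<rho>: "\<rho> \<in> borel_measurable borel" "\<And>x. 0 \<le> \<rho> x" and fin: "(\<integral>\<^sup>+x. ennreal (\<rho> x) \<partial>lborel) < \<infinity>"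
    and supp: "AE x in lborel. x \<notin> cube \<longrightarrow> \<rho> x = 0"
    and t: "t0 \<in> convex_gradients" "t1 \<in> convex_gradients" and s: "0 < s" "s < 1"
  defines "\<mu> \<equiv> density lborel (\<lambda>x. ennreal (\<rho> x))"
    and "ts \<equiv> \<lambda>x. (1 - s) *\<^sub>R t0 x + s *\<^sub>R t1 x"
    and "ent \<equiv> \<lambda>t. relative_entropy h V (\<lambda>x. enn2real (RN_deriv lborel (distr (density lborel (\<lambda>x. ennreal (\<rho> x))) borel t) x))"
  assumes ac: "absolutely_continuous lborel (distr \<mu> borel t0)" "absolutely_continuous lborel (distr \<mu> borel t1)"
  shows "absolutely_continuous lborel (distr \<mu> borel ts)"
    and "ent ts \<le> ereal (1 - s) * ent t0 + ereal s * ent t1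
      - ereal (lam / 2 * s * (1 - s) * (\<integral>x. (norm (t1 x - t0 x))\<^sup>2 \<partial>\<mu>))"
proof -
  have Vc: "continuous_on (closure cube) V" using V unfolding smooth_on_def by (metis Ck_on.simps(1))
  have tm: "t0 \<in> borel_measurable borel" "t1 \<in> borel_measurable borel" using t by (auto simp: convex_gradients_def)
  have tsm: "ts \<in> borel_measurable borel" unfolding ts_def using tm by measurable
  from convex_gradient_structure[OF t(1)] obtain E0 where e0: "E0 \<subseteq> cube \<and> negligible (cube - E0) \<and> t0 ` E0 \<subseteq> cube \<and>
    (\<forall>x\<in>E0. \<forall>y\<in>E0. 0 \<le> (t0 x - t0 y) \<bullet> (x - y)) \<and>
    (\<forall>x\<in>E0. \<exists>A. (t0 has_derivative A) (at x within E0) \<and> (\<forall>u v. A u \<bullet> v = u \<bullet> A v) \<and> (\<forall>v. 0 \<le> A v \<bullet> v))" ..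
  note E0 = conjunct1[OF e0] conjunct2[OF e0, THEN conjunct1] conjunct2[OF e0, THEN conjunct2, THEN conjunct1]
    bspec[OF bspec[OF conjunct2[OF e0, THEN conjunct2, THEN conjunct2, THEN conjunct1]]]
    conjunct2[OF e0, THEN conjunct2, THEN conjunct2, THEN conjunct2]
  from convex_gradient_structure[OF t(2)] obtain E1 where e1: "E1 \<subseteq> cube \<and> negligible (cube - E1) \<and> t1 ` E1 \<subseteq> cube \<and>
    (\<forall>x\<in>E1. \<forall>y\<in>E1. 0 \<le> (t1 x - t1 y) \<bullet> (x - y)) \<and>
    (\<forall>x\<in>E1. \<exists>A. (t1 has_derivative A) (at x within E1) \<and> (\<forall>u v. A u \<bullet> v = u \<bullet> A v) \<and> (\<forall>v. 0 \<le> A v \<bullet> v))" ..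
  note E1 = conjunct1[OF e1] conjunct2[OF e1, THEN conjunct1] conjunct2[OF e1, THEN conjunct2, THEN conjunct1]
    bspec[OF bspec[OF conjunct2[OF e1, THEN conjunct2, THEN conjunct2, THEN conjunct1]]]
    conjunct2[OF e1, THEN conjunct2, THEN conjunct2, THEN conjunct2]
  \<comment> \<open>The two derivatives are taken within different sets; on the intersection, still
    of full measure, they can be added.\<close>
  define E where "E = E0 \<inter> E1"
  have E: "E \<subseteq> E0" "E \<subseteq> E1" "E \<subseteq> cube" using E0(1) by (auto simp: E_def)
  have "cube - E = (cube - E0) \<union> (cube - E1)" by (auto simp: E_def)
  then have negE: "negligible (cube - E)" using E0(2) E1(2) by (simp add: negligible_Un)
  from bchoice[OF E0(5)] obtain A0 where
    cA0: "\<forall>x\<in>E0. (t0 has_derivative A0 x) (at x within E0) \<and> (\<forall>u v. A0 x u \<bullet> v = u \<bullet> A0 x v) \<and> (\<forall>v. 0 \<le> A0 x v \<bullet> v)" ..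
  have A0: "(t0 has_derivative A0 x) (at x within E)" "\<And>u v. A0 x u \<bullet> v = u \<bullet> A0 x v" "\<And>v. 0 \<le> A0 x v \<bullet> v" if "x \<in> E" for x
  proof -
    have x: "(t0 has_derivative A0 x) (at x within E0) \<and> (\<forall>u v. A0 x u \<bullet> v = u \<bullet> A0 x v) \<and> (\<forall>v. 0 \<le> A0 x v \<bullet> v)"
      using that E by (intro bspec[OF cA0]) auto
    show "(t0 has_derivative A0 x) (at x within E)"
      using conjunct1[OF x] by (rule has_derivative_subset) (use E in auto)
    show "\<And>u v. A0 x u \<bullet> v = u \<bullet> A0 x v" "\<And>v. 0 \<le> A0 x v \<bullet> v" using conjunct2[OF x] by auto
  qed
  from bchoice[OF E1(5)] obtain A1 where
    cA1: "\<forall>x\<in>E1. (t1 has_derivative A1 x) (at x within E1) \<and> (\<forall>u v. A1 x u \<bullet> v = u \<bullet> A1 x v) \<and> (\<forall>v. 0 \<le> A1 x v \<bullet> v)" ..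
  have A1: "(t1 has_derivative A1 x) (at x within E)" "\<And>u v. A1 x u \<bullet> v = u \<bullet> A1 x v" "\<And>v. 0 \<le> A1 x v \<bullet> v" if "x \<in> E" for x
  proof -
    have x: "(t1 has_derivative A1 x) (at x within E1) \<and> (\<forall>u v. A1 x u \<bullet> v = u \<bullet> A1 x v) \<and> (\<forall>v. 0 \<le> A1 x v \<bullet> v)"
      using that E by (intro bspec[OF cA1]) auto
    show "(t1 has_derivative A1 x) (at x within E)"
      using conjunct1[OF x] by (rule has_derivative_subset) (use E in auto)
    show "\<And>u v. A1 x u \<bullet> v = u \<bullet> A1 x v" "\<And>v. 0 \<le> A1 x v \<bullet> v" using conjunct2[OF x] by auto
  qed
  define As where "As x v = (1 - s) *\<^sub>R A0 x v + s *\<^sub>R A1 x v" for x v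
  have As: "(ts has_derivative As x) (at x within E)" if "x \<in> E" for x
    unfolding ts_def As_def by (intro derivative_intros A0(1) A1(1) that)
  obtain N0 where N0: "N0 \<in> sets borel" "\<And>x. x \<in> E \<Longrightarrow> t0 x \<notin> N0 \<Longrightarrow> det (matrix (A0 x)) \<noteq> 0"
    "AE x in lborel. t0 x \<in> N0 \<longrightarrow> \<rho> x = 0"
    using nondegenerate_ae[OF tm(1) \<rho> A0(1) ac(1)[unfolded \<mu>_def]] by blast
  obtain N1 where N1: "N1 \<in> sets borel" "\<And>x. x \<in> E \<Longrightarrow> t1 x \<notin> N1 \<Longrightarrow> det (matrix (A1 x)) \<noteq> 0"
    "AE x in lborel. t1 x \<in> N1 \<longrightarrow> \<rho> x = 0"
    using nondegenerate_ae[OF tm(2) \<rho> A1(1) ac(2)[unfolded \<mu>_def]] by blast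
  \<comment> \<open>Discarding points through the Borel sets \<open>N0\<close> and
    \<open>N1\<close>, rather than through a vanishing determinant, makes \<open>S\<close> visibly
    measurable.\<close>
  define S where "S = {x \<in> E. t0 x \<notin> N0 \<and> t1 x \<notin> N1}"
  have SE: "S \<subseteq> E" "S \<subseteq> cube" using E by (auto simp: S_def)
  have Sleb: "S \<in> sets lebesgue"
  proof -
    have "E = cube - (cube - E)" using E by auto
    moreover have "cube - (cube - E) \<in> sets lebesgue"
      using lmeasurable_cube by (intro sets.Diff[OF _ negligible_imp_sets[OF negE]]) auto
    ultimately have "E \<in> sets lebesgue" by simp
    moreover have "t0 -` N0 \<in> sets lebesgue" "t1 -` N1 \<in> sets lebesgue"
      using measurable_sets[OF tm(1) N0(1)] measurable_sets[OF tm(2) N1(1)] by auto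
    moreover have "S = E - t0 -` N0 - t1 -` N1" by (auto simp: S_def)
    ultimately show ?thesis by (metis sets.Diff)
  qed
  have supp_S: "AE x in lebesgue. x \<notin> S \<longrightarrow> \<rho> x = 0"
  proof -
    have "AE x in lebesgue. x \<notin> cube - E" using negE unfolding negligible_iff_null_sets by (rule AE_not_in)
    with AE_completion[OF supp] AE_completion[OF N0(3)] AE_completion[OF N1(3)]
    show ?thesis by eventually_elim (auto simp: S_def)
  qed
  have lin: "linear (A0 x)" "linear (A1 x)" "linear (As x)" if "x \<in> E" for x
    using A0(1)[OF that] A1(1)[OF that] As[OF that] by (simp_all only: has_derivative_linear)
  have mink: "0 < det (matrix (A0 x))" "0 < det (matrix (A1 x))" "0 < det (matrix (As x))"
    "(1 - s) * det (matrix (A0 x)) powr (1 / CARD('n)) + s * det (matrix (A1 x)) powr (1 / CARD('n)) \<le> det (matrix (As x)) powr (1 / CARD('n))"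
    if x: "x \<in> S" for x
  proof -
    have xE: "x \<in> E" using x SE by blast
    have mv: "matrix (A0 x) *v v = A0 x v" "matrix (A1 x) *v v = A1 x v" for v
      using lin[OF xE] by (simp_all add: matrix_works)
    have eq: "matrix (As x) = (1 - s) *\<^sub>R matrix (A0 x) + s *\<^sub>R matrix (A1 x)"
      by (simp add: matrix_def As_def vec_eq_iff)
    have d: "det (matrix (A0 x)) \<noteq> 0" "det (matrix (A1 x)) \<noteq> 0" using N0(2) N1(2) x by (auto simp: S_def)
    have sym: "v \<bullet> (matrix (A0 x) *v w) = w \<bullet> (matrix (A0 x) *v v)" "v \<bullet> (matrix (A1 x) *v w) = w \<bullet> (matrix (A1 x) *v v)" for v w
      unfolding mv using A0(2)[OF xE, of v w] A1(2)[OF xE, of v w] by (simp_all add: inner_commute)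
    have nn: "0 \<le> v \<bullet> (matrix (A0 x) *v v)" "0 \<le> v \<bullet> (matrix (A1 x) *v v)" for v
      unfolding mv using A0(3)[OF xE, of v] A1(3)[OF xE, of v] by (simp_all add: inner_commute)
    note M = Minkowski_det[OF sym(1) nn(1) d(1) sym(2) nn(2) d(2) s eq]
    show "0 < det (matrix (A0 x))" "0 < det (matrix (A1 x))" "0 < det (matrix (As x))"
      "(1 - s) * det (matrix (A0 x)) powr (1 / CARD('n)) + s * det (matrix (A1 x)) powr (1 / CARD('n)) \<le> det (matrix (As x)) powr (1 / CARD('n))"
      using M by auto
  qed
  have mono0: "0 \<le> (t0 x - t0 y) \<bullet> (x - y)" and mono1: "0 \<le> (t1 x - t1 y) \<bullet> (x - y)" if "x \<in> E" "y \<in> E" for x y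
    using E0(4)[of x y] E1(4)[of x y] that subsetD[OF E(1)] subsetD[OF E(2)] by simp_all
  have mono_s: "0 \<le> (ts x - ts y) \<bullet> (x - y)" if "x \<in> E" "y \<in> E" for x y
  proof -
    have "(ts x - ts y) \<bullet> (x - y) = (1 - s) * ((t0 x - t0 y) \<bullet> (x - y)) + s * ((t1 x - t1 y) \<bullet> (x - y))"
      by (simp add: ts_def inner_diff_left inner_diff_right inner_add_left algebra_simps)
    then show ?thesis using mono0[OF that] mono1[OF that] s by simp
  qed
  \<comment> \<open>Blow-up needs a set of full Lebesgue measure in the cube, so monotonicity and
    derivatives refer to \<open>E\<close>; \<open>S\<close> is only known to carry almost all the
    mass of \<open>\<rho>\<close>.\<close>
  have inj: "inj_on g S" if m: "\<And>x y. x \<in> E \<Longrightarrow> y \<in> E \<Longrightarrow> 0 \<le> (g x - g y) \<bullet> (x - y)"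
      and d: "\<And>x. x \<in> E \<Longrightarrow> (g has_derivative g' x) (at x within E)"
      and det: "\<And>x. x \<in> S \<Longrightarrow> 0 < det (matrix (g' x))" for g g'
  proof (rule inj_onI)
    fix x y assume xy: "x \<in> S" "y \<in> S" "g x = g y"
    then have xE: "x \<in> E" "y \<in> E" using SE by auto
    have "surj (g' x)"
      using det[OF xy(1)] has_derivative_linear[OF d[OF xE(1)]] by (intro linear_det_surj) auto
    then have "y = x"
      using monotone_derivative_injective[OF open_cube _ negE m d[OF xE(1)] _ xE(2)] xE(1) E(3) xy(3) by auto
    then show "x = y" by simp
  qed
  have derS: "(g has_derivative g' x) (at x within S)" if "\<And>x. x \<in> E \<Longrightarrow> (g has_derivative g' x) (at x within E)" "x \<in> S" for g g' x
    using that(1)[of x] that(2) SE by (auto intro: has_derivative_subset)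
  have img: "t0 x \<in> cube" "t1 x \<in> cube" "ts x \<in> cube" if "x \<in> S" for x
  proof -
    show "t0 x \<in> cube" "t1 x \<in> cube" using that SE E E0(3) E1(3) by blast+
    then show "ts x \<in> cube" unfolding ts_def using s by (intro convexD_alt[OF convex_cube]) auto
  qed
  have sub: "t0 ` S \<subseteq> cube" "t1 ` S \<subseteq> cube" "ts ` S \<subseteq> cube" using img by auto
  define \<Phi> where "\<Phi> A x = det (matrix (A x)) * (h (\<rho> x / det (matrix (A x))) - h 0)" for A :: "real^'n \<Rightarrow> real^'n \<Rightarrow> real^'n" and x
  have der0: "\<forall>x\<in>S. (t0 has_derivative A0 x) (at x within S)" and der1: "\<forall>x\<in>S. (t1 has_derivative A1 x) (at x within S)"
    and ders: "\<forall>x\<in>S. (ts has_derivative As x) (at x within S)"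
    by (intro ballI derS[OF A0(1)] derS[OF A1(1)] derS[OF As]; assumption)+
  have inj0: "inj_on t0 S" by (rule inj[OF mono0 A0(1) mink(1)])
  have inj1: "inj_on t1 S" by (rule inj[OF mono1 A1(1) mink(2)])
  have injs: "inj_on ts S" by (rule inj[OF mono_s As mink(3)])
  have det_pos: "\<forall>x\<in>S. 0 < det (matrix (A0 x))" "\<forall>x\<in>S. 0 < det (matrix (A1 x))" "\<forall>x\<in>S. 0 < det (matrix (As x))"
    using mink(1-3) by auto
  note e0 = entropy_of_push_forward[OF P h Vc Sleb SE(2) sub(1) tm(1) der0 inj0 det_pos(1) \<rho> fin supp_S, folded \<Phi>_def \<mu>_def]
  note e1 = entropy_of_push_forward[OF P h Vc Sleb SE(2) sub(2) tm(2) der1 inj1 det_pos(2) \<rho> fin supp_S, folded \<Phi>_def \<mu>_def]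
  note es = entropy_of_push_forward[OF P h Vc Sleb SE(2) sub(3) tsm ders injs det_pos(3) \<rho> fin supp_S, folded \<Phi>_def \<mu>_def]
  have ent': "ent t = relative_entropy h V (\<lambda>x. enn2real (RN_deriv lborel (distr \<mu> borel t) x))" for t
    by (simp add: ent_def \<mu>_def)
  show "absolutely_continuous lborel (distr \<mu> borel ts)" by (rule es(1))
  have fin\<mu>: "finite_measure \<mu>"
  proof (rule finite_measureI)
    have "emeasure \<mu> (space \<mu>) = (\<integral>\<^sup>+x. ennreal (\<rho> x) \<partial>lborel)"
      unfolding \<mu>_def using \<rho>(1) by (subst emeasure_density) auto
    then show "emeasure \<mu> (space \<mu>) \<noteq> \<infinity>" using fin by simp
  qed
  let ?I = "\<integral>x. (norm (t1 x - t0 x))\<^sup>2 \<partial>\<mu>"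
  have not_MInf: "ent t \<noteq> - \<infinity>" if "t \<in> borel_measurable borel" "absolutely_continuous lborel (distr \<mu> borel t)" for t
  proof -
    have "finite_measure (distr \<mu> borel t)"
      by (rule finite_measure.finite_measure_distr[OF fin\<mu>]) (use that in \<open>simp add: \<mu>_def\<close>)
    then show ?thesis unfolding ent' by (intro relative_entropy_RN_not_MInf[OF P h Vc]) (use that in auto)
  qed
  show "ent ts \<le> ereal (1 - s) * ent t0 + ereal s * ent t1 - ereal (lam / 2 * s * (1 - s) * ?I)"
  proof (cases "integrable (lebesgue_on S) (\<Phi> A0) \<and> integrable (lebesgue_on S) (\<Phi> A1)")
    case False
    then have "ent t0 = \<infinity> \<or> ent t1 = \<infinity>" using e0(5) e1(5) unfolding ent' by blast
    moreover have "ent t0 \<noteq> - \<infinity>" "ent t1 \<noteq> - \<infinity>" using not_MInf tm ac by auto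
    \<comment> \<open>Both weights are positive and neither entropy is minus infinity, so a single
      infinite term makes the whole side infinite.\<close>
    ultimately have "ereal (1 - s) * ent t0 + ereal s * ent t1 - ereal (lam / 2 * s * (1 - s) * ?I) = \<infinity>"
      using s by (cases "ent t0"; cases "ent t1") auto
    then show ?thesis by simp
  next
    case True
    have le: "\<Phi> As x \<le> (1 - s) * \<Phi> A0 x + s * \<Phi> A1 x" if x: "x \<in> S" for x
    \<comment> \<open>Where \<open>\<rho>\<close> vanishes, all three integrands are a multiple of
      \<open>h 0 - h 0\<close>; the rescaling by the root of \<open>\<rho>\<close> requires a
      positive value.\<close>
    proof (cases "\<rho> x = 0")
      case False
      then have "0 < \<rho> x" using \<rho>(2)[of x] by simp
      then show ?thesis unfolding \<Phi>_def
        using energy_of_Jacobian_le[OF P h zero_less_card_finite McC s] mink[OF x] by blast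
    qed (simp add: \<Phi>_def)
    have int_comb: "integrable (lebesgue_on S) (\<lambda>x. (1 - s) * \<Phi> A0 x + s * \<Phi> A1 x)"
      using True by (intro Bochner_Integration.integrable_add integrable_mult_right) auto
    have "(\<integral>\<^sup>+x. ennreal (\<Phi> As x) \<partial>lebesgue_on S) \<le> (\<integral>\<^sup>+x. ennreal ((1 - s) * \<Phi> A0 x + s * \<Phi> A1 x) \<partial>lebesgue_on S)"
      by (intro nn_integral_mono ennreal_leI le) (simp add: space_restrict_space)
    also have "\<dots> < \<infinity>" using int_comb unfolding real_integrable_def by (simp add: less_top)
    \<comment> \<open>The positive part is dominated by the convex combination, the negative part is
      finite by the general lower bound on the internal energy.\<close>
    finally have int_s: "integrable (lebesgue_on S) (\<Phi> As)"
      using es(2,3) unfolding real_integrable_def by (simp add: less_top)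
    have "(\<integral>x. \<Phi> As x \<partial>lebesgue_on S) \<le> (\<integral>x. (1 - s) * \<Phi> A0 x + s * \<Phi> A1 x \<partial>lebesgue_on S)"
      by (intro integral_mono int_s int_comb le) (simp add: space_restrict_space)
    then have \<Phi>_le: "(\<integral>x. \<Phi> As x \<partial>lebesgue_on S) \<le> (1 - s) * (\<integral>x. \<Phi> A0 x \<partial>lebesgue_on S) + s * (\<integral>x. \<Phi> A1 x \<partial>lebesgue_on S)"
      using True by simp
    define V' where "V' y = indicator cube y * V y" for y
    have V'm: "V' \<in> borel_measurable borel" unfolding V'_def by (rule cube_potential(1)[OF Vc])
    obtain B where V'_le: "\<And>y. \<bar>V' y\<bar> \<le> B" using cube_potential(2)[OF Vc] unfolding V'_def by blast
    have V'_int: "integrable \<mu> (\<lambda>x. V' (g x))" if "g \<in> borel_measurable borel" for g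
      by (rule finite_measure.integrable_const_bound[OF fin\<mu>, of _ B])
        (use V'_le measurable_compose[OF that V'm] in \<open>auto simp: \<mu>_def\<close>)
    have aeS: "AE x in \<mu>. x \<in> S"
    proof -
      have "AE x in lborel. x \<notin> S \<longrightarrow> \<rho> x = 0" using supp_S by (simp add: AE_completion_iff)
      then have "AE x in lborel. 0 < ennreal (\<rho> x) \<longrightarrow> x \<in> S" by eventually_elim auto
      then show ?thesis unfolding \<mu>_def using \<rho>(1) by (subst AE_density) auto
    qed
    have dist_int: "integrable \<mu> (\<lambda>x. (norm (t1 x - t0 x))\<^sup>2)"
    proof (rule finite_measure.integrable_const_bound[OF fin\<mu>, of _ "(2 * real CARD('n))\<^sup>2"])
      show "AE x in \<mu>. norm ((norm (t1 x - t0 x))\<^sup>2) \<le> (2 * real CARD('n))\<^sup>2"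
        using aeS
      proof eventually_elim
        fix x assume "x \<in> S"
        then have "norm (t1 x - t0 x) \<le> 2 * real CARD('n)"
          using norm_cube[OF img(1)] norm_cube[OF img(2)] norm_triangle_ineq4[of "t1 x" "t0 x"] by fastforce
        then have "(norm (t1 x - t0 x))\<^sup>2 \<le> (2 * real CARD('n))\<^sup>2" by (intro power_mono) auto
        then show "norm ((norm (t1 x - t0 x))\<^sup>2) \<le> (2 * real CARD('n))\<^sup>2" by simp
      qed
      show "(\<lambda>x. (norm (t1 x - t0 x))\<^sup>2) \<in> borel_measurable \<mu>" unfolding \<mu>_def using tm by measurable
    qed
    have V_le: "(\<integral>x. V' (ts x) \<partial>\<mu>) \<le> (1 - s) * (\<integral>x. V' (t0 x) \<partial>\<mu>) + s * (\<integral>x. V' (t1 x) \<partial>\<mu>) - lam / 2 * s * (1 - s) * ?I"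
    proof -
      have "(\<integral>x. V' (ts x) \<partial>\<mu>) \<le> (\<integral>x. (1 - s) * V' (t0 x) + s * V' (t1 x) - lam / 2 * s * (1 - s) * (norm (t1 x - t0 x))\<^sup>2 \<partial>\<mu>)"
      proof (rule integral_mono_AE)
        show "integrable \<mu> (\<lambda>x. V' (ts x))" by (rule V'_int[OF tsm])
        show "integrable \<mu> (\<lambda>x. (1 - s) * V' (t0 x) + s * V' (t1 x) - lam / 2 * s * (1 - s) * (norm (t1 x - t0 x))\<^sup>2)"
          by (intro Bochner_Integration.integrable_diff Bochner_Integration.integrable_add integrable_mult_right V'_int tm dist_int)
        show "AE x in \<mu>. V' (ts x) \<le> (1 - s) * V' (t0 x) + s * V' (t1 x) - lam / 2 * s * (1 - s) * (norm (t1 x - t0 x))\<^sup>2"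
          using aeS
        proof eventually_elim
          fix x assume x: "x \<in> S"
          then show "V' (ts x) \<le> (1 - s) * V' (t0 x) + s * V' (t1 x) - lam / 2 * s * (1 - s) * (norm (t1 x - t0 x))\<^sup>2"
            using hessian_convex_along_segments[OF V hess img(1,2)[OF x], of s] img[OF x] s by (simp add: V'_def ts_def)
        qed
      qed
      also have "\<dots> = (1 - s) * (\<integral>x. V' (t0 x) \<partial>\<mu>) + s * (\<integral>x. V' (t1 x) \<partial>\<mu>) - lam / 2 * s * (1 - s) * ?I"
        using V'_int[OF tm(1)] V'_int[OF tm(2)] dist_int by simp
      finally show ?thesis .
    qed
    have combine: "k + F + W \<le> (1 - s) * (k + F0 + W0) + s * (k + F1 + W1) - L"
      if "F \<le> (1 - s) * F0 + s * F1" "W \<le> (1 - s) * W0 + s * W1 - L" for k F W F0 W0 F1 W1 L :: real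
      using that by (simp add: algebra_simps)
    let ?k = "h 0 * measure lebesgue (cube :: (real^'n) set)"
    have "ent t0 = ereal (?k + (\<integral>x. \<Phi> A0 x \<partial>lebesgue_on S) + (\<integral>x. V' (t0 x) \<partial>\<mu>))"
      "ent t1 = ereal (?k + (\<integral>x. \<Phi> A1 x \<partial>lebesgue_on S) + (\<integral>x. V' (t1 x) \<partial>\<mu>))"
      "ent ts = ereal (?k + (\<integral>x. \<Phi> As x \<partial>lebesgue_on S) + (\<integral>x. V' (ts x) \<partial>\<mu>))"
      unfolding ent' V'_def using e0(4) e1(4) es(4) True int_s by blast+
    moreover have "?k + (\<integral>x. \<Phi> As x \<partial>lebesgue_on S) + (\<integral>x. V' (ts x) \<partial>\<mu>)
       \<le> (1 - s) * (?k + (\<integral>x. \<Phi> A0 x \<partial>lebesgue_on S) + (\<integral>x. V' (t0 x) \<partial>\<mu>))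
        + s * (?k + (\<integral>x. \<Phi> A1 x \<partial>lebesgue_on S) + (\<integral>x. V' (t1 x) \<partial>\<mu>)) - lam / 2 * s * (1 - s) * ?I"
      by (rule combine[OF \<Phi>_le V_le])
    ultimately show ?thesis by simp
  qed
qed

theorem proposition4:
  fixes P h :: "real \<Rightarrow> real"
    and V ubar :: "real ^ 'n \<Rightarrow> real"
    and M lam s :: real
    and T t\<^sub>0 t\<^sub>1 :: "real ^ 'n \<Rightarrow> real ^ 'n"
  assumes "pressure P"
    and "internal_energy P h"
    and "McCann_condition CARD('n) P"
    and "smooth_on (closure cube) V"
    and "\<forall>x\<in>cube. 0 < ubar x"
    and "has_bochner_integral (lebesgue_on cube) ubar M"
    and "\<forall>x\<in>cube. \<forall>\<xi>. lam * (\<xi> \<bullet> \<xi>) \<le> \<xi> \<bullet> (hessian V x *v \<xi>)"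
    and "T \<in> Diff_plus"
    and "t\<^sub>0 \<in> convex_gradients"
    and "t\<^sub>1 \<in> convex_gradients"
    and "0 \<le> s" and "s \<le> 1"
  shows "map_entropy h V ubar ((\<lambda>x. (1 - s) *\<^sub>R t\<^sub>0 x + s *\<^sub>R t\<^sub>1 x) \<circ> T)
    \<le> ereal (1 - s) * map_entropy h V ubar (t\<^sub>0 \<circ> T) + ereal s * map_entropy h V ubar (t\<^sub>1 \<circ> T)
      - ereal (lam / 2 * s * (1 - s) * (\<integral>x. (norm (t\<^sub>1 x - t\<^sub>0 x))\<^sup>2 \<partial>(push_forward ubar T)))"
proof -
  note P = assms(1) and h = assms(2) and McC = assms(3) and V = assms(4)
  have hess: "\<And>x \<xi>. x \<in> cube \<Longrightarrow> lam * (\<xi> \<bullet> \<xi>) \<le> \<xi> \<bullet> (hessian V x *v \<xi>)" using assms(7) by blast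
  note pf = push_forward_facts[OF assms(8,6,5)]
  define \<mu> where "\<mu> = push_forward ubar T"
  \<comment> \<open>From here on \<open>T\<close> and \<open>ubar\<close> enter only through
    \<open>\<mu>\<close> and this Borel density.\<close>
  define \<rho> where "\<rho> x = enn2real (RN_deriv lborel \<mu> x)" for x
  have \<mu>: "\<mu> = density lborel (\<lambda>x. ennreal (\<rho> x))"
    unfolding \<rho>_def \<mu>_def using finite_density_RN_deriv[OF pf(2,3,1)] by simp
  have \<rho>: "\<rho> \<in> borel_measurable borel" "\<And>x. 0 \<le> \<rho> x"
    unfolding \<rho>_def using borel_measurable_RN_deriv[of lborel \<mu>] by (auto intro: borel_measurable_enn2real)
  have fin: "(\<integral>\<^sup>+x. ennreal (\<rho> x) \<partial>lborel) < \<infinity>"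
  proof -
    have "(\<integral>\<^sup>+x. ennreal (\<rho> x) \<partial>lborel) = emeasure \<mu> UNIV"
      unfolding \<mu> using \<rho>(1) by (subst emeasure_density) auto
    also have "\<dots> < \<infinity>" using finite_measure.emeasure_finite[OF pf(2), of UNIV] by (simp add: less_top \<mu>_def)
    finally show ?thesis .
  qed
  have supp: "AE x in lborel. x \<notin> cube \<longrightarrow> \<rho> x = 0"
  proof -
    have cB: "- cube \<in> sets (borel :: (real^'n) measure)"
      using sets.compl_sets[OF sets_cube] by (simp add: Compl_eq_Diff_UNIV)
    have "emeasure \<mu> (- cube) = 0" using pf(4) by (simp add: \<mu>_def)
    then have "(\<integral>\<^sup>+x. ennreal (\<rho> x) * indicator (- cube) x \<partial>lborel) = 0"
      unfolding \<mu> using \<rho>(1) cB by (subst (asm) emeasure_density) auto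
    then have "AE x in lborel. ennreal (\<rho> x) * indicator (- cube) x = 0"
      using \<rho>(1) cB by (subst (asm) nn_integral_0_iff_AE) auto
    then show ?thesis
      by eventually_elim (use \<rho>(2) in \<open>auto simp: indicator_def ennreal_eq_0_iff intro: antisym\<close>)
  qed
  let ?ent = "\<lambda>t. relative_entropy h V (\<lambda>x. enn2real (RN_deriv lborel (distr (density lborel (\<lambda>x. ennreal (\<rho> x))) borel t) x))"
  have ent: "map_entropy h V ubar (t \<circ> T) = (if absolutely_continuous lborel (distr \<mu> borel t) then ?ent t else \<infinity>)"
    if "t \<in> borel_measurable borel" for t
  proof -
    have "push_forward ubar (t \<circ> T) = distr \<mu> borel t" using pf(5)[OF that] by (simp add: \<mu>_def)
    moreover have "sets (distr \<mu> borel t) = sets borel" by simp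
    ultimately show ?thesis
      unfolding map_entropy_def \<mu>[symmetric] by (simp only: absolutely_continuous_iff_density)
  qed
  have tm: "t\<^sub>0 \<in> borel_measurable borel" "t\<^sub>1 \<in> borel_measurable borel" using assms(9,10) by (auto simp: convex_gradients_def)
  let ?ts = "\<lambda>x. (1 - s) *\<^sub>R t\<^sub>0 x + s *\<^sub>R t\<^sub>1 x"
  have tsm: "?ts \<in> borel_measurable borel" using tm by measurable
  have Vc: "continuous_on (closure cube) V" using V unfolding smooth_on_def by (metis Ck_on.simps(1))
  have not_MInf: "map_entropy h V ubar (t \<circ> T) \<noteq> - \<infinity>" if t: "t \<in> borel_measurable borel" for t
  proof (cases "absolutely_continuous lborel (distr \<mu> borel t)")
    case True
    have "finite_measure (distr \<mu> borel t)"
      using t pf(2) by (intro finite_measure.finite_measure_distr) (simp_all add: \<mu>_def measurable_cong_sets[OF pf(1) refl])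
    then show ?thesis
      unfolding ent[OF t] \<mu>[symmetric] using True relative_entropy_RN_not_MInf[OF P h Vc] by simp
  qed (simp add: ent[OF t])
  \<comment> \<open>At the endpoints \<open>ereal 0\<close> annihilates even an infinite entropy, so
    the inequality must hold without any information on the other map, and it is an equality there.
    Strictly positive weights are what allows nondegeneracy of both derivatives to be
    assumed.\<close>
  consider "s = 0" | "s = 1" | "0 < s" "s < 1" using assms(11,12) by linarith
  then show ?thesis
  proof cases
    case 3
    show ?thesis
    proof (cases "absolutely_continuous lborel (distr \<mu> borel t\<^sub>0) \<and> absolutely_continuous lborel (distr \<mu> borel t\<^sub>1)")
      case True
      then have ac: "absolutely_continuous lborel (distr (density lborel (\<lambda>x. ennreal (\<rho> x))) borel t\<^sub>0)"
        "absolutely_continuous lborel (distr (density lborel (\<lambda>x. ennreal (\<rho> x))) borel t\<^sub>1)" unfolding \<mu> by auto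
      note dc = displacement_convexity[OF P h McC V hess \<rho> fin supp assms(9,10) 3 ac, folded \<mu>]
      show ?thesis
        using dc True by (simp add: ent[OF tm(1)] ent[OF tm(2)] ent[OF tsm] \<mu>[symmetric] \<mu>_def[symmetric])
    next
      case False
      then have "map_entropy h V ubar (t\<^sub>0 \<circ> T) = \<infinity> \<or> map_entropy h V ubar (t\<^sub>1 \<circ> T) = \<infinity>"
        using ent tm by auto
      then have "ereal (1 - s) * map_entropy h V ubar (t\<^sub>0 \<circ> T) + ereal s * map_entropy h V ubar (t\<^sub>1 \<circ> T)
         - ereal (lam / 2 * s * (1 - s) * (\<integral>x. (norm (t\<^sub>1 x - t\<^sub>0 x))\<^sup>2 \<partial>(push_forward ubar T))) = \<infinity>"
        using not_MInf[OF tm(1)] not_MInf[OF tm(2)] 3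
        by (cases "map_entropy h V ubar (t\<^sub>0 \<circ> T)"; cases "map_entropy h V ubar (t\<^sub>1 \<circ> T)") auto
      then show ?thesis by simp
    qed
  qed (simp_all add: zero_ereal_def[symmetric] one_ereal_def[symmetric])
qed

end
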